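(* Let $H_1$ and $H_2$ be graphs such that, if $\chi(H_2)\neq 4$, then \[e(H_1)>\frac{\mathrm{crit}(H_2)\cdot(\chi(H_2)-2)!\cdot(\chi(H_2)-2)^{v(H_2)-\chi(H_2)-k(H_2)+1}\cdot(\chi(H_1)-1)^{v(H_2)-k(H_2)}}{(\chi(H_2)-1)^{v(H_2)-k(H_2)}}\] and, if $\chi(H_2)=4$, then \[e(H_1)>\frac{\mathrm{crit}(H_2)\cdot 2^{v(H_2)-k(H_2)-1}\cdot(\chi(H_1)-1)^{v(H_2)-k(H_2)}}{3^{v(H_2)-k(H_2)}}.\] Then $(H_1,H_2)$ is not multiplicity good.
   Context: All graphs are finite and simple; $v(H)=|V(H)|$, $e(H)=|E(H)|$, $k(H)$ is the number of connected components, $\chi(H)$ the chromatic number, $\overline{G}$ the complement of $G$. An edge $e$ is critical if $\chi(H-e)<\chi(H)$; $\mathrm{crit}(H)$ is the number of critical edges of $H$. The homomorphism density $t(H,G)$ is the probability that a uniformly random map $V(H)\to V(G)$ sends every edge of $H$ to an edge of $G$. A pair $(H_1,H_2)$ is multiplicity good if \[(\chi(H_2)-1)^{v(H_1)-k(H_1)}\,t(H_1,G)+(\chi(H_1)-1)^{v(H_2)-k(H_2)}\,t(H_2,\overline{G})\geq 1-o(1)\] for all graphs $G$, where $o(1)\to 0$ as $v(G)\to\infty$. *)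

theory Defs
  imports Complex_Main "HOL-Library.FuncSet"
begin

record 'a ugraph =
  verts :: "'a set"
  edges :: "'a set set"

definition simple_graph :: "'a ugraph \<Rightarrow> bool" where
  "simple_graph H \<longleftrightarrow>
     finite (verts H) \<and> (\<forall>e\<in>edges H. e \<subseteq> verts H \<and> card e = 2)"

definition num_verts :: "'a ugraph \<Rightarrow> nat" where
  "num_verts H = card (verts H)"

definition num_edges :: "'a ugraph \<Rightarrow> nat" where
  "num_edges H = card (edges H)"

definition complement :: "'a ugraph \<Rightarrow> 'a ugraph" where
  "complement G =
     \<lparr>verts = verts G, edges = {e. e \<subseteq> verts G \<and> card e = 2 \<and> e \<notin> edges G}\<rparr>"

definition reachable :: "'a ugraph \<Rightarrow> ('a \<times> 'a) set" where
  "reachable H =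
     {(u, v). u \<in> verts H \<and> v \<in> verts H \<and> (u, v) \<in> {(x, y). {x, y} \<in> edges H}\<^sup>*}"

definition num_components :: "'a ugraph \<Rightarrow> nat" where
  "num_components H = card (verts H // reachable H)"

definition proper_colouring :: "'a ugraph \<Rightarrow> nat \<Rightarrow> ('a \<Rightarrow> nat) \<Rightarrow> bool" where
  "proper_colouring H k c \<longleftrightarrow>
     (\<forall>v\<in>verts H. c v < k) \<and> (\<forall>u v. {u, v} \<in> edges H \<longrightarrow> c u \<noteq> c v)"

definition chromatic_number :: "'a ugraph \<Rightarrow> nat" where
  "chromatic_number H = (LEAST k. \<exists>c. proper_colouring H k c)"

definition delete_edge :: "'a ugraph \<Rightarrow> 'a set \<Rightarrow> 'a ugraph" where
  "delete_edge H e = H\<lparr>edges := edges H - {e}\<rparr>"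

definition critical_edge :: "'a ugraph \<Rightarrow> 'a set \<Rightarrow> bool" where
  "critical_edge H e \<longleftrightarrow>
     e \<in> edges H \<and> chromatic_number (delete_edge H e) < chromatic_number H"

definition crit :: "'a ugraph \<Rightarrow> nat" where
  "crit H = card {e. critical_edge H e}"

definition hom_density :: "'a ugraph \<Rightarrow> 'b ugraph \<Rightarrow> real" where
  "hom_density H G =
     real (card {f \<in> verts H \<rightarrow>\<^sub>E verts G. \<forall>e\<in>edges H. f ` e \<in> edges G})
       / real (card (verts H \<rightarrow>\<^sub>E verts G))"

text \<open>
  The host graphs range over all finite simple graphs with vertices in \<^typ>\<open>nat\<close>; since all
  quantities involved are isomorphism invariant, this covers every finite simple graph.
  The function \<open>\<delta>\<close> is the \<open>o(1)\<close> term: it depends on the number of vertices of the host graph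
  only, i.e. the bound is uniform over host graphs of the same order.
\<close>

definition multiplicity_good :: "'a ugraph \<Rightarrow> 'b ugraph \<Rightarrow> bool" where
  "multiplicity_good H1 H2 \<longleftrightarrow>
     (\<exists>\<delta> :: nat \<Rightarrow> real. \<delta> \<longlonglongrightarrow> 0 \<and>
       (\<forall>G :: nat ugraph. simple_graph G \<longrightarrow>
          (real (chromatic_number H2) - 1) ^ (num_verts H1 - num_components H1)
              * hom_density H1 G
            + (real (chromatic_number H1) - 1) ^ (num_verts H2 - num_components H2)
              * hom_density H2 (complement G)
          \<ge> 1 - \<delta> (num_verts G)))"

end

theory Submission imports Defs begin

text \<open>
  Put \<open>q = \<chi>(H\<^sub>2) - 1\<close> and let \<open>G\<close> be a blow-up of \<open>q\<close> disjoint complete graphs on \<open>L\<close>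
  vertices. Then \<open>q\<^sup>v\<^sup>-\<^sup>k t(H\<^sub>1,G)\<close> is \<open>1 - e(H\<^sub>1)/L + O(1/L\<^sup>2)\<close>. In the complement, a homomorphism of
  \<open>H\<^sub>2\<close> gives a map to \<open>q\<close> parts in which every edge inside a part costs a factor \<open>1/L\<close>, so only the
  maps with exactly one such edge \<open>e\<close> matter: these are the \<open>q\<close>-colourings of \<open>H\<^sub>2 - e\<close>, where \<open>e\<close> is
  critical. For large \<open>L\<close> it remains to bound the number of these colourings.

  For \<open>q \<le> 3\<close> the trivial bound suffices. For \<open>q \<ge> 4\<close> the bound is that of Tomescu's conjecture,
  \<open>q! (q - 1)\<^sup>n\<^sup>-\<^sup>q\<close> for the \<open>n\<close>-vertex graph \<open>F\<close> obtained by contracting \<open>e\<close>. Identifying two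
  nonadjacent vertices of \<open>F\<close> gives a smaller graph of the same kind; hence in a minimal
  counterexample, under a uniformly random colouring, any two vertices share a colour with
  probability at most \<open>1/(q - 1)\<close>. If \<open>n < 3 q - 3\<close>, a slight sharpening of this contradicts the
  number of monochromatic pairs forced by pigeonhole, because criticality gives degrees at least \<open>q\<close>.
  For larger \<open>n\<close>, order the vertices so that each has earlier and later neighbours; colouring greedily along the
  order and along its reverse, the collision bound limits the average number of available colours,
  and the product of the two estimates is below the square of the claimed bound.
\<close>

section \<open>Colourings\<close>

text \<open>Criticality does not survive identifying vertices. The induction therefore keeps the
  neighbourhoods \<open>A\<close> and \<open>B\<close> of both ends of the contracted edge and the
  property \<open>blocked\<close>, which passes to supersets and survives identification, even of a
  vertex with the root. The collision bound is conditional: if the number N of colourings exceeds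
  \<open>tomescu q n\<close>, then a pair shares its colour in at most
  \<open>tomescu q (n - 1)\<close> < N/(q - 1) of them. For small n this is not enough. The source
  of the sharpening is that an identified graph either is minimal again, so that its own sharper
  bound applies, or has a vertex outside a smaller core that still keeps q - 2 neighbours. In the
  latter case the count is at most 2 (q - 1) + (q - 2)(q - 3)/2 times
  \<open>tomescu q (n - 3)\<close>, where (q - 1)^2 times would be allowed. The quotient is 7/9 for
  q = 4 and at most 11/16 for q \<ge> 5, but 1 for q = 3, where this computation leaves no
  slack.\<close>

definition cols :: "nat \<Rightarrow> ('a \<Rightarrow> 'a \<Rightarrow> bool) \<Rightarrow> 'a set \<Rightarrow> ('a \<Rightarrow> nat) set" where
  "cols q E V = {c \<in> V \<rightarrow>\<^sub>E {..<q}. \<forall>x\<in>V. \<forall>y\<in>V. E x y \<longrightarrow> c x \<noteq> c y}"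

lemma finite_cols [simp]: "finite V \<Longrightarrow> finite (cols q E V)"
  unfolding cols_def by (simp add: finite_PiE)

lemma cols_less: "c \<in> cols q E V \<Longrightarrow> x \<in> V \<Longrightarrow> c x < q"
  by (auto simp: cols_def)

lemma cols_proper: "c \<in> cols q E V \<Longrightarrow> x \<in> V \<Longrightarrow> y \<in> V \<Longrightarrow> E x y \<Longrightarrow> c x \<noteq> c y"
  by (auto simp: cols_def)

lemma cols_restrict: "c \<in> cols q E V \<Longrightarrow> W \<subseteq> V \<Longrightarrow> restrict c W \<in> cols q E W"
  unfolding cols_def by auto

text \<open>A new vertex may take any colour missing from its neighbours. The weight
  \<open>f\<close> lets one identity serve both plain counting and the greedy probabilities.\<close>

lemma sum_cols_insert:
  fixes f :: "('a \<Rightarrow> nat) \<Rightarrow> real"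
  assumes W: "finite W" "z \<notin> W" and E: "symp E" "irreflp E"
  shows "(\<Sum>c\<in>cols q E (insert z W). f (restrict c W)) =
         (\<Sum>c\<in>cols q E W. f c * real (q - card (c ` {y\<in>W. E z y})))"
proof -
  let ?F = "\<lambda>c. {..<q} - c ` {y\<in>W. E z y}"
  let ?g = "\<lambda>(c, i). c(z := i)"
  have symE: "E x y \<Longrightarrow> E y x" for x y using E(1) by (auto dest: sympD)
  have irr: "\<not> E x x" for x using E(2) by (auto simp: irreflp_def)
  have bij: "bij_betw ?g (Sigma (cols q E W) ?F) (cols q E (insert z W))"
  proof (rule bij_betwI[where g = "\<lambda>c. (restrict c W, c z)"])
    show "?g \<in> Sigma (cols q E W) ?F \<rightarrow> cols q E (insert z W)"
    proof (rule funcsetI)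
      fix p assume "p \<in> Sigma (cols q E W) ?F"
      then obtain c i where p: "p = (c, i)" and c: "c \<in> cols q E W" and i: "i < q"
        and i': "\<And>y. y \<in> W \<Longrightarrow> E z y \<Longrightarrow> c y \<noteq> i"
        by auto
      have "c(z := i) \<in> insert z W \<rightarrow>\<^sub>E {..<q}"
        using c i unfolding cols_def by (intro PiE_fun_upd) auto
      moreover have "\<forall>x\<in>insert z W. \<forall>y\<in>insert z W. E x y \<longrightarrow> (c(z := i)) x \<noteq> (c(z := i)) y"
      proof (intro ballI impI)
        fix x y assume "x \<in> insert z W" "y \<in> insert z W" "E x y"
        then show "(c(z := i)) x \<noteq> (c(z := i)) y"
          using i'[of x] i'[of y] symE[of x y] irr[of z] cols_proper[OF c, of x y] by auto
      qed
      ultimately show "?g p \<in> cols q E (insert z W)" by (simp only: p cols_def mem_Collect_eq case_prod_conv)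
    qed
    show "(\<lambda>c. (restrict c W, c z)) \<in> cols q E (insert z W) \<rightarrow> Sigma (cols q E W) ?F"
    proof (rule funcsetI)
      fix c assume c: "c \<in> cols q E (insert z W)"
      have "restrict c W \<in> cols q E W" using c by (rule cols_restrict) auto
      moreover have "c z \<noteq> c y" if "y \<in> W" "E z y" for y
        using cols_proper[OF c, of z y] that by auto
      ultimately show "(restrict c W, c z) \<in> Sigma (cols q E W) ?F"
        using cols_less[OF c, of z] by auto
    qed
    show "(restrict (?g p) W, ?g p z) = p" if "p \<in> Sigma (cols q E W) ?F" for p
    proof -
      obtain c i where p: "p = (c, i)" by force
      with that have "c \<in> extensional W" by (auto simp: cols_def PiE_def)
      then have "restrict (c(z := i)) W = c"
        using W(2) by (auto simp: fun_eq_iff restrict_def extensional_def)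
      then show ?thesis by (simp add: p)
    qed
    show "?g (restrict c W, c z) = c" if "c \<in> cols q E (insert z W)" for c
    proof -
      have "c \<in> extensional (insert z W)" using that by (auto simp: cols_def PiE_def)
      then show ?thesis by (auto simp: fun_eq_iff restrict_def extensional_def)
    qed
  qed
  have "(\<Sum>c\<in>cols q E (insert z W). f (restrict c W)) =
        (\<Sum>p\<in>Sigma (cols q E W) ?F. f (restrict (?g p) W))"
    by (rule sum.reindex_bij_betw[OF bij, symmetric])
  also have "\<dots> = (\<Sum>p\<in>Sigma (cols q E W) ?F. f (fst p))"
  proof (rule sum.cong[OF refl])
    fix p assume p: "p \<in> Sigma (cols q E W) ?F"
    obtain c i where pc: "p = (c, i)" by force
    with p have "c \<in> extensional W" by (auto simp: cols_def PiE_def)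
    then have "restrict (?g p) W = fst p"
      using W(2) by (auto simp: pc fun_eq_iff restrict_def extensional_def)
    then show "f (restrict (?g p) W) = f (fst p)" by simp
  qed
  also have "\<dots> = (\<Sum>c\<in>cols q E W. \<Sum>i\<in>?F c. f c)"
    using W by (subst sum.Sigma) (auto simp: case_prod_unfold)
  also have "\<dots> = (\<Sum>c\<in>cols q E W. f c * real (q - card (c ` {y\<in>W. E z y})))"
  proof (rule sum.cong[OF refl])
    fix c assume c: "c \<in> cols q E W"
    have "c ` {y\<in>W. E z y} \<subseteq> {..<q}" using c by (auto dest: cols_less)
    then have "card (?F c) = q - card (c ` {y\<in>W. E z y})"
      using W(1) by (subst card_Diff_subset) auto
    then show "(\<Sum>i\<in>?F c. f c) = f c * real (q - card (c ` {y\<in>W. E z y}))" by simp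
  qed
  finally show ?thesis .
qed

section \<open>Monochromatic pairs and available colours\<close>

definition mono_pairs :: "('a \<Rightarrow> nat) \<Rightarrow> 'a set \<Rightarrow> ('a \<times> 'a) set" where
  "mono_pairs c T = {(a, b). a \<in> T \<and> b \<in> T \<and> a \<noteq> b \<and> c a = c b}"

lemma card_off_diagonal:
  assumes "finite K"
  shows "card (K \<times> K - Id_on K) = card K * card K - card K"
proof -
  have "Id_on K = (\<lambda>a. (a, a)) ` K" by auto
  then have "card (Id_on K) = card K" "finite (Id_on K)"
    using assms by (auto simp: card_image inj_on_def)
  moreover have "Id_on K \<subseteq> K \<times> K" by auto
  ultimately show ?thesis by (simp add: card_Diff_subset card_cartesian_product)
qed

text \<open>Summing \<open>(k - s) (k - s - 1) \<ge> 0\<close> over the sizes \<open>k\<close> of the colour classes.\<close>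

lemma mono_pairs_lower_bound:
  assumes "finite T"
  shows "2 * real s * real (card T) \<le> real (card (mono_pairs c T)) + real s * (real s + 1) * real (card (c ` T))"
proof -
  define K where "K j = {a\<in>T. c a = j}" for j
  have finK: "finite (K j)" for j using assms by (auto simp: K_def)
  have cT: "real (card T) = (\<Sum>j\<in>c ` T. real (card (K j)))"
  proof -
    have "T = (\<Union>j\<in>c ` T. K j)" by (auto simp: K_def)
    then have "card T = (\<Sum>j\<in>c ` T. card (K j))"
      using assms by (subst card_UN_disjoint[symmetric]) (auto simp: K_def)
    then show ?thesis by simp
  qed
  have "mono_pairs c T = (\<Union>j\<in>c ` T. K j \<times> K j - Id_on (K j))"
    unfolding mono_pairs_def K_def by (auto simp: Id_on_def)
  moreover have "card (\<Union>j\<in>c ` T. K j \<times> K j - Id_on (K j)) = (\<Sum>j\<in>c ` T. card (K j \<times> K j - Id_on (K j)))"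
  proof (rule card_UN_disjoint)
    show "\<forall>i\<in>c ` T. \<forall>j\<in>c ` T. i \<noteq> j \<longrightarrow>
      (K i \<times> K i - Id_on (K i)) \<inter> (K j \<times> K j - Id_on (K j)) = {}"
      by (auto simp: K_def)
  qed (use assms finK in auto)
  moreover have "card (K j \<times> K j - Id_on (K j)) = card (K j) * card (K j) - card (K j)" for j
    by (rule card_off_diagonal[OF finK])
  ultimately have cM: "real (card (mono_pairs c T)) = (\<Sum>j\<in>c ` T. real (card (K j)) * (real (card (K j)) - 1))"
    by (simp add: of_nat_diff algebra_simps)
  have "2 * real s * real k \<le> real k * (real k - 1) + real s * (real s + 1)" for k :: nat
  proof -
    have "(int k - int s) * (int k - int s - 1) \<ge> 0"
      by (cases "k \<le> s") (auto intro: mult_nonpos_nonpos mult_nonneg_nonneg)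
    then have "real_of_int ((int k - int s) * (int k - int s - 1)) \<ge> 0" by linarith
    then show ?thesis by (simp add: algebra_simps)
  qed
  then have "(\<Sum>j\<in>c ` T. 2 * real s * real (card (K j)))
     \<le> (\<Sum>j\<in>c ` T. real (card (K j)) * (real (card (K j)) - 1) + real s * (real s + 1))"
    by (intro sum_mono) simp
  moreover have "(\<Sum>j\<in>c ` T. 2 * real s * real (card (K j))) = 2 * real s * real (card T)"
    by (simp only: cT sum_distrib_left)
  ultimately show ?thesis
    by (simp add: cM sum.distrib mult.commute)
qed

definition mono_cols :: "nat \<Rightarrow> ('a \<Rightarrow> 'a \<Rightarrow> bool) \<Rightarrow> 'a set \<Rightarrow> 'a \<Rightarrow> 'a \<Rightarrow> ('a \<Rightarrow> nat) set" where
  "mono_cols q E V a b = {c \<in> cols q E V. c a = c b}"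

text \<open>Double counting of colourings against ordered pairs; adjacent pairs are never
  monochromatic.\<close>

lemma sum_card_mono_pairs:
  assumes V: "finite V" and T: "T \<subseteq> V"
    and \<mu>: "\<And>a b. a \<in> T \<Longrightarrow> b \<in> T \<Longrightarrow> a \<noteq> b \<Longrightarrow> \<not> E a b \<Longrightarrow> real (card (mono_cols q E V a b)) \<le> \<mu>"
  shows "(\<Sum>c\<in>cols q E V. real (card (mono_pairs c T)))
    \<le> real (card {(a, b). a \<in> T \<and> b \<in> T \<and> a \<noteq> b \<and> \<not> E a b}) * \<mu>"
proof -
  let ?P = "{(a, b). a \<in> T \<and> b \<in> T \<and> a \<noteq> b \<and> \<not> E a b}"
  have fT: "finite T" using V T finite_subset by auto
  have fP: "finite ?P" by (rule finite_subset[of _ "T \<times> T"]) (auto simp: fT)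
  have "(\<Sum>c\<in>cols q E V. real (card (mono_pairs c T)))
      = (\<Sum>c\<in>cols q E V. \<Sum>p\<in>?P. if c (fst p) = c (snd p) then 1 else 0)"
  proof (rule sum.cong[OF refl])
    fix c assume c: "c \<in> cols q E V"
    have "\<And>a b. a \<in> T \<Longrightarrow> b \<in> T \<Longrightarrow> c a = c b \<Longrightarrow> \<not> E a b"
      using cols_proper[OF c] T by blast
    then have "mono_pairs c T = {p\<in>?P. c (fst p) = c (snd p)}"
      by (auto simp: mono_pairs_def)
    then show "real (card (mono_pairs c T)) = (\<Sum>p\<in>?P. if c (fst p) = c (snd p) then 1 else 0)"
      using fP by (simp add: sum.If_cases Int_def)
  qed
  also have "\<dots> = (\<Sum>p\<in>?P. \<Sum>c\<in>cols q E V. if c (fst p) = c (snd p) then 1 else 0)"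
    by (rule sum.swap)
  also have "\<dots> = (\<Sum>p\<in>?P. real (card (mono_cols q E V (fst p) (snd p))))"
    using V by (simp add: sum.If_cases Int_def mono_cols_def)
  also have "\<dots> \<le> (\<Sum>p\<in>?P. \<mu>)"
    by (intro sum_mono) (auto intro: \<mu>)
  finally show ?thesis by simp
qed

text \<open>The loss |T| - |c(T)| is at most the number of unordered monochromatic pairs in
  \<open>T\<close>, and those are bounded on average by \<open>\<mu>\<close>. \<open>T\<close> is a
  part of the coloured neighbourhood \<open>T'\<close>, so that its size can be prescribed.\<close>

lemma sum_avail_le:
  assumes V: "finite V" and T: "T \<subseteq> T'" "T' \<subseteq> V" and t: "card T \<le> q" and \<mu>0: "0 \<le> \<mu>"
    and \<mu>: "\<And>a b. a \<in> T \<Longrightarrow> b \<in> T \<Longrightarrow> a \<noteq> b \<Longrightarrow> \<not> E a b \<Longrightarrow> real (card (mono_cols q E V a b)) \<le> \<mu>"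
  shows "(\<Sum>c\<in>cols q E V. real (q - card (c ` T')))
     \<le> (real q - real (card T)) * real (card (cols q E V)) + real (card T) * (real (card T) - 1) / 2 * \<mu>"
proof -
  have fT: "finite T" "finite T'" using finite_subset[OF T(2) V] finite_subset[OF T(1)] by auto
  have TV: "T \<subseteq> V" using T by auto
  have "(\<Sum>c\<in>cols q E V. real (q - card (c ` T')))
     \<le> (\<Sum>c\<in>cols q E V. (real q - real (card T)) + real (card (mono_pairs c T)) / 2)"
  proof (rule sum_mono)
    fix c assume "c \<in> cols q E V"
    have "card (c ` T) \<le> card (c ` T')" using T fT by (intro card_mono) auto
    moreover have "card (c ` T') \<le> card {..<q}"
      using \<open>c \<in> cols q E V\<close> T(2) by (intro card_mono) (auto dest: cols_less)
    moreover have "2 * real (card T) \<le> real (card (mono_pairs c T)) + 2 * real (card (c ` T))"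
      using mono_pairs_lower_bound[OF fT(1), of 1 c] by simp
    ultimately show "real (q - card (c ` T')) \<le> (real q - real (card T)) + real (card (mono_pairs c T)) / 2"
      by (simp add: of_nat_diff)
  qed
  also have "\<dots> = (real q - real (card T)) * real (card (cols q E V))
        + (\<Sum>c\<in>cols q E V. real (card (mono_pairs c T))) / 2"
    by (simp add: sum.distrib sum_divide_distrib)
  also have "(\<Sum>c\<in>cols q E V. real (card (mono_pairs c T))) \<le> real (card T) * (real (card T) - 1) * \<mu>"
  proof -
    let ?P = "{(a, b). a \<in> T \<and> b \<in> T \<and> a \<noteq> b \<and> \<not> E a b}"
    have "card ?P \<le> card (T \<times> T - Id_on T)"
      using fT by (intro card_mono) auto
    also have "\<dots> = card T * card T - card T"
      by (rule card_off_diagonal[OF fT(1)])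
    finally have "real (card ?P) \<le> real (card T * card T - card T)" by linarith
    also have "\<dots> = real (card T) * (real (card T) - 1)" by (simp add: of_nat_diff algebra_simps)
    finally have "real (card ?P) * \<mu> \<le> real (card T) * (real (card T) - 1) * \<mu>"
      using \<mu>0 by (intro mult_right_mono)
    with sum_card_mono_pairs[OF V TV \<mu>] show ?thesis by linarith
  qed
  finally show ?thesis by simp
qed

section \<open>Rooted graphs whose root cannot be split\<close>

text \<open>\<open>E\<close>, \<open>A\<close> and \<open>B\<close> live on the whole type and
  subgraphs are induced, so deleting vertices changes only the vertex set. \<open>A\<close> and
  \<open>B\<close> may overlap: a common member is adjacent to both ends of the contracted
  edge.\<close>

definition rooted :: "('a \<Rightarrow> 'a \<Rightarrow> bool) \<Rightarrow> 'a \<Rightarrow> 'a set \<Rightarrow> 'a set \<Rightarrow> bool" where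
  "rooted E s A B \<longleftrightarrow> symp E \<and> irreflp E \<and> {y. E s y} = A \<union> B"

text \<open>The root \<open>s\<close> stands for a contracted edge whose ends have the neighbourhoods \<open>A\<close> and \<open>B\<close>.
  \<open>blocked\<close> says that the graph before the contraction has no \<open>q\<close>-colouring: the ends can
  never receive two different colours \<open>i\<close> and \<open>j\<close>.\<close>

definition blocked ::
  "nat \<Rightarrow> ('a \<Rightarrow> 'a \<Rightarrow> bool) \<Rightarrow> 'a \<Rightarrow> 'a set \<Rightarrow> 'a set \<Rightarrow> 'a set \<Rightarrow> bool" where
  "blocked q E s A B V \<longleftrightarrow>
     (\<forall>c\<in>cols q E (V - {s}). \<forall>i<q. \<forall>j<q. i \<noteq> j \<longrightarrow>
        i \<in> c ` (A \<inter> (V - {s})) \<or> j \<in> c ` (B \<inter> (V - {s})))"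

text \<open>Connectedness in the form used for growing a set from the root by one adjacent vertex at
  a time.\<close>

definition conn :: "('a \<Rightarrow> 'a \<Rightarrow> bool) \<Rightarrow> 'a \<Rightarrow> 'a set \<Rightarrow> bool" where
  "conn E s V \<longleftrightarrow> (\<forall>W. s \<in> W \<longrightarrow> W \<subset> V \<longrightarrow> (\<exists>x\<in>W. \<exists>y\<in>V - W. E x y))"

definition minimal_blocked ::
  "nat \<Rightarrow> ('a \<Rightarrow> 'a \<Rightarrow> bool) \<Rightarrow> 'a \<Rightarrow> 'a set \<Rightarrow> 'a set \<Rightarrow> 'a set \<Rightarrow> bool" where
  "minimal_blocked q E s A B V \<longleftrightarrow>
     s \<in> V \<and> blocked q E s A B V \<and> (\<forall>W. s \<in> W \<longrightarrow> W \<subset> V \<longrightarrow> \<not> blocked q E s A B W)"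

lemma rootedD:
  assumes "rooted E s A B"
  shows "E x y \<Longrightarrow> E y x" "\<not> E x x" "E s y \<longleftrightarrow> y \<in> A \<or> y \<in> B"
proof -
  show "E y x" if "E x y" using assms that unfolding rooted_def by (blast dest: sympD)
  show "\<not> E x x" using assms by (simp add: rooted_def irreflp_def)
  have "y \<in> {y. E s y} \<longleftrightarrow> y \<in> A \<union> B" using assms by (simp add: rooted_def)
  then show "E s y \<longleftrightarrow> y \<in> A \<or> y \<in> B" by simp
qed

lemma blockedE:
  assumes "\<not> blocked q E s A B V"
  obtains c i j where "c \<in> cols q E (V - {s})" "i < q" "j < q" "i \<noteq> j"
    "i \<notin> c ` (A \<inter> (V - {s}))" "j \<notin> c ` (B \<inter> (V - {s}))"
proof -
  have "\<exists>c\<in>cols q E (V - {s}). \<exists>i<q. \<exists>j<q. i \<noteq> j \<and>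
      \<not> (i \<in> c ` (A \<inter> (V - {s})) \<or> j \<in> c ` (B \<inter> (V - {s})))"
    using assms unfolding blocked_def by meson
  then show thesis using that by (elim bexE exE conjE) simp
qed

lemma blockedD:
  assumes "blocked q E s A B V" "c \<in> cols q E (V - {s})" "i < q" "j < q" "i \<noteq> j"
  shows "(\<exists>a\<in>A \<inter> (V - {s}). c a = i) \<or> (\<exists>b\<in>B \<inter> (V - {s}). c b = j)"
proof -
  have "i \<in> c ` (A \<inter> (V - {s})) \<or> j \<in> c ` (B \<inter> (V - {s}))"
    using assms by (simp add: blocked_def)
  then show ?thesis by blast
qed

lemma minimal_blockedD:
  assumes "minimal_blocked q E s A B V"
  shows "s \<in> V" "blocked q E s A B V" "s \<in> W \<Longrightarrow> W \<subset> V \<Longrightarrow> \<not> blocked q E s A B W"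
  using assms by (simp_all add: minimal_blocked_def)

lemma colsI:
  assumes "c \<in> extensional V" "\<And>x. x \<in> V \<Longrightarrow> c x < q"
    "\<And>x y. x \<in> V \<Longrightarrow> y \<in> V \<Longrightarrow> E x y \<Longrightarrow> c x \<noteq> c y"
  shows "c \<in> cols q E V"
  unfolding cols_def
proof (intro CollectI conjI ballI impI PiE_I)
  show "c x = undefined" if "x \<notin> V" for x using assms(1) that by (rule extensional_arb)
qed (use assms in auto)

lemma blocked_mono:
  assumes "blocked q E s A B W" "W \<subseteq> V"
  shows "blocked q E s A B V"
  unfolding blocked_def
proof (intro ballI allI impI)
  fix c i j assume c: "c \<in> cols q E (V - {s})" and ij: "i < q" "j < q" "i \<noteq> j"
  have "restrict c (W - {s}) \<in> cols q E (W - {s})"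
    using c by (rule cols_restrict) (use assms(2) in auto)
  from blockedD[OF assms(1) this ij]
  show "i \<in> c ` (A \<inter> (V - {s})) \<or> j \<in> c ` (B \<inter> (V - {s}))"
    using assms(2) by auto
qed

text \<open>A colour missing from \<open>V\<close> could be used to tell the two halves of the root apart.\<close>

lemma blocked_cols_onto:
  assumes r: "rooted E s A B" and b: "blocked q E s A B V" and s: "s \<in> V" and c: "c \<in> cols q E V"
  shows "c ` V = {..<q}"
proof
  show "c ` V \<subseteq> {..<q}" using c by (auto dest: cols_less)
  show "{..<q} \<subseteq> c ` V"
  proof
    fix i assume i: "i \<in> {..<q}"
    show "i \<in> c ` V"
    proof (rule ccontr)
      assume n: "i \<notin> c ` V"
      have r': "restrict c (V - {s}) \<in> cols q E (V - {s})" using c by (rule cols_restrict) auto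
      have "i \<noteq> c s" using n s by auto
      from blockedD[OF b r' _ cols_less[OF c s] this] i n
      obtain y where "y \<in> B" "y \<in> V" "y \<noteq> s" "c y = c s" by auto
      then show False using cols_proper[OF c s, of y] rootedD(3)[OF r] by auto
    qed
  qed
qed

lemma ex_minimal_blocked:
  assumes "finite V" "s \<in> V" "blocked q E s A B V"
  obtains W where "W \<subseteq> V" "minimal_blocked q E s A B W"
proof -
  let ?P = "\<lambda>W. s \<in> W \<and> W \<subseteq> V \<and> blocked q E s A B W"
  obtain W where W: "?P W" and least: "\<And>W'. ?P W' \<Longrightarrow> card W \<le> card W'"
    using ex_has_least_nat[of ?P V card] assms by auto
  have "\<not> blocked q E s A B W'" if "s \<in> W'" "W' \<subset> W" for W'
  proof
    assume "blocked q E s A B W'"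
    then have "card W \<le> card W'" using least[of W'] that W by auto
    moreover have "card W' < card W"
      using that W assms(1) by (meson finite_subset psubset_card_mono)
    ultimately show False by simp
  qed
  with W have "minimal_blocked q E s A B W" by (auto simp: minimal_blocked_def)
  with W that show ?thesis by auto
qed

text \<open>Degree bound for a vertex-critical graph, read before the contraction: if fewer than q
  colours were forbidden at \<open>z\<close>, a colouring without \<open>z\<close> could be
  extended. A vertex in both \<open>A\<close> and \<open>B\<close> sees both ends of the edge and
  counts twice.\<close>

lemma minimal_blocked_degree:
  assumes r: "rooted E s A B" and m: "minimal_blocked q E s A B V" and V: "finite V"
    and z: "z \<in> V" "z \<noteq> s"
  shows "q \<le> card {y\<in>V - {s}. E z y} + (if z \<in> A then 1 else 0) + (if z \<in> B then 1 else 0)"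
proof (rule ccontr)
  assume less: "\<not> ?thesis"
  have "\<not> blocked q E s A B (V - {z})"
    using z minimal_blockedD(1)[OF m] by (intro minimal_blockedD(3)[OF m]) auto
  then obtain c i j where c: "c \<in> cols q E (V - {z} - {s})" and ij: "i < q" "j < q" "i \<noteq> j"
    and i: "i \<notin> c ` (A \<inter> (V - {z} - {s}))" and j: "j \<notin> c ` (B \<inter> (V - {z} - {s}))"
    by (rule blockedE)
  \<comment> \<open>The colours forbidden at \<open>z\<close>; the two halves of the root carry the
    colours \<open>i\<close> and \<open>j\<close>.\<close>
  define X where "X = c ` {y\<in>V - {s}. E z y} \<union> (if z \<in> A then {i} else {}) \<union> (if z \<in> B then {j} else {})"
  have "card X \<le> card (c ` {y\<in>V - {s}. E z y}) + card (if z \<in> A then {i} else {})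
      + card (if z \<in> B then {j} else {})"
    unfolding X_def
    using card_Un_le[of "c ` {y\<in>V - {s}. E z y} \<union> (if z \<in> A then {i} else {})" "if z \<in> B then {j} else {}"]
      card_Un_le[of "c ` {y\<in>V - {s}. E z y}" "if z \<in> A then {i} else {}"] by linarith
  also have "card (c ` {y\<in>V - {s}. E z y}) \<le> card {y\<in>V - {s}. E z y}"
    using V by (intro card_image_le) auto
  finally have "card X < q" using less by (auto split: if_splits)
  moreover have "finite X" using V by (auto simp: X_def)
  ultimately have "\<not> {..<q} \<subseteq> X" using card_mono[of X "{..<q}"] by auto
  then obtain k where k: "k < q" "k \<notin> X" by auto
  have c': "c(z := k) \<in> cols q E (V - {s})"
  proof (rule colsI)
    show "c(z := k) \<in> extensional (V - {s})"
      using c z by (auto simp: cols_def PiE_def extensional_def)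
    show "(c(z := k)) x < q" if "x \<in> V - {s}" for x
      using that k cols_less[OF c, of x] by auto
    show "(c(z := k)) x \<noteq> (c(z := k)) y" if "x \<in> V - {s}" "y \<in> V - {s}" "E x y" for x y
    proof -
      have kz: "c w \<noteq> k" if "w \<in> V - {s}" "E z w" for w using that k by (auto simp: X_def)
      have "E y x" "\<not> E z z" using that rootedD[OF r] by blast+
      then show ?thesis
        using that kz[of x] kz[of y] cols_proper[OF c, of x y] by auto
    qed
  qed
  have "blocked q E s A B V" by (rule minimal_blockedD(2)[OF m])
  from blockedD[OF this c' ij] show False
    using i j k z by (auto simp: X_def split: if_splits)
qed

text \<open>If no edge left \<open>W\<close>, a colouring showing that \<open>W\<close> is not
  blocked could be completed by \<open>c0\<close> outside \<open>W\<close>, and \<open>V\<close>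
  would not be blocked either.\<close>

lemma minimal_blocked_conn:
  assumes r: "rooted E s A B" and m: "minimal_blocked q E s A B V" and c0: "c0 \<in> cols q E V"
  shows "conn E s V"
  unfolding conn_def
proof (intro allI impI)
  fix W assume W: "s \<in> W" "W \<subset> V"
  show "\<exists>x\<in>W. \<exists>y\<in>V - W. E x y"
  proof (rule ccontr)
    assume "\<not> ?thesis"
    then have no: "\<not> E x y" "\<not> E y x" if "x \<in> W" "y \<in> V" "y \<notin> W" for x y
      using that rootedD(1)[OF r] by blast+
    have "\<not> blocked q E s A B W" by (rule minimal_blockedD(3)[OF m W])
    then obtain c i j where c: "c \<in> cols q E (W - {s})" and ij: "i < q" "j < q" "i \<noteq> j"
      and i: "i \<notin> c ` (A \<inter> (W - {s}))" and j: "j \<notin> c ` (B \<inter> (W - {s}))"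
      by (rule blockedE)
    define c' where "c' = restrict (\<lambda>x. if x \<in> W then c x else c0 x) (V - {s})"
    have "c' \<in> cols q E (V - {s})"
    proof (rule colsI)
      show "c' x < q" if "x \<in> V - {s}" for x
        using that cols_less[OF c, of x] cols_less[OF c0, of x] by (auto simp: c'_def)
      show "c' x \<noteq> c' y" if "x \<in> V - {s}" "y \<in> V - {s}" "E x y" for x y
        using that no[of x y] no[of y x] cols_proper[OF c, of x y] cols_proper[OF c0, of x y]
        by (auto simp: c'_def)
    qed (auto simp: c'_def)
    then have "(\<exists>a\<in>A \<inter> (V - {s}). c' a = i) \<or> (\<exists>b\<in>B \<inter> (V - {s}). c' b = j)"
      using ij by (intro blockedD[OF minimal_blockedD(2)[OF m]])
    moreover have "y \<in> W" if "y \<in> A \<union> B" "y \<in> V" for y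
      using no[of s y] that W rootedD(3)[OF r, of y] by auto
    ultimately show False using i j by (auto simp: c'_def)
  qed
qed

text \<open>A cut vertex \<open>a\<close> is impossible: after permuting the colours behind it, colourings of
  the two sides can be glued.\<close>

lemma minimal_blocked_no_cut:
  assumes r: "rooted E s A B" and m: "minimal_blocked q E s A B V" and c0: "c0 \<in> cols q E V"
    and Q: "Q \<subseteq> V - {s}" "Q \<noteq> {}" and a: "a \<in> V - Q" "a \<noteq> s"
    and cut: "\<And>x y. x \<in> V - Q \<Longrightarrow> y \<in> Q \<Longrightarrow> E x y \<Longrightarrow> x = a"
  shows False
proof -
  have "s \<in> V" by (rule minimal_blockedD(1)[OF m])
  have "\<not> blocked q E s A B (V - Q)"
    using Q \<open>s \<in> V\<close> by (intro minimal_blockedD(3)[OF m]) auto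
  then obtain c i j where c: "c \<in> cols q E (V - Q - {s})" and ij: "i < q" "j < q" "i \<noteq> j"
    and i: "i \<notin> c ` (A \<inter> (V - Q - {s}))" and j: "j \<notin> c ` (B \<inter> (V - Q - {s}))"
    by (rule blockedE)
  define \<pi> where "\<pi> k = (if k = c0 a then c a else if k = c a then c0 a else k)" for k
  have \<pi>: "\<pi> k = \<pi> l \<longleftrightarrow> k = l" for k l by (auto simp: \<pi>_def)
  have \<pi>a: "\<pi> (c0 a) = c a" by (simp add: \<pi>_def)
  have "c a < q" using a by (intro cols_less[OF c]) auto
  moreover have "c0 a < q" using a by (intro cols_less[OF c0]) auto
  ultimately have \<pi>q: "\<pi> k < q" if "k < q" for k using that by (auto simp: \<pi>_def)
  define c' where "c' = restrict (\<lambda>x. if x \<in> Q then \<pi> (c0 x) else c x) (V - {s})"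
  have "c' \<in> cols q E (V - {s})"
  proof (rule colsI)
    show "c' x < q" if "x \<in> V - {s}" for x
      using that cols_less[OF c, of x] \<pi>q[OF cols_less[OF c0, of x]] by (auto simp: c'_def)
    have cross: "c' x \<noteq> c' y" if "x \<in> V - {s} - Q" "y \<in> Q" "E x y" for x y
    proof -
      have "x = a" using cut[of x y] that by auto
      moreover have "c0 a \<noteq> c0 y" using cols_proper[OF c0, of a y] that \<open>x = a\<close> Q by auto
      ultimately show ?thesis using that Q a \<pi>a \<pi>[of "c0 a" "c0 y"] by (auto simp: c'_def)
    qed
    show "c' x \<noteq> c' y" if "x \<in> V - {s}" "y \<in> V - {s}" "E x y" for x y
    proof -
      have "E y x" using rootedD(1)[OF r] that by blast
      then show ?thesis
        using that cross[of x y] cross[of y x] cols_proper[OF c, of x y] cols_proper[OF c0, of x y] \<pi>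
        by (cases "x \<in> Q"; cases "y \<in> Q") (auto simp: c'_def)
    qed
  qed (auto simp: c'_def)
  then have "(\<exists>a\<in>A \<inter> (V - {s}). c' a = i) \<or> (\<exists>b\<in>B \<inter> (V - {s}). c' b = j)"
    using ij by (intro blockedD[OF minimal_blockedD(2)[OF m]])
  moreover have "y \<notin> Q" if "y \<in> A \<union> B" for y
    using cut[of s y] that \<open>s \<in> V\<close> Q a rootedD(3)[OF r, of y] by auto
  ultimately show False using i j by (auto simp: c'_def)
qed

section \<open>Growing connected sets\<close>

lemma connE:
  assumes "conn E s V" "s \<in> W" "W \<subset> V"
  obtains x y where "x \<in> W" "y \<in> V" "y \<notin> W" "E x y"
proof -
  have "\<exists>x\<in>W. \<exists>y\<in>V - W. E x y" using assms by (simp add: conn_def)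
  then show thesis using that by blast
qed

lemma conn_insert:
  assumes "s \<in> W" "conn E s W" "a \<in> W" "E a b"
  shows "conn E s (insert b W)"
  unfolding conn_def
proof (intro allI impI)
  fix X assume X: "s \<in> X" "X \<subset> insert b W"
  show "\<exists>x\<in>X. \<exists>y\<in>insert b W - X. E x y"
  proof (cases "W \<subseteq> X")
    case True
    then have "b \<notin> X" using X by blast
    moreover have "a \<in> X" using True assms(3) by blast
    ultimately show ?thesis using assms(4) by blast
  next
    case False
    then have "s \<in> X \<inter> W" "X \<inter> W \<subset> W" using X assms(1) by blast+
    then obtain x y where "x \<in> X \<inter> W" "y \<in> W" "y \<notin> X \<inter> W" "E x y"
      by (rule connE[OF assms(2)])
    then show ?thesis by blast
  qed
qed

text \<open>A largest connected proper superset of \<open>C\<close> misses exactly one vertex, since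
  adding an adjacent vertex keeps it connected.\<close>

lemma ex_last_vertex:
  assumes V: "finite V" and s: "s \<in> C" and C: "C \<subset> V" "conn E s C" and conn: "conn E s V"
  obtains z where "z \<in> V - C" "conn E s (V - {z})"
proof -
  let ?P = "\<lambda>W. C \<subseteq> W \<and> W \<subset> V \<and> conn E s W"
  have "\<exists>W. ?P W \<and> (\<forall>W'. ?P W' \<longrightarrow> card W' \<le> card W)"
    by (rule ex_has_greatest_nat[of ?P C card "Suc (card V)"])
      (use C V in \<open>auto simp: less_Suc_eq_le intro!: card_mono\<close>)
  then obtain W where W: "?P W" and max: "\<And>W'. ?P W' \<Longrightarrow> card W' \<le> card W" by blast
  have "s \<in> W" using W s by auto
  then obtain a b where ab: "a \<in> W" "b \<in> V" "b \<notin> W" "E a b"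
    using connE[OF conn, of W] W by blast
  have conn': "conn E s (insert b W)" using W ab \<open>s \<in> W\<close> by (intro conn_insert) auto
  have "finite W" using W V finite_subset[of W V] by auto
  then have "card (insert b W) > card W" using ab by auto
  then have "insert b W = V" using max[of "insert b W"] conn' W ab by auto
  then have "V - {b} = W" using ab by auto
  with W ab that[of b] show ?thesis by auto
qed

section \<open>Identifying two vertices\<close>

text \<open>\<open>y\<close> keeps its old adjacencies here; the identified graph is the restriction
  to a vertex set without \<open>y\<close>.\<close>

definition merge_adj :: "('a \<Rightarrow> 'a \<Rightarrow> bool) \<Rightarrow> 'a \<Rightarrow> 'a \<Rightarrow> 'a \<Rightarrow> 'a \<Rightarrow> bool" where
  "merge_adj E x y a b \<longleftrightarrow> E a b \<or> (a = x \<and> E y b) \<or> (b = x \<and> E a y)"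

text \<open>A vertex merged into the root is merged into its \<open>A\<close>-half.\<close>

definition merge_A :: "('a \<Rightarrow> 'a \<Rightarrow> bool) \<Rightarrow> 'a \<Rightarrow> 'a \<Rightarrow> 'a \<Rightarrow> 'a set \<Rightarrow> 'a set" where
  "merge_A E s x y A = (if x = s then A \<union> {b. E y b} else if y \<in> A then insert x A else A)"

definition merge_B :: "'a \<Rightarrow> 'a \<Rightarrow> 'a \<Rightarrow> 'a set \<Rightarrow> 'a set" where
  "merge_B s x y B = (if x \<noteq> s \<and> y \<in> B then insert x B else B)"

lemma merge_rooted:
  assumes r: "rooted E s A B" and xy: "x \<noteq> y" "\<not> E x y" and y: "y \<noteq> s"
  shows "rooted (merge_adj E x y) s (merge_A E s x y A) (merge_B s x y B)"
proof -
  note R = rootedD[OF r]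
  have "symp (merge_adj E x y)"
    by (rule sympI) (auto simp: merge_adj_def intro: R(1))
  moreover have "irreflp (merge_adj E x y)"
    using xy R(2) R(1)[of y x] by (auto simp: merge_adj_def irreflp_def)
  moreover have "merge_adj E x y s b \<longleftrightarrow> b \<in> merge_A E s x y A \<union> merge_B s x y B" for b
    using xy y by (auto simp: merge_adj_def merge_A_def merge_B_def R(3))
  ultimately show ?thesis by (auto simp: rooted_def)
qed

lemma merge_conn:
  assumes c: "conn E s V" and xy: "x \<in> V" "y \<in> V" "x \<noteq> y" and y: "y \<noteq> s"
  shows "conn (merge_adj E x y) s (V - {y})"
  unfolding conn_def
proof (intro allI impI)
  fix W assume W: "s \<in> W" "W \<subset> V - {y}"
  show "\<exists>a\<in>W. \<exists>b\<in>V - {y} - W. merge_adj E x y a b"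
  proof (cases "x \<in> W")
    case True
    have "s \<in> insert y W" "insert y W \<subset> V" using W xy by auto
    then obtain a b where ab: "a \<in> insert y W" "b \<in> V" "b \<notin> insert y W" "E a b"
      by (rule connE[OF c])
    show ?thesis
    proof (cases "a = y")
      case True
      then have "merge_adj E x y x b" using ab by (simp add: merge_adj_def)
      then show ?thesis using \<open>x \<in> W\<close> ab by blast
    next
      case False
      then have "merge_adj E x y a b" "a \<in> W" using ab by (simp_all add: merge_adj_def)
      then show ?thesis using ab by blast
    qed
  next
    case False
    have "W \<subset> V" using W by auto
    then obtain a b where ab: "a \<in> W" "b \<in> V" "b \<notin> W" "E a b"
      using connE[OF c W(1)] by blast
    show ?thesis
    proof (cases "b = y")
      case True
      then have "merge_adj E x y a x" using ab by (simp add: merge_adj_def)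
      then show ?thesis using ab False xy by blast
    next
      case False
      then have "merge_adj E x y a b" using ab by (simp add: merge_adj_def)
      then show ?thesis using ab False by blast
    qed
  qed
qed

text \<open>Identification is undone by giving \<open>y\<close> the colour of \<open>x\<close>, so a
  way to colour the two halves differently would pull back to the old graph.\<close>

lemma merge_blocked:
  assumes r: "rooted E s A B" and b: "blocked q E s A B V"
    and xy: "x \<in> V" "y \<in> V" "x \<noteq> y" "\<not> E x y" and y: "y \<noteq> s"
  shows "blocked q (merge_adj E x y) s (merge_A E s x y A) (merge_B s x y B) (V - {y})"
proof (rule ccontr)
  assume "\<not> ?thesis"
  then obtain c i j where c: "c \<in> cols q (merge_adj E x y) (V - {y} - {s})"
    and ij: "i < q" "j < q" "i \<noteq> j"
    and i: "i \<notin> c ` (merge_A E s x y A \<inter> (V - {y} - {s}))"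
    and j: "j \<notin> c ` (merge_B s x y B \<inter> (V - {y} - {s}))"
    by (rule blockedE)
  note R = rootedD[OF r]
  \<comment> \<open>If \<open>x\<close> is the root, \<open>y\<close> was merged into its
    \<open>A\<close>-half, whose colour is \<open>i\<close>.\<close>
  define k where "k = (if x = s then i else c x)"
  have kq: "k < q" using ij cols_less[OF c, of x] xy by (auto simp: k_def)
  have ky: "c a \<noteq> k" if "a \<in> V - {s}" "a \<noteq> y" "E y a" for a
  proof (cases "x = s")
    case True
    then show ?thesis using that i by (auto simp: k_def merge_A_def)
  next
    case False
    have "merge_adj E x y x a" using that by (simp add: merge_adj_def)
    then have "c x \<noteq> c a" using that xy False by (intro cols_proper[OF c]) auto
    then show ?thesis using False by (simp add: k_def)
  qed
  have c': "c(y := k) \<in> cols q E (V - {s})"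
  proof (rule colsI)
    show "c(y := k) \<in> extensional (V - {s})"
      using c xy y by (auto simp: cols_def PiE_def extensional_def)
    show "(c(y := k)) a < q" if "a \<in> V - {s}" for a
      using that kq cols_less[OF c, of a] by auto
    show "(c(y := k)) a \<noteq> (c(y := k)) b" if ab: "a \<in> V - {s}" "b \<in> V - {s}" "E a b" for a b
    proof -
      have "merge_adj E x y a b" "E b a" using ab R(1) by (auto simp: merge_adj_def)
      then show ?thesis
        using ab ky[of a] ky[of b] cols_proper[OF c, of a b] R(2)[of y] by auto
    qed
  qed
  from blockedD[OF b c' ij] show False
  proof
    assume "\<exists>a\<in>A \<inter> (V - {s}). (c(y := k)) a = i"
    then obtain a where a: "a \<in> A" "a \<in> V" "a \<noteq> s" "(c(y := k)) a = i" by auto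
    show False
    proof (cases "a = y")
      case True
      then have "x \<noteq> s" using a xy R(3)[of y] by auto
      then have "c x = i" "x \<in> merge_A E s x y A" using a True by (auto simp: k_def merge_A_def)
      then show False using i xy \<open>x \<noteq> s\<close> by auto
    next
      case False
      then have "a \<in> merge_A E s x y A" "c a = i" using a by (auto simp: merge_A_def)
      then show False using i a False by auto
    qed
  next
    assume "\<exists>b\<in>B \<inter> (V - {s}). (c(y := k)) b = j"
    then obtain a where a: "a \<in> B" "a \<in> V" "a \<noteq> s" "(c(y := k)) a = j" by auto
    show False
    proof (cases "a = y")
      case True
      then have "x \<noteq> s" using a xy R(3)[of y] by auto
      then have "c x = j" "x \<in> merge_B s x y B" using a True by (auto simp: k_def merge_B_def)
      then show False using j xy \<open>x \<noteq> s\<close> by auto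
    next
      case False
      then have "a \<in> merge_B s x y B" "c a = j" using a by (auto simp: merge_B_def)
      then show False using j a False by auto
    qed
  qed
qed

lemma card_mono_cols_le_merge:
  assumes V: "finite V" and xy: "x \<in> V" "y \<in> V" "x \<noteq> y" and E: "symp E"
  shows "card (mono_cols q E V x y) \<le> card (cols q (merge_adj E x y) (V - {y}))"
proof (rule card_inj_on_le)
  show "inj_on (\<lambda>c. restrict c (V - {y})) (mono_cols q E V x y)"
  proof (rule inj_onI)
    fix c d assume c: "c \<in> mono_cols q E V x y" and d: "d \<in> mono_cols q E V x y"
      and eq: "restrict c (V - {y}) = restrict d (V - {y})"
    have same: "c a = d a" if "a \<in> V - {y}" for a using fun_cong[OF eq, of a] that by simp
    have "c a = d a" if "a \<in> V" for a
      using same[of a] same[of x] that xy c d by (cases "a = y") (auto simp: mono_cols_def)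
    moreover have "c \<in> extensional V" "d \<in> extensional V"
      using c d by (auto simp: mono_cols_def cols_def PiE_def)
    ultimately show "c = d" by (intro extensionalityI)
  qed
  show "(\<lambda>c. restrict c (V - {y})) ` mono_cols q E V x y \<subseteq> cols q (merge_adj E x y) (V - {y})"
  proof (rule image_subsetI)
    fix c assume "c \<in> mono_cols q E V x y"
    then have c: "c \<in> cols q E V" and eq: "c x = c y" by (auto simp: mono_cols_def)
    show "restrict c (V - {y}) \<in> cols q (merge_adj E x y) (V - {y})"
    proof (rule colsI)
      show "restrict c (V - {y}) a < q" if "a \<in> V - {y}" for a
        using that cols_less[OF c, of a] by auto
      show "restrict c (V - {y}) a \<noteq> restrict c (V - {y}) b"
        if "a \<in> V - {y}" "b \<in> V - {y}" "merge_adj E x y a b" for a b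
        using that eq xy cols_proper[OF c, of a b] cols_proper[OF c, of y b] cols_proper[OF c, of a y]
        by (auto simp: merge_adj_def)
    qed auto
  qed
qed (use V in simp)

lemma mono_cols_adjacent:
  assumes "a \<in> V" "b \<in> V" "E a b"
  shows "mono_cols q E V a b = {}"
  using assms by (auto simp: mono_cols_def dest: cols_proper)

lemma mono_cols_commute: "mono_cols q E V a b = mono_cols q E V b a"
  by (auto simp: mono_cols_def)

section \<open>Counting monochromatic pairs\<close>

definition admissible ::
  "nat \<Rightarrow> ('a \<Rightarrow> 'a \<Rightarrow> bool) \<Rightarrow> 'a \<Rightarrow> 'a set \<Rightarrow> 'a set \<Rightarrow> 'a set \<Rightarrow> bool" where
  "admissible q E s A B V \<longleftrightarrow>
     rooted E s A B \<and> finite V \<and> s \<in> V \<and> conn E s V \<and> blocked q E s A B V"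

text \<open>\<open>q! (q - 1)\<^sup>n\<^sup>-\<^sup>q\<close>, without truncated subtraction.\<close>

definition tomescu :: "nat \<Rightarrow> nat \<Rightarrow> real" where
  "tomescu q n = fact q * (real q - 1) ^ n / (real q - 1) ^ q"

lemma tomescu_Suc: "tomescu q (Suc n) = (real q - 1) * tomescu q n"
  by (simp add: tomescu_def)

lemma tomescu_pos: "q \<ge> 2 \<Longrightarrow> 0 < tomescu q n"
  by (simp add: tomescu_def)

lemma tomescu_self: "q \<ge> 2 \<Longrightarrow> tomescu q q = fact q"
  by (simp add: tomescu_def)

lemma admissibleD:
  assumes "admissible q E s A B V"
  shows "rooted E s A B" "finite V" "s \<in> V" "conn E s V" "blocked q E s A B V"
  using assms by (simp_all add: admissible_def)

lemma merge_admissible: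
  assumes "admissible q E s A B V" "x \<in> V" "y \<in> V" "x \<noteq> y" "\<not> E x y" "y \<noteq> s"
  shows "admissible q (merge_adj E x y) s (merge_A E s x y A) (merge_B s x y B) (V - {y})"
  using assms merge_rooted[of E s A B x y] merge_conn[of E s V x y] merge_blocked[of E s A B q V x y]
  by (simp add: admissible_def)

text \<open>Turns bounds for all identified graphs into a collision bound for every pair. The root
  must survive the identification, so \<open>x\<close> and \<open>y\<close> exchange roles if
  \<open>y\<close> is the root.\<close>

lemma card_mono_cols_le:
  assumes a: "admissible q E s A B V" and xy: "x \<in> V" "y \<in> V" "x \<noteq> y" and u: "0 \<le> u"
    and merge: "\<And>a b. a \<in> V \<Longrightarrow> b \<in> V \<Longrightarrow> a \<noteq> b \<Longrightarrow> \<not> E a b \<Longrightarrow> b \<noteq> s \<Longrightarrow>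
      real (card (cols q (merge_adj E a b) (V - {b}))) \<le> u"
  shows "real (card (mono_cols q E V x y)) \<le> u"
proof (cases "E x y")
  case True
  then show ?thesis using mono_cols_adjacent[of x V y E q] xy u by simp
next
  case False
  have sym: "symp E" using a by (simp add: admissible_def rooted_def)
  have "\<not> E y x" using False sym by (blast dest: sympD)
  consider "y \<noteq> s" | "x \<noteq> s" using xy by auto
  then show ?thesis
  proof cases
    case 1
    have "card (mono_cols q E V x y) \<le> card (cols q (merge_adj E x y) (V - {y}))"
      using admissibleD(2)[OF a] xy sym by (rule card_mono_cols_le_merge)
    then show ?thesis using merge[OF xy(1,2,3) False 1] by linarith
  next
    case 2
    have "card (mono_cols q E V y x) \<le> card (cols q (merge_adj E y x) (V - {x}))"
      using admissibleD(2)[OF a] xy sym by (intro card_mono_cols_le_merge) auto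
    then show ?thesis using merge[OF xy(2,1) xy(3)[symmetric] \<open>\<not> E y x\<close> 2]
      by (simp add: mono_cols_commute[of q E V x y])
  qed
qed

lemma blocked_card_le:
  assumes "rooted E s A B" "blocked q E s A B V" "s \<in> V" "finite V" "c \<in> cols q E V"
  shows "q \<le> card V"
  using blocked_cols_onto[OF assms(1,2,3,5)] card_image_le[OF assms(4), of c] by simp

text \<open>All q colours occur, so on q vertices every colouring is injective.\<close>

lemma card_cols_le_fact:
  assumes r: "rooted E s A B" and b: "blocked q E s A B V" and s: "s \<in> V" and V: "finite V" "card V = q"
  shows "card (cols q E V) \<le> fact q"
proof -
  have "cols q E V \<subseteq> {c \<in> V \<rightarrow>\<^sub>E {..<q}. inj_on c V}"
  proof
    fix c assume c: "c \<in> cols q E V"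
    then have "card (c ` V) = card V" using blocked_cols_onto[OF r b s c] V by simp
    then have "inj_on c V" using V by (auto intro: eq_card_imp_inj_on)
    then show "c \<in> {c \<in> V \<rightarrow>\<^sub>E {..<q}. inj_on c V}" using c by (auto simp: cols_def)
  qed
  then have "card (cols q E V) \<le> card {c \<in> V \<rightarrow>\<^sub>E {..<q}. inj_on c V}"
    using V by (intro card_mono) (auto intro!: finite_subset[OF _ finite_PiE[of V "\<lambda>_. {..<q}"]])
  also have "\<dots> = fact q"
    using V by (subst card_inj_on_subset_funcset) (auto simp: fact_prod_rev)
  finally show ?thesis .
qed

lemma card_cols_insert_le:
  assumes r: "rooted E s A B" and W: "finite W" "z \<notin> W" and T: "T \<subseteq> {y\<in>W. E z y}" "card T \<le> q"
    and u: "0 \<le> u" "\<And>a b. a \<in> T \<Longrightarrow> b \<in> T \<Longrightarrow> a \<noteq> b \<Longrightarrow> real (card (mono_cols q E W a b)) \<le> u"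
  shows "real (card (cols q E (insert z W))) \<le>
    (real q - real (card T)) * real (card (cols q E W)) + real (card T) * (real (card T) - 1) / 2 * u"
proof -
  have E: "symp E" "irreflp E" using r by (simp_all add: rooted_def)
  have "real (card (cols q E (insert z W))) = (\<Sum>c\<in>cols q E W. real (q - card (c ` {y\<in>W. E z y})))"
    using sum_cols_insert[OF W E, where f = "\<lambda>_. 1" and q = q] by simp
  also have "\<dots> \<le> (real q - real (card T)) * real (card (cols q E W))
      + real (card T) * (real (card T) - 1) / 2 * u"
    using W T u by (intro sum_avail_le) auto
  finally show ?thesis .
qed

text \<open>Restricting \<open>c\<close> to the core shows that the core is connected, so a
  connected set can be grown from it until a single vertex outside is left.\<close>

lemma admissible_remove_last:
  assumes a: "admissible q E s A B V" and m: "minimal_blocked q E s A B C" and C: "C \<subset> V"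
    and c: "c \<in> cols q E V"
  obtains z where "z \<in> V - C" "admissible q E s A B (V - {z})" "\<exists>y\<in>V - {z}. E z y"
proof -
  note D = admissibleD[OF a]
  have "restrict c C \<in> cols q E C" using c C by (intro cols_restrict) auto
  then have "conn E s C" by (rule minimal_blocked_conn[OF D(1) m])
  then obtain z where z: "z \<in> V - C" "conn E s (V - {z})"
    using ex_last_vertex[OF D(2) minimal_blockedD(1)[OF m] C _ D(4)] by blast
  have "s \<in> C" by (rule minimal_blockedD(1)[OF m])
  have "C \<subseteq> V - {z}" using z C by auto
  then have "blocked q E s A B (V - {z})" using minimal_blockedD(2)[OF m] by (rule blocked_mono[rotated])
  with z D \<open>s \<in> C\<close> C have adm: "admissible q E s A B (V - {z})"
    by (auto simp: admissible_def)
  have "s \<in> V - {z}" "V - {z} \<subset> V" using z \<open>s \<in> C\<close> C by auto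
  then obtain x y where "x \<in> V - {z}" "y \<in> V" "y \<notin> V - {z}" "E x y" by (rule connE[OF D(4)])
  then have "\<exists>y\<in>V - {z}. E z y" using rootedD(1)[OF D(1)] by auto
  with that z adm show ?thesis by blast
qed

text \<open>The contraction merges the edges from \<open>z\<close> to the two ends into one, so at
  most one neighbour is lost.\<close>

lemma minimal_blocked_degree':
  assumes r: "rooted E s A B" and m: "minimal_blocked q E s A B V" and V: "finite V"
    and z: "z \<in> V" "z \<noteq> s"
  shows "q \<le> Suc (card {y\<in>V. E z y})"
proof -
  note R = rootedD[OF r]
  have eq: "{y\<in>V. E z y} = {y\<in>V - {s}. E z y} \<union> (if z \<in> A \<union> B then {s} else {})"
    using minimal_blockedD(1)[OF m] R(3)[of z] R(1)[of s z] R(1)[of z s] by auto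
  have "card {y\<in>V. E z y} = card {y\<in>V - {s}. E z y} + (if z \<in> A \<union> B then 1 else 0)"
    unfolding eq using V by (subst card_Un_disjoint) auto
  then show ?thesis using minimal_blocked_degree[OF r m V z] by (auto split: if_splits)
qed

text \<open>The degree of the root is the number \<open>f\<close> of edges to it, so in the degree
  sum each such edge is counted twice over the other vertices. This matches the double weight of
  \<open>A\<close> and \<open>B\<close> in the degree bound, and each of the n - 1 other vertices
  contributes at least q.\<close>

lemma card_nonadjacent_pairs_le:
  assumes r: "rooted E s A B" and m: "minimal_blocked q E s A B V" and V: "finite V"
  shows "real (card {(a, b). a \<in> V \<and> b \<in> V \<and> a \<noteq> b \<and> \<not> E a b})
    \<le> (real (card V) - 1) * (real (card V) - real q)"
proof -
  note R = rootedD[OF r]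
  have s: "s \<in> V" by (rule minimal_blockedD(1)[OF m])
  define n where "n = card V"
  have n: "n \<ge> 1" unfolding n_def using s V by (metis One_nat_def Suc_leI card_gt_0_iff empty_iff)
  define d where "d a = real (card {y\<in>V. E a y})" for a
  define e where "e a = real (card {y\<in>V - {s}. E a y})" for a
  define f where "f a = (if E s a then 1 else 0 :: real)" for a
  have da: "d a = e a + f a" if "a \<in> V" for a
  proof -
    have "{y\<in>V. E a y} = {y\<in>V - {s}. E a y} \<union> (if E s a then {s} else {})"
      using s R(1)[of s a] R(1)[of a s] by auto
    moreover have "card ({y\<in>V - {s}. E a y} \<union> (if E s a then {s} else {}))
        = card {y\<in>V - {s}. E a y} + (if E s a then 1 else 0)"
      using V by (subst card_Un_disjoint) auto
    ultimately show ?thesis by (simp add: d_def e_def f_def)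
  qed
  have ds: "d s = (\<Sum>a\<in>V - {s}. f a)"
  proof -
    have "{y\<in>V. E s y} = {y\<in>V - {s}. E s y}" using R(2) by auto
    then show ?thesis using V by (simp add: d_def f_def sum.If_cases Int_def)
  qed
  have "(\<Sum>a\<in>V. d a) = d s + (\<Sum>a\<in>V - {s}. d a)" using s V by (simp add: sum.remove)
  also have "\<dots> = (\<Sum>a\<in>V - {s}. e a + 2 * f a)"
    by (simp add: da ds sum.distrib sum_distrib_left)
  also have "\<dots> \<ge> (\<Sum>a\<in>V - {s}. real q)"
  proof (rule sum_mono)
    fix a assume a: "a \<in> V - {s}"
    then have "q \<le> card {y\<in>V - {s}. E a y} + (if a \<in> A then 1 else 0) + (if a \<in> B then 1 else 0)"
      by (intro minimal_blocked_degree[OF r m V]) auto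
    then show "real q \<le> e a + 2 * f a" by (auto simp: e_def f_def R(3) split: if_splits)
  qed
  finally have deg: "(real n - 1) * real q \<le> (\<Sum>a\<in>V. d a)"
    using s V n by (simp add: n_def card_Diff_subset of_nat_diff)
  have "{(a, b). a \<in> V \<and> b \<in> V \<and> a \<noteq> b \<and> \<not> E a b} = (SIGMA a:V. V - {a} - {y\<in>V. E a y})"
    by auto
  then have "real (card {(a, b). a \<in> V \<and> b \<in> V \<and> a \<noteq> b \<and> \<not> E a b})
      = (\<Sum>a\<in>V. real (card (V - {a} - {y\<in>V. E a y})))"
    using V by (simp add: card_SigmaI)
  also have "\<dots> = (\<Sum>a\<in>V. real n - 1 - d a)"
  proof (rule sum.cong[OF refl])
    fix a assume a: "a \<in> V"
    have sub: "{y\<in>V. E a y} \<subseteq> V - {a}" using R(2) by auto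
    have "card (V - {a} - {y\<in>V. E a y}) = card (V - {a}) - card {y\<in>V. E a y}"
      using V sub by (intro card_Diff_subset) auto
    moreover have "card {y\<in>V. E a y} \<le> card (V - {a})" using V sub by (intro card_mono) auto
    moreover have "card (V - {a}) = n - 1" using a V by (simp add: n_def)
    ultimately show "real (card (V - {a} - {y\<in>V. E a y})) = real n - 1 - d a"
      using n by (simp add: d_def of_nat_diff)
  qed
  also have "\<dots> = real n * (real n - 1) - (\<Sum>a\<in>V. d a)"
    by (subst sum_subtractf) (simp add: n_def)
  also have "\<dots> \<le> real n * (real n - 1) - (real n - 1) * real q" using deg by linarith
  finally show ?thesis by (simp add: n_def algebra_simps)
qed

text \<open>The monochromatic pairs forced by pigeonhole, where all q colours occur, are compared
  with the number of nonadjacent pairs times the collision bound. The parameter \<open>k\<close> is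
  the assumed typical class size; 1 and 2 are used.\<close>

lemma minimal_blocked_mono_bound:
  assumes r: "rooted E s A B" and m: "minimal_blocked q E s A B V" and V: "finite V"
    and u: "0 \<le> u" "\<And>a b. a \<in> V \<Longrightarrow> b \<in> V \<Longrightarrow> a \<noteq> b \<Longrightarrow> real (card (mono_cols q E V a b)) \<le> u"
  shows "(2 * real k * real (card V) - real k * (real k + 1) * real q) * real (card (cols q E V))
     \<le> (real (card V) - 1) * (real (card V) - real q) * u"
proof -
  have "(2 * real k * real (card V) - real k * (real k + 1) * real q) * real (card (cols q E V))
     = (\<Sum>c\<in>cols q E V. 2 * real k * real (card V) - real k * (real k + 1) * real q)"
    by simp
  also have "\<dots> \<le> (\<Sum>c\<in>cols q E V. real (card (mono_pairs c V)))"
  proof (rule sum_mono)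
    fix c assume c: "c \<in> cols q E V"
    have "card (c ` V) = q"
      using blocked_cols_onto[OF r minimal_blockedD(2)[OF m] minimal_blockedD(1)[OF m] c] by simp
    then show "2 * real k * real (card V) - real k * (real k + 1) * real q \<le> real (card (mono_pairs c V))"
      using mono_pairs_lower_bound[OF V, of k c] by simp
  qed
  also have "\<dots> \<le> real (card {(a, b). a \<in> V \<and> b \<in> V \<and> a \<noteq> b \<and> \<not> E a b}) * u"
    using u(2) by (intro sum_card_mono_pairs[OF V]) auto
  also have "\<dots> \<le> (real (card V) - 1) * (real (card V) - real q) * u"
    using card_nonadjacent_pairs_le[OF r m V] u(1) by (intro mult_right_mono)
  finally show ?thesis .
qed

section \<open>Bipolar orders and greedy colouring\<close>

text \<open>Akin to an st-numbering with the root as both poles. The root is left out because it is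
  coloured first in both directions, which is also why its neighbours are exempt from the
  condition.\<close>

definition bipolar :: "('a \<Rightarrow> 'a \<Rightarrow> bool) \<Rightarrow> 'a \<Rightarrow> 'a set \<Rightarrow> 'a list \<Rightarrow> bool" where
  "bipolar E s V L \<longleftrightarrow> distinct L \<and> set L \<subseteq> V - {s} \<and>
     (\<forall>xs z ys. L = xs @ z # ys \<longrightarrow> \<not> E s z \<longrightarrow> (\<exists>x\<in>set xs. E z x) \<and> (\<exists>y\<in>set ys. E z y))"

lemma bipolarD:
  assumes "bipolar E s V L"
  shows "distinct L" "set L \<subseteq> V - {s}"
    "L = xs @ z # ys \<Longrightarrow> \<not> E s z \<Longrightarrow> (\<exists>x\<in>set xs. E z x) \<and> (\<exists>y\<in>set ys. E z y)"
  using assms unfolding bipolar_def by auto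

text \<open>Old entries keep their earlier and later neighbours, so only the inserted block has to
  be checked.\<close>

lemma bipolar_insert:
  assumes b: "bipolar E s V (us @ vs)" and ps: "distinct ps" "set ps \<subseteq> V - {s}" "set ps \<inter> set (us @ vs) = {}"
    and in_ps: "\<And>r z t. ps = r @ z # t \<Longrightarrow> \<not> E s z \<Longrightarrow> (\<exists>x\<in>set (us @ r). E z x) \<and> (\<exists>y\<in>set (t @ vs). E z y)"
  shows "bipolar E s V (us @ ps @ vs)"
  unfolding bipolar_def
proof (intro conjI allI impI)
  show "distinct (us @ ps @ vs)" using bipolarD(1)[OF b] ps by auto
  show "set (us @ ps @ vs) \<subseteq> V - {s}" using bipolarD(2)[OF b] ps by auto
  fix xs z ys assume eq: "us @ ps @ vs = xs @ z # ys" and z: "\<not> E s z"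
  consider r where "us = xs @ z # r" "ys = r @ ps @ vs"
    | r t where "ps = r @ z # t" "xs = us @ r" "ys = t @ vs"
    | r where "vs = r @ z # ys" "xs = us @ ps @ r"
    using eq by (auto simp: append_eq_append_conv2 append_eq_Cons_conv Cons_eq_append_conv)
  then have "(\<exists>x\<in>set xs. E z x) \<and> (\<exists>y\<in>set ys. E z y)"
  proof cases
    case 1
    then show ?thesis using bipolarD(3)[OF b, of xs z "r @ vs"] z by auto
  next
    case 2
    then show ?thesis using in_ps[of r z t] z by auto
  next
    case 3
    then show ?thesis using bipolarD(3)[OF b, of "us @ r" z ys] z by auto
  qed
  then show "\<exists>x\<in>set xs. E z x" "\<exists>y\<in>set ys. E z y" by auto
qed

text \<open>Along the inserted path the predecessor and the successor serve as the two neighbours,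
  with \<open>a\<close> and \<open>b\<close> serving at its ends.\<close>

lemma bipolar_insert_path:
  assumes sym: "\<And>x y. E x y \<Longrightarrow> E y x"
    and b: "bipolar E s V L" and L: "L = l1 @ a # l2 @ b # l3"
    and ps: "distinct ps" "set ps \<subseteq> V - {s}" "set ps \<inter> set L = {}"
    and path: "ps \<noteq> []" "successively E ps" "E a (hd ps)" "E (last ps) b"
  shows "bipolar E s V (l1 @ a # ps @ l2 @ b # l3)"
proof -
  have "bipolar E s V ((l1 @ [a]) @ ps @ (l2 @ b # l3))"
  proof (rule bipolar_insert)
    show "bipolar E s V ((l1 @ [a]) @ l2 @ b # l3)" using b L by simp
    show "distinct ps" "set ps \<subseteq> V - {s}" by (fact ps)+
    show "set ps \<inter> set ((l1 @ [a]) @ l2 @ b # l3) = {}" using ps(3) L by simp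
    fix r z t assume eq: "ps = r @ z # t"
    have "\<exists>x\<in>set ((l1 @ [a]) @ r). E z x"
    proof (cases r rule: rev_cases)
      case Nil
      then show ?thesis using path(3) eq sym by auto
    next
      case (snoc r' x)
      then have "E x z" using path(2) eq by (auto simp: successively_append_iff)
      then show ?thesis using snoc sym by auto
    qed
    moreover have "\<exists>y\<in>set (t @ l2 @ b # l3). E z y"
    proof (cases t)
      case Nil
      then show ?thesis using path(4) eq by auto
    next
      case (Cons y t')
      then have "E z y" using path(2) eq by (auto simp: successively_append_iff successively_Cons)
      then show ?thesis using Cons by auto
    qed
    ultimately show "(\<exists>x\<in>set ((l1 @ [a]) @ r). E z x) \<and> (\<exists>y\<in>set (t @ l2 @ b # l3). E z y)" by blast
  qed
  then show ?thesis by simp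
qed

text \<open>A longest such list misses no vertex: otherwise, as there is no cut vertex, an ear with
  two different ends in the list could be inserted between its ends.\<close>

lemma ex_bipolar_order:
  assumes r: "rooted E s A B" and m: "minimal_blocked q E s A B V" and V: "finite V"
    and c0: "c0 \<in> cols q E V"
  obtains L where "bipolar E s V L" "set L = V - {s}"
proof -
  note R = rootedD[OF r]
  have sV: "s \<in> V" by (rule minimal_blockedD(1)[OF m])
  have len: "length L < Suc (card V)" if "bipolar E s V L" for L
  proof -
    have "card (set L) \<le> card V" using bipolarD(2)[OF that] V by (intro card_mono) auto
    then show ?thesis using bipolarD(1)[OF that] by (simp add: distinct_card)
  qed
  have "bipolar E s V []" by (simp add: bipolar_def)
  then have "\<exists>L. bipolar E s V L \<and> (\<forall>L'. bipolar E s V L' \<longrightarrow> length L' \<le> length L)"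
    using len by (intro ex_has_greatest_nat[of "bipolar E s V" "[]" length "Suc (card V)"]) auto
  then obtain L where L: "bipolar E s V L"
    and max: "\<And>L'. bipolar E s V L' \<Longrightarrow> length L' \<le> length L" by blast
  define Z where "Z = V - {s} - set L"
  have "Z = {}"
  proof (rule ccontr)
    assume "Z \<noteq> {}"
    \<comment> \<open>A missing neighbour of the root could be put in front of the list, where
      nothing is required of it.\<close>
    have ZN: "\<not> E s z" if "z \<in> Z" for z
    proof
      assume "E s z"
      have "bipolar E s V ([] @ [z] @ L)"
        by (rule bipolar_insert) (use L that \<open>E s z\<close> in \<open>auto simp: Z_def Cons_eq_append_conv\<close>)
      then show False using max[of "[z] @ L"] by simp
    qed
    have "s \<in> V - Z" "V - Z \<subset> V" using sV \<open>Z \<noteq> {}\<close> by (auto simp: Z_def)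
    then obtain a z0 where az: "a \<in> V - Z" "z0 \<in> V" "z0 \<notin> V - Z" "E a z0"
      by (rule connE[OF minimal_blocked_conn[OF r m c0]])
    then have z0: "z0 \<in> Z" and "a \<noteq> s" using ZN by auto
    then have aL: "a \<in> set L" using az by (auto simp: Z_def)
    \<comment> \<open>\<open>P\<close> describes the paths that start next to \<open>a\<close> and
      stay among the missing vertices; \<open>Q\<close> is the set of vertices reached by
      them.\<close>
    define P where "P ps \<longleftrightarrow> ps \<noteq> [] \<and> distinct ps \<and> set ps \<subseteq> Z \<and> successively E ps \<and> E a (hd ps)" for ps
    define Q where "Q = last ` {ps. P ps}"
    have "P [z0]" using z0 az by (simp add: P_def)
    then have "Q \<noteq> {}" by (auto simp: Q_def)
    have QZ: "Q \<subseteq> Z" by (auto simp: Q_def P_def)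
    have closed: "z' \<in> Q" if z: "z \<in> Q" "z' \<in> Z" "E z z'" for z z'
    proof -
      obtain ps where ps: "P ps" "z = last ps" using z by (auto simp: Q_def)
      show ?thesis
      proof (cases "z' \<in> set ps")
        case False
        then have "P (ps @ [z'])" using ps z by (auto simp: P_def successively_append_iff)
        then have "last (ps @ [z']) \<in> Q" unfolding Q_def by blast
        then show ?thesis by simp
      next
        case True
        then obtain p1 p2 where p: "ps = p1 @ z' # p2" by (auto simp: in_set_conv_decomp)
        then have "P (p1 @ [z'])"
          using ps by (cases p1) (auto simp: P_def successively_append_iff successively_Cons hd_append)
        then have "last (p1 @ [z']) \<in> Q" unfolding Q_def by blast
        then show ?thesis by simp
      qed
    qed
    \<comment> \<open>Otherwise \<open>a\<close> would be a cut vertex separating \<open>Q\<close>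
      from the root.\<close>
    have "\<exists>b\<in>set L. b \<noteq> a \<and> (\<exists>z\<in>Q. E z b)"
    proof (rule ccontr)
      assume no: "\<not> ?thesis"
      show False
      proof (rule minimal_blocked_no_cut[OF r m c0])
        show "Q \<subseteq> V - {s}" using QZ by (auto simp: Z_def)
        show "Q \<noteq> {}" by fact
        show "a \<in> V - Q" using az QZ by auto
        show "a \<noteq> s" by fact
        fix x y assume xy: "x \<in> V - Q" "y \<in> Q" "E x y"
        have "x \<notin> Z" using closed[of y x] xy R(1) by auto
        moreover have "x \<noteq> s" using ZN[of y] xy QZ by auto
        ultimately have "x \<in> set L" using xy by (auto simp: Z_def)
        then show "x = a" using no xy R(1) by auto
      qed
    qed
    then obtain b ps where b: "b \<in> set L" "b \<noteq> a" and ps: "P ps" "E (last ps) b"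
      by (auto simp: Q_def)
    have ps': "distinct ps" "set ps \<subseteq> V - {s}" "set ps \<inter> set L = {}" "ps \<noteq> []" "successively E ps"
      "E a (hd ps)"
      using ps by (auto simp: P_def Z_def)
    have rev_ps: "distinct (rev ps)" "set (rev ps) \<subseteq> V - {s}" "set (rev ps) \<inter> set L = {}" "rev ps \<noteq> []"
      "E b (hd (rev ps))" "E (last (rev ps)) a"
      using ps' ps R(1) by (auto simp: hd_rev last_rev)
    have rev_succ: "successively E (rev ps)"
      unfolding successively_rev using ps'(5) R(1) by (blast intro: successively_mono)
    obtain l1 l2 where l: "L = l1 @ a # l2" using aL by (auto simp: in_set_conv_decomp)
    have "b \<in> set l1 \<or> b \<in> set l2" using b l by auto
    then show False
    proof
      assume "b \<in> set l2"
      then obtain l3 l4 where "l2 = l3 @ b # l4" by (auto simp: in_set_conv_decomp)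
      with l have L': "L = l1 @ a # l3 @ b # l4" by simp
      have "bipolar E s V (l1 @ a # ps @ l3 @ b # l4)"
        by (rule bipolar_insert_path[OF R(1) L L']) (use ps' ps in auto)
      from max[OF this] show False using L' ps' by simp
    next
      assume "b \<in> set l1"
      then obtain l3 l4 where "l1 = l3 @ b # l4" by (auto simp: in_set_conv_decomp)
      with l have L': "L = l3 @ b # l4 @ a # l2" by simp
      have "bipolar E s V (l3 @ b # rev ps @ l4 @ a # l2)"
        by (rule bipolar_insert_path[OF R(1) L L']) (use rev_ps rev_succ in auto)
      from max[OF this] show False using L' ps' by simp
    qed
  qed
  then have "set L = V - {s}" using bipolarD(2)[OF L] by (auto simp: Z_def)
  with L that show ?thesis by blast
qed


section \<open>Greedy colouring along a list\<close>

fun after :: "'a list \<Rightarrow> 'a \<Rightarrow> 'a set" where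
  "after [] z = {}"
| "after (x # xs) z = (if z = x then set xs else after xs z)"

lemma after_append: "z \<notin> set us \<Longrightarrow> after (us @ z # vs) z = set vs"
  by (induction us) auto

lemma after_subset: "after xs z \<subseteq> set xs"
  by (induction xs) auto

lemma avail_pos:
  assumes c: "c \<in> cols q E V" and z: "z \<in> V" and S: "S \<subseteq> V" "finite S"
  shows "0 < q - card (c ` {y\<in>S. E z y})"
proof -
  have "c ` {y\<in>S. E z y} \<subseteq> {..<q} - {c z}"
    using c z S by (auto dest: cols_less cols_proper)
  then have "card (c ` {y\<in>S. E z y}) \<le> card ({..<q} - {c z})" by (intro card_mono) auto
  also have "\<dots> < q" using cols_less[OF c z] by auto
  finally show ?thesis by simp
qed

text \<open>Colouring the vertices one by one, from the end of the list, with a uniformly random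
  available colour produces \<open>c\<close> with the probability summed here.\<close>

lemma sum_greedy_probabilities:
  assumes E: "symp E" "irreflp E" and "distinct xs"
  shows "(\<Sum>c\<in>cols q E (set xs). \<Prod>z\<in>set xs. 1 / real (q - card (c ` {y\<in>after xs z. E z y}))) \<le> 1"
  using \<open>distinct xs\<close>
proof (induction xs)
  case Nil
  have "cols q E {} = {\<lambda>_. undefined}" by (auto simp: cols_def)
  then show ?case by simp
next
  case (Cons x xs)
  define g where "g c z = 1 / real (q - card (c ` {y\<in>after xs z. E z y}))" for c :: "'a \<Rightarrow> nat" and z
  define h where "h c = 1 / real (q - card (c ` {y\<in>set xs. E x y}))" for c :: "'a \<Rightarrow> nat"
  have x: "x \<notin> set xs" using Cons.prems by simp
  have g_restrict: "g (restrict c (set xs)) z = g c z" for c z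
  proof -
    have "restrict c (set xs) ` {y\<in>after xs z. E z y} = c ` {y\<in>after xs z. E z y}"
      using after_subset[of xs z] by (intro image_cong) auto
    then show ?thesis by (simp add: g_def)
  qed
  have h_restrict: "h (restrict c (set xs)) = h c" for c
  proof -
    have "restrict c (set xs) ` {y\<in>set xs. E x y} = c ` {y\<in>set xs. E x y}"
      by (intro image_cong) auto
    then show ?thesis by (simp add: h_def)
  qed
  have "(\<Sum>c\<in>cols q E (set (x # xs)). \<Prod>z\<in>set (x # xs). 1 / real (q - card (c ` {y\<in>after (x # xs) z. E z y})))
      = (\<Sum>c\<in>cols q E (insert x (set xs)). h (restrict c (set xs)) * (\<Prod>z\<in>set xs. g (restrict c (set xs)) z))"
  proof (rule sum.cong)
    fix c assume "c \<in> cols q E (insert x (set xs))"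
    have "(\<Prod>z\<in>set xs. 1 / real (q - card (c ` {y\<in>after (x # xs) z. E z y}))) = (\<Prod>z\<in>set xs. g c z)"
      using x by (intro prod.cong) (auto simp: g_def)
    then show "(\<Prod>z\<in>set (x # xs). 1 / real (q - card (c ` {y\<in>after (x # xs) z. E z y})))
        = h (restrict c (set xs)) * (\<Prod>z\<in>set xs. g (restrict c (set xs)) z)"
      using x by (simp add: g_restrict h_restrict) (simp add: h_def)
  qed simp
  also have "\<dots> = (\<Sum>c\<in>cols q E (set xs). h c * (\<Prod>z\<in>set xs. g c z) * real (q - card (c ` {y\<in>set xs. E x y})))"
    using x E by (intro sum_cols_insert) auto
  also have "\<dots> \<le> (\<Sum>c\<in>cols q E (set xs). \<Prod>z\<in>set xs. g c z)"
  proof (rule sum_mono)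
    fix c
    have "0 \<le> (\<Prod>z\<in>set xs. g c z)" by (intro prod_nonneg) (auto simp: g_def)
    \<comment> \<open>The product is 1, or 0 if no colour is left, because then
      \<open>1 / 0 = 0\<close>: the random process may get stuck, hence an inequality.\<close>
    moreover have "h c * real (q - card (c ` {y\<in>set xs. E x y})) \<le> 1" by (simp add: h_def)
    ultimately show "h c * (\<Prod>z\<in>set xs. g c z) * real (q - card (c ` {y\<in>set xs. E x y})) \<le> (\<Prod>z\<in>set xs. g c z)"
      using mult_right_mono[of "h c * real (q - card (c ` {y\<in>set xs. E x y}))" 1 "\<Prod>z\<in>set xs. g c z"]
      by (simp add: mult_ac)
  qed
  also have "\<dots> \<le> 1" using Cons by (simp add: g_def)
  finally show ?case .
qed

text \<open>From 1 - 1/r \<le> ln r and 1 + x \<le> exp x. This linear bound replaces Jensen's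
  inequality below.\<close>

lemma one_plus_sum_le_prod:
  fixes r :: "'a \<Rightarrow> real"
  assumes "\<And>z. z \<in> S \<Longrightarrow> 0 < r z"
  shows "1 + (\<Sum>z\<in>S. 1 - 1 / r z) \<le> (\<Prod>z\<in>S. r z)"
proof (cases "finite S")
  case True
  have "(\<Sum>z\<in>S. 1 - 1 / r z) \<le> (\<Sum>z\<in>S. ln (r z))"
  proof (rule sum_mono)
    fix z assume "z \<in> S"
    then have "ln (1 / r z) \<le> 1 / r z - 1" using assms by (intro ln_le_minus_one) auto
    then show "1 - 1 / r z \<le> ln (r z)" using assms[OF \<open>z \<in> S\<close>] by (simp add: ln_div)
  qed
  then have "1 + (\<Sum>z\<in>S. 1 - 1 / r z) \<le> exp (\<Sum>z\<in>S. ln (r z))"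
    using exp_ge_add_one_self[of "\<Sum>z\<in>S. ln (r z)"] by linarith
  also have "\<dots> = (\<Prod>z\<in>S. r z)" using True assms by (simp add: exp_sum)
  finally show ?thesis .
qed simp

text \<open>The greedy probabilities, products of 1/g, sum to at most 1. Multiplied by the product
  of the \<open>a z\<close> they become products of a/g, each at least 1 + \<Sum>(1 - g/a), and
  these lower bounds average to at least 1 because \<open>a\<close> dominates the mean of g.\<close>

lemma card_cols_le_prod:
  assumes E: "symp E" "irreflp E" and xs: "distinct xs" "set xs = V"
    and a: "\<And>z. z \<in> V \<Longrightarrow> 0 < a z"
    and avg: "\<And>z. z \<in> V \<Longrightarrow>
      (\<Sum>c\<in>cols q E V. real (q - card (c ` {y\<in>after xs z. E z y}))) \<le> a z * real (card (cols q E V))"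
  shows "real (card (cols q E V)) \<le> (\<Prod>z\<in>V. a z)"
proof -
  define g where "g c z = real (q - card (c ` {y\<in>after xs z. E z y}))" for c :: "'a \<Rightarrow> nat" and z
  define N where "N = real (card (cols q E V))"
  have g0: "0 < g c z" if "c \<in> cols q E V" "z \<in> V" for c z
    unfolding g_def of_nat_0_less_iff using that after_subset[of xs z] xs
    by (intro avail_pos) (auto intro: finite_subset)
  have V: "finite V" using xs by auto
  have "0 \<le> (\<Sum>z\<in>V. N - (\<Sum>c\<in>cols q E V. g c z) / a z)"
  proof (rule sum_nonneg)
    fix z assume z: "z \<in> V"
    have "(\<Sum>c\<in>cols q E V. g c z) \<le> N * a z" using avg[OF z] by (simp add: g_def N_def mult.commute)
    then have "(\<Sum>c\<in>cols q E V. g c z) / a z \<le> N" using a[OF z] by (simp add: pos_divide_le_eq)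
    then show "0 \<le> N - (\<Sum>c\<in>cols q E V. g c z) / a z" by simp
  qed
  also have "\<dots> = (\<Sum>z\<in>V. \<Sum>c\<in>cols q E V. 1 - g c z / a z)"
    by (simp add: N_def sum_subtractf sum_divide_distrib)
  also have "\<dots> = (\<Sum>c\<in>cols q E V. \<Sum>z\<in>V. 1 - g c z / a z)" by (rule sum.swap)
  finally have "N \<le> (\<Sum>c\<in>cols q E V. 1 + (\<Sum>z\<in>V. 1 - g c z / a z))"
    by (simp add: sum.distrib N_def)
  also have "\<dots> \<le> (\<Sum>c\<in>cols q E V. \<Prod>z\<in>V. a z / g c z)"
  proof (rule sum_mono)
    fix c assume c: "c \<in> cols q E V"
    show "1 + (\<Sum>z\<in>V. 1 - g c z / a z) \<le> (\<Prod>z\<in>V. a z / g c z)"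
      using one_plus_sum_le_prod[of V "\<lambda>z. a z / g c z"] g0[OF c] a by auto
  qed
  also have "\<dots> = (\<Prod>z\<in>V. a z) * (\<Sum>c\<in>cols q E V. \<Prod>z\<in>V. 1 / g c z)"
    by (simp add: sum_distrib_left prod_dividef)
  also have "\<dots> \<le> (\<Prod>z\<in>V. a z) * 1"
    using sum_greedy_probabilities[OF E xs(1), of q] a xs(2)
    by (intro mult_left_mono) (auto simp: g_def intro!: prod_nonneg intro: less_imp_le)
  finally show ?thesis by (simp add: N_def)
qed

text \<open>The bound of \<open>sum_avail_le\<close> per colouring, for t coloured neighbours any
  two of which collide with probability at most 1/(q - 1).\<close>

definition avg_avail :: "nat \<Rightarrow> nat \<Rightarrow> real" where
  "avg_avail q t = real q - real t + real t * (real t - 1) / (2 * (real q - 1))"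

lemma avg_avail_pos:
  assumes "q \<ge> 2" "t < q"
  shows "0 < avg_avail q t"
proof -
  have "0 \<le> real t * (real t - 1)" by (cases t) auto
  then have "0 \<le> real t * (real t - 1) / (2 * (real q - 1))" using assms by (intro divide_nonneg_nonneg) auto
  then show ?thesis using assms by (simp add: avg_avail_def)
qed

text \<open>In u = t - 1 and v = q - t - 1 the difference of the two sides, cleared of denominators,
  is uv times a polynomial with positive coefficients. Equality holds for t = 1 and t = q -
  1.\<close>

lemma avg_avail_mult_le:
  assumes "1 \<le> t" "t < q"
  shows "avg_avail q t * avg_avail q (q - t) \<le> real q * (real q - 1) / 2"
proof -
  define u v m where "u = real t - 1" and "v = real q - real t - 1" and "m = real q - 1"
  have uv: "0 \<le> u" "0 \<le> v" "m = u + v + 1" using assms by (auto simp: u_def v_def m_def)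
  have m0: "0 < m" using uv by simp
  have 1: "avg_avail q t = (2 * m * (v + 1) + u * (u + 1)) / (2 * m)"
    using m0 by (simp add: avg_avail_def u_def v_def m_def field_simps)
  have 2: "avg_avail q (q - t) = (2 * m * (u + 1) + v * (v + 1)) / (2 * m)"
    using m0 assms by (simp add: avg_avail_def u_def v_def m_def of_nat_diff field_simps)
  have "0 \<le> u * v * (2 * u\<^sup>2 + 3 * u * v + 5 * u + 2 * v\<^sup>2 + 5 * v + 3)"
    using uv by (intro mult_nonneg_nonneg add_nonneg_nonneg) auto
  also have "\<dots> = 2 * m ^ 3 * (m + 1) - (2 * m * (v + 1) + u * (u + 1)) * (2 * m * (u + 1) + v * (v + 1))"
    unfolding uv(3) by (simp add: algebra_simps power2_eq_square power3_eq_cube)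
  finally have le: "(2 * m * (v + 1) + u * (u + 1)) * (2 * m * (u + 1) + v * (v + 1)) \<le> 2 * m ^ 3 * (m + 1)"
    by simp
  have "avg_avail q t * avg_avail q (q - t) \<le> 2 * m ^ 3 * (m + 1) / (4 * m\<^sup>2)"
  proof -
    have "2 * m * (2 * m) = 4 * m\<^sup>2" by (simp add: power2_eq_square)
    then show ?thesis unfolding 1 2 times_divide_times_eq
      by (simp only:) (intro divide_right_mono, use le in simp_all)
  qed
  also have "\<dots> = (m + 1) * m / 2"
    using m0 by (simp add: power2_eq_square power3_eq_cube field_simps)
  also have "\<dots> = real q * (real q - 1) / 2" by (simp add: m_def)
  finally show ?thesis .
qed

text \<open>A neighbour of the root has the root in both \<open>X\<close> and \<open>Y\<close>; this
  double count again covers the case that it lies in both \<open>A\<close> and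
  \<open>B\<close>.\<close>

lemma bipolar_degrees:
  assumes r: "rooted E s A B" and m: "minimal_blocked q E s A B V" and V: "finite V"
    and L: "bipolar E s V L" "set L = V - {s}" and z: "z \<in> V" "z \<noteq> s"
  defines "X \<equiv> {y \<in> after (rev L @ [s]) z. E z y}" and "Y \<equiv> {y \<in> after (L @ [s]) z. E z y}"
  shows "1 \<le> card X" "1 \<le> card Y" "q \<le> card X + card Y"
proof -
  note R = rootedD[OF r]
  have "z \<in> set L" using z L by auto
  then obtain xs ys where l: "L = xs @ z # ys" by (auto simp: in_set_conv_decomp)
  have d: "distinct L" by (rule bipolarD(1)[OF L(1)])
  have X: "X = {y\<in>set xs. E z y} \<union> (if E s z then {s} else {})"
  proof -
    have "after (rev L @ [s]) z = set (rev xs @ [s])"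
      using d after_append[of z "rev ys" "rev xs @ [s]"] by (simp add: l)
    then show ?thesis using R(1)[of s z] R(1)[of z s] by (auto simp: X_def)
  qed
  have Y: "Y = {y\<in>set ys. E z y} \<union> (if E s z then {s} else {})"
  proof -
    have "after (L @ [s]) z = set (ys @ [s])"
      using d after_append[of z xs "ys @ [s]"] by (simp add: l)
    then show ?thesis using R(1)[of s z] R(1)[of z s] by (auto simp: Y_def)
  qed
  have fin: "finite X" "finite Y" by (auto simp: X Y)
  have ne: "X \<noteq> {}" "Y \<noteq> {}"
    using bipolarD(3)[OF L(1) l] by (auto simp: X Y)
  then show "1 \<le> card X" "1 \<le> card Y" using fin by (simp_all add: Suc_le_eq card_gt_0_iff)
  have sL: "s \<notin> set L" using L by auto
  have cX: "card X = card {y\<in>set xs. E z y} + (if E s z then 1 else 0)"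
    unfolding X using sL by (subst card_Un_disjoint) (auto simp: l)
  have cY: "card Y = card {y\<in>set ys. E z y} + (if E s z then 1 else 0)"
    unfolding Y using sL by (subst card_Un_disjoint) (auto simp: l)
  have "{y\<in>V - {s}. E z y} = {y\<in>set xs. E z y} \<union> {y\<in>set ys. E z y}"
    using L(2)[symmetric] R(2) by (auto simp: l)
  then have "card {y\<in>V - {s}. E z y} = card {y\<in>set xs. E z y} + card {y\<in>set ys. E z y}"
    using d by (simp only:) (subst card_Un_disjoint, auto simp: l)
  then show "q \<le> card X + card Y"
    using minimal_blocked_degree[OF r m V z] by (auto simp: cX cY R(3) split: if_splits)
qed

text \<open>The two colouring directions are multiplied vertex by vertex: the root has q choices in
  each, and any other vertex contributes at most q (q - 1)/2 to the product.\<close>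

lemma minimal_blocked_square_bound:
  assumes r: "rooted E s A B" and m: "minimal_blocked q E s A B V" and V: "finite V"
    and c0: "c0 \<in> cols q E V" and q: "q \<ge> 2"
    and u: "\<And>a b. a \<in> V \<Longrightarrow> b \<in> V \<Longrightarrow> a \<noteq> b \<Longrightarrow>
      real (card (mono_cols q E V a b)) \<le> real (card (cols q E V)) / (real q - 1)"
  shows "(real (card (cols q E V)))\<^sup>2 \<le> (real q)\<^sup>2 * (real q * (real q - 1) / 2) ^ (card V - 1)"
proof -
  have E: "symp E" "irreflp E" using r by (auto simp: rooted_def)
  have sV: "s \<in> V" by (rule minimal_blockedD(1)[OF m])
  obtain L where L: "bipolar E s V L" "set L = V - {s}" by (rule ex_bipolar_order[OF r m V c0])
  have d: "distinct L" by (rule bipolarD(1)[OF L(1)])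
  define N where "N = real (card (cols q E V))"
  have avg: "(\<Sum>c\<in>cols q E V. real (q - card (c ` {y\<in>S. E z y}))) \<le> avg_avail q t * N"
    if S: "S \<subseteq> V" "t \<le> card {y\<in>S. E z y}" "t < q" for S z t
  proof -
    obtain T where T: "T \<subseteq> {y\<in>S. E z y}" "card T = t"
      using obtain_subset_with_card_n[OF S(2)] by blast
    have "(\<Sum>c\<in>cols q E V. real (q - card (c ` {y\<in>S. E z y})))
        \<le> (real q - real (card T)) * real (card (cols q E V)) + real (card T) * (real (card T) - 1) / 2 * (N / (real q - 1))"
    proof (rule sum_avail_le[OF V T(1)])
      show "real (card (mono_cols q E V a b)) \<le> N / (real q - 1)" if "a \<in> T" "b \<in> T" "a \<noteq> b" for a b
        unfolding N_def using T S that by (intro u) auto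
    qed (use T S q in \<open>auto simp: N_def\<close>)
    also have "\<dots> = avg_avail q t * N"
      by (simp add: T avg_avail_def N_def algebra_simps)
    finally show ?thesis .
  qed
  define X where "X z = {y \<in> after (rev L @ [s]) z. E z y}" for z
  define Y where "Y z = {y \<in> after (L @ [s]) z. E z y}" for z
  \<comment> \<open>Capping at q - 1 puts both t and q - t between 1 and q - 1, and
    \<open>Y z\<close> still has at least q - t elements.\<close>
  define t where "t z = min (card (X z)) (q - 1)" for z
  have t: "1 \<le> t z" "t z < q" "t z \<le> card (X z)" "q - t z \<le> card (Y z)" if "z \<in> V - {s}" for z
    using bipolar_degrees[OF r m V L, of z] that q by (auto simp: t_def X_def Y_def)
  define a where "a z = (if z = s then real q else avg_avail q (t z))" for z
  define b where "b z = (if z = s then real q else avg_avail q (q - t z))" for z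
  have aft: "after (L @ [s]) z \<subseteq> V" "after (rev L @ [s]) z \<subseteq> V" for z
    using after_subset[of "L @ [s]" z] after_subset[of "rev L @ [s]" z] L(2) sV by auto
  have pos: "0 < a z" "0 < b z" if "z \<in> V" for z
    using that q t[of z] avg_avail_pos[OF q] by (auto simp: a_def b_def)
  have sL: "s \<notin> set L" using L by auto
  have Ns: "(\<Sum>c\<in>cols q E V. real (q - card (c ` {y\<in>S. E z y}))) \<le> real q * N" for S z
  proof -
    have "(\<Sum>c\<in>cols q E V. real (q - card (c ` {y\<in>S. E z y}))) \<le> (\<Sum>c\<in>cols q E V. real q)"
      by (intro sum_mono) auto
    then show ?thesis by (simp add: N_def mult.commute)
  qed
  have "N \<le> (\<Prod>z\<in>V. a z)"
    unfolding N_def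
  proof (rule card_cols_le_prod[OF E, of "rev L @ [s]"])
    show "(\<Sum>c\<in>cols q E V. real (q - card (c ` {y\<in>after (rev L @ [s]) z. E z y})))
        \<le> a z * real (card (cols q E V))" if "z \<in> V" for z
    proof (cases "z = s")
      case True
      then show ?thesis using Ns by (simp add: a_def N_def)
    next
      case False
      then show ?thesis using avg[OF aft(2)[of z], of "t z" z] t[of z] that by (simp add: a_def N_def X_def)
    qed
  qed (use d sL L pos sV in auto)
  moreover have "N \<le> (\<Prod>z\<in>V. b z)"
    unfolding N_def
  proof (rule card_cols_le_prod[OF E, of "L @ [s]"])
    show "(\<Sum>c\<in>cols q E V. real (q - card (c ` {y\<in>after (L @ [s]) z. E z y})))
        \<le> b z * real (card (cols q E V))" if "z \<in> V" for z
    proof (cases "z = s")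
      case True
      then show ?thesis using Ns by (simp add: b_def N_def)
    next
      case False
      then show ?thesis
        using avg[OF aft(1)[of z], of "q - t z" z] t[of z] that by (simp add: b_def N_def Y_def)
    qed
  qed (use d sL L pos sV in auto)
  moreover have "0 \<le> N" by (simp add: N_def)
  ultimately have "N * N \<le> (\<Prod>z\<in>V. a z) * (\<Prod>z\<in>V. b z)"
    by (intro mult_mono) auto
  also have "\<dots> = (\<Prod>z\<in>V. a z * b z)" by (simp add: prod.distrib)
  also have "\<dots> = (real q)\<^sup>2 * (\<Prod>z\<in>V - {s}. a z * b z)"
    using V sV by (simp add: prod.remove[of V s] a_def b_def power2_eq_square)
  also have "(\<Prod>z\<in>V - {s}. a z * b z) \<le> (\<Prod>z\<in>V - {s}. real q * (real q - 1) / 2)"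
  proof (rule prod_mono)
    fix z assume z: "z \<in> V - {s}"
    then show "0 \<le> a z * b z \<and> a z * b z \<le> real q * (real q - 1) / 2"
      using pos[of z] avg_avail_mult_le[of "t z" q] t[OF z] by (auto simp: a_def b_def less_imp_le)
  qed
  also have "(\<Prod>z\<in>V - {s}. real q * (real q - 1) / 2) = (real q * (real q - 1) / 2) ^ (card V - 1)"
    using V sV by simp
  finally show ?thesis by (simp add: N_def power2_eq_square mult_left_mono)
qed

section \<open>Numerical inequalities\<close>

lemma exp_33_16: "exp (33 / 16 :: real) \<le> 8"
proof -
  \<comment> \<open>132/64 = 33/16; the power 132 = 12 * 11 is split so that an intermediate
    rounding keeps the numbers small.\<close>
  have "exp (1 / 64 :: real) \<le> 1 + 1 / 64 + (1 / 64)\<^sup>2" by (intro exp_bound) auto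
  then have "exp (1 / 64 :: real) ^ 132 \<le> (1 + 1 / 64 + (1 / 64)\<^sup>2) ^ 132" by (intro power_mono) auto
  also have "\<dots> = ((1 + 1 / 64 + (1 / 64)\<^sup>2) ^ 12) ^ 11" by (simp add: power_mult[symmetric])
  also have "\<dots> \<le> (1208 / 1000) ^ 11" by (intro power_mono) (simp_all add: power2_eq_square power_divide)
  also have "\<dots> \<le> 8" by (simp add: power_divide)
  finally show ?thesis by (simp add: exp_of_nat_mult[symmetric])
qed

text \<open>Up to polynomial factors the sides decay like 8^(-m) and e^(-2m), so the narrow fact e^2
  < 8 decides. In the induction step the left side changes by the factor X * Y and the right side by
  Z.\<close>

lemma tomescu_numeric:
  fixes m :: nat
  assumes "m \<ge> 3"
  shows "((real m + 1) / (2 * real m)) ^ (3 * m - 1) \<le> (fact m / real m ^ m)\<^sup>2"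
proof -
  consider "m = 3" | "m = 4" | "m = 5" | "m = 6" | "m \<ge> 7" using assms by linarith
  then show ?thesis
  proof cases
    case 5
    then show ?thesis
    proof (induction m rule: dec_induct)
      case base
      show ?case by (simp add: fact_numeral power2_eq_square power_divide)
    next
      case (step m)
      define M where "M = real m"
      have M: "M \<ge> 7" using step by (simp add: M_def)
      define X where "X = (M * (M + 2) / (M + 1)\<^sup>2) ^ (3 * m - 1)"
      define Y where "Y = ((M + 2) / (2 * (M + 1))) ^ 3"
      define Z where "Z = ((M / (M + 1)) ^ m)\<^sup>2"
      have "X \<le> exp ((3 * M - 1) * (- 1 / (M + 1)\<^sup>2))"
      proof -
        have "M * (M + 2) / (M + 1)\<^sup>2 = 1 + (- 1 / (M + 1)\<^sup>2)"
        proof -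
          have "M * (M + 2) = (M + 1)\<^sup>2 - 1" by (simp add: power2_eq_square algebra_simps)
          then show ?thesis using M by (simp add: diff_divide_distrib)
        qed
        also have "\<dots> \<le> exp (- 1 / (M + 1)\<^sup>2)" by (rule exp_ge_add_one_self)
        finally have "X \<le> exp (- 1 / (M + 1)\<^sup>2) ^ (3 * m - 1)"
          unfolding X_def using M by (intro power_mono) auto
        also have "\<dots> = exp (real (3 * m - 1) * (- 1 / (M + 1)\<^sup>2))" by (rule exp_of_nat_mult[symmetric])
        also have "real (3 * m - 1) = 3 * M - 1" using step by (simp add: M_def of_nat_diff)
        finally show ?thesis .
      qed
      moreover have "Y \<le> exp (3 / (M + 1)) / 8"
      proof -
        have "(M + 2) / (2 * (M + 1)) = (1 + 1 / (M + 1)) / 2" using M by (simp add: field_simps)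
        also have "\<dots> \<le> exp (1 / (M + 1)) / 2" using exp_ge_add_one_self[of "1 / (M + 1)"] by (intro divide_right_mono) auto
        finally have "Y \<le> (exp (1 / (M + 1)) / 2) ^ 3" unfolding Y_def using M by (intro power_mono) auto
        also have "\<dots> = exp (3 / (M + 1)) / 8"
          by (simp add: power_divide exp_of_nat_mult[symmetric])
        finally show ?thesis .
      qed
      moreover have "exp (- 2) \<le> Z"
      proof -
        have "(M + 1) / M \<le> exp (1 / M)"
          using exp_ge_add_one_self[of "1 / M"] M by (simp add: field_simps)
        then have "((M + 1) / M) ^ m \<le> exp (1 / M) ^ m" using M by (intro power_mono) auto
        also have "\<dots> = exp 1" using M step by (simp add: exp_of_nat_mult[symmetric] M_def)
        finally have "exp (- 1) \<le> (M / (M + 1)) ^ m"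
          using M by (simp add: exp_minus power_divide field_simps)
        then have "exp (- 1) ^ 2 \<le> Z" unfolding Z_def by (intro power_mono) auto
        then show ?thesis by (simp add: exp_of_nat_mult[symmetric])
      qed
      moreover have "exp ((3 * M - 1) * (- 1 / (M + 1)\<^sup>2)) * (exp (3 / (M + 1)) / 8) \<le> exp (- 2)"
      proof -
        have "(3 * M - 1) * (- 1 / D\<^sup>2) + 3 / D = 4 / D\<^sup>2" if "D = M + 1" for D
        proof -
          have "D \<noteq> 0" using M that by simp
          then have "3 / D = 3 * D / D\<^sup>2" by (simp add: power2_eq_square)
          moreover have "(3 * M - 1) * (- 1 / D\<^sup>2) = (1 - 3 * M) / D\<^sup>2"
            unfolding times_divide_eq_right by (rule arg_cong[where f = "\<lambda>x. x / D\<^sup>2"]) simp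
          ultimately have "(3 * M - 1) * (- 1 / D\<^sup>2) + 3 / D = (1 - 3 * M + 3 * D) / D\<^sup>2"
            by (simp only: add_divide_distrib)
          then show ?thesis using that by simp
        qed
        from this[OF refl] have eq: "(3 * M - 1) * (- 1 / (M + 1)\<^sup>2) + 3 / (M + 1) = 4 / (M + 1)\<^sup>2" .
        \<comment> \<open>From M = 7 on the exponent is at most 33/16 - 2, and exp (33/16) is still
          below 8. With M = 6 this estimate would fail, so the smaller cases are computed.\<close>
        have "64 \<le> (M + 1)\<^sup>2" using M power_mono[of 8 "M + 1" 2] by simp
        then have "4 / (M + 1)\<^sup>2 \<le> 1 / 16" by (simp add: divide_le_eq)
        then have "4 / (M + 1)\<^sup>2 \<le> 33 / 16 + (- 2)" by simp
        then have "exp (4 / (M + 1)\<^sup>2) \<le> exp (33 / 16 + (- 2))" by (simp only: exp_le_cancel_iff)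
        also have "\<dots> = exp (33 / 16) * exp (- 2)" by (rule exp_add)
        also have "\<dots> \<le> 8 * exp (- 2)" using exp_33_16 by (intro mult_right_mono) auto
        finally have "exp ((3 * M - 1) * (- 1 / (M + 1)\<^sup>2)) * exp (3 / (M + 1)) \<le> 8 * exp (- 2)"
          unfolding eq[symmetric] exp_add .
        then show ?thesis by linarith
      qed
      moreover have "0 \<le> X" "0 \<le> Y" using M by (simp_all add: X_def Y_def)
      ultimately have XYZ: "X * Y \<le> Z"
        using mult_mono[of X "exp ((3 * M - 1) * (- 1 / (M + 1)\<^sup>2))" Y "exp (3 / (M + 1)) / 8"] by linarith
      have "((real (Suc m) + 1) / (2 * real (Suc m))) ^ (3 * Suc m - 1) = ((M + 2) / (2 * (M + 1))) ^ ((3 * m - 1) + 3)"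
        using step by (simp add: M_def algebra_simps)
      also have "\<dots> = ((M + 2) / (2 * (M + 1))) ^ (3 * m - 1) * Y" by (simp only: power_add Y_def)
      also have "(M + 2) / (2 * (M + 1)) = (M + 1) / (2 * M) * (M * (M + 2) / (M + 1)\<^sup>2)"
      proof -
        have "(D + 1) / (2 * D) = D / (2 * M) * (M * (D + 1) / D\<^sup>2)" if "D \<noteq> 0" for D
          using M that by (simp add: power2_eq_square)
        from this[of "M + 1"] show ?thesis using M by (simp add: add.assoc)
      qed
      also have "\<dots> ^ (3 * m - 1) * Y = ((M + 1) / (2 * M)) ^ (3 * m - 1) * (X * Y)"
        by (simp only: power_mult_distrib X_def mult.assoc)
      also have "\<dots> \<le> (fact m / M ^ m)\<^sup>2 * Z"
        using step.IH XYZ \<open>0 \<le> X\<close> \<open>0 \<le> Y\<close> by (intro mult_mono) (auto simp: M_def)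
      also have "\<dots> = (fact (Suc m) / real (Suc m) ^ Suc m)\<^sup>2"
      proof -
        have "fact m / M ^ m * (M / (M + 1)) ^ m = fact (Suc m) / real (Suc m) ^ Suc m"
          using M by (simp add: M_def power_divide add.commute)
        then show ?thesis unfolding Z_def by (simp only: power_mult_distrib[symmetric])
      qed
      finally show ?case .
    qed
  qed (simp_all add: fact_numeral power2_eq_square power_divide)
qed

text \<open>With m = q - 1, division by m^(2 (n - 1)) leaves the preceding inequality. For q = 4 the
  threshold n = 9 is sharp for this argument: (2/3)^7 > (2/9)^2.\<close>

lemma square_bound_le_tomescu:
  assumes q: "q \<ge> 4" and n: "n \<ge> 3 * q - 3"
  shows "(real q)\<^sup>2 * (real q * (real q - 1) / 2) ^ (n - 1) \<le> (tomescu q n)\<^sup>2"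
proof -
  obtain m where m: "q = Suc m" "m \<ge> 3" using q by (cases q) auto
  define M where "M = real m"
  have M: "M \<ge> 3" using m by (simp add: M_def)
  have "((M + 1) / (2 * M)) ^ (n - 1) \<le> ((M + 1) / (2 * M)) ^ (3 * m - 1)"
    using n m M by (intro power_decreasing) auto
  also have "\<dots> \<le> (fact m / M ^ m)\<^sup>2" using tomescu_numeric[OF m(2)] by (simp add: M_def)
  finally have le: "((M + 1) / (2 * M)) ^ (n - 1) \<le> (fact m / M ^ m)\<^sup>2" .
  have "(real q * (real q - 1) / 2) = (M + 1) / (2 * M) * M\<^sup>2"
    using M by (simp add: m power2_eq_square) (simp add: M_def algebra_simps)
  then have "(real q)\<^sup>2 * (real q * (real q - 1) / 2) ^ (n - 1)
      = (real q)\<^sup>2 * (((M + 1) / (2 * M)) ^ (n - 1) * (M\<^sup>2) ^ (n - 1))"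
    by (simp only: power_mult_distrib)
  also have "\<dots> \<le> (real q)\<^sup>2 * ((fact m / M ^ m)\<^sup>2 * (M\<^sup>2) ^ (n - 1))"
    using le by (intro mult_left_mono mult_right_mono) auto
  also have "\<dots> = (real q * (fact m / M ^ m) * M ^ (n - 1))\<^sup>2"
    by (simp only: power_mult_distrib power_mult[symmetric] mult.assoc mult.commute[of 2])
  also have "real q * (fact m / M ^ m) * M ^ (n - 1) = tomescu q n"
  proof -
    have "n = Suc (n - 1)" using n q by simp
    then have "M ^ n = M * M ^ (n - 1)" by (metis power_Suc)
    then have "tomescu q n = real q * fact m * (M * M ^ (n - 1)) / (M * M ^ m)"
      by (simp add: tomescu_def m M_def)
    then show ?thesis using M by simp
  qed
  finally show ?thesis .
qed

text \<open>A minimal graph on \<open>n > q\<close> vertices has at most \<open>minimal_factor q n \<cdot> tomescu q n\<close>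
  colourings. The estimate of the next size loses slightly more than it gains once \<open>n \<ge> 2 q\<close>, and
  the slack \<open>outer_factor q\<close> collected below \<open>2 q\<close> pays for this up to \<open>n = 3 q - 4\<close>.\<close>

definition outer_factor :: "nat \<Rightarrow> real" where
  "outer_factor q = (if q = 4 then 7 / 9 else 11 / 16)"

definition minimal_factor :: "nat \<Rightarrow> nat \<Rightarrow> real" where
  "minimal_factor q n = (if n < 2 * q then outer_factor q
            else if n < 3 * q - 3 then outer_factor q * (1 + 1 / (2 * real q - 2)) * (1 + (real n - 2 * real q) / (4 * (real q - 4)))
            else 1)"

lemma minimal_factor_bounds:
  assumes q: "q \<ge> 4"
  shows "outer_factor q \<le> minimal_factor q n" "minimal_factor q n \<le> 1"
proof -
  have "outer_factor q \<le> minimal_factor q n \<and> minimal_factor q n \<le> 1"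
  proof (cases "2 * q \<le> n \<and> n < 3 * q - 3")
    case False
    then show ?thesis by (auto simp: minimal_factor_def outer_factor_def)
  next
    case True
    show ?thesis
    proof (cases "q = 4")
      case True4: True
      \<comment> \<open>The divisor 4 (q - 4) is 0 here, and the quotient in
        \<open>minimal_factor\<close> evaluates to 0.\<close>
      then have "n = 8" using True by simp
      then show ?thesis using True4 by (simp add: minimal_factor_def outer_factor_def)
    next
      case False
      then have q5: "real q \<ge> 5" using q by simp
      have "real n \<le> 3 * real q - 4" using True q by (simp add: nat_less_real_le of_nat_diff)
      then have "real n - 2 * real q \<le> real q - 4" by simp
      then have 1: "(real n - 2 * real q) / (4 * (real q - 4)) \<le> 1 / 4"
        using q5 by (simp add: divide_le_eq)
      have n0: "0 \<le> (real n - 2 * real q) / (4 * (real q - 4))"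
        using q5 True by (intro divide_nonneg_nonneg) auto
      have 2: "1 / (2 * real q - 2) \<le> 1 / 8" using q5 by (intro divide_left_mono) auto
      have q0: "0 \<le> 1 / (2 * real q - 2)" using q5 by simp
      define K where "K = (1 + 1 / (2 * real q - 2)) * (1 + (real n - 2 * real q) / (4 * (real q - 4)))"
      \<comment> \<open>Enough because 11/16 * 9/8 * 5/4 = 495/512 < 1.\<close>
      have "K \<le> (1 + 1 / 8) * (1 + 1 / 4)"
        unfolding K_def using 1 n0 2 q0 by (intro mult_mono) auto
      moreover have "1 * 1 \<le> K" unfolding K_def using n0 q0 by (intro mult_mono) auto
      moreover have "minimal_factor q n = 11 / 16 * K"
        using True False by (simp add: minimal_factor_def outer_factor_def K_def)
      ultimately show ?thesis using False by (simp add: outer_factor_def)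
    qed
  qed
  then show "outer_factor q \<le> minimal_factor q n" "minimal_factor q n \<le> 1" by auto
qed

text \<open>This is what the pigeonhole bound with \<open>k = 2\<close> needs in order to pass from
  n - 1 to n. At n = 2 q it is an equality, which is the origin of 1 + 1/(2 q - 2); beyond that the
  linear factor pays for the loss.\<close>

lemma minimal_factor_step:
  assumes q: "q \<ge> 4" and n: "2 * q \<le> n" "n < 3 * q - 3"
  shows "(real n - 1) * (real n - real q) * minimal_factor q (n - 1) \<le> (4 * real n - 6 * real q) * (minimal_factor q n * (real q - 1))"
proof (cases "n = 2 * q")
  case True
  then show ?thesis using q n by (simp add: minimal_factor_def field_simps)
next
  case False
  define b where "b = n - 2 * q"
  have b: "n = 2 * q + b" "b \<ge> 1" "b \<le> q - 4" "q \<ge> 5" using n False q by (auto simp: b_def)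
  define Q where "Q = real q"
  define x where "x = real b"
  have Q: "Q \<ge> 5" and x: "1 \<le> x" "x \<le> Q - 4" using b by (auto simp: Q_def x_def of_nat_diff)
  define h where "h = 4 * (Q - 4)"
  have h: "h > 0" using Q by (simp add: h_def)
  define P where "P = (2 * Q + x - 1) * (Q + x)"
  define R where "R = (Q - 1) * (2 * Q + 4 * x)"
  define C where "C = outer_factor q * (1 + 1 / (2 * Q - 2))"
  have C: "C \<ge> 0" using Q by (simp add: C_def outer_factor_def)
  \<comment> \<open>The loss P - R equals 4 minus this product, so it stays bounded while R is
    quadratic in Q; an increment of 1/h per step is enough.\<close>
  have "0 \<le> (x - 1) * (Q - 4 - x)" using x by (intro mult_nonneg_nonneg) auto
  then have "P - R \<le> 4" by (simp add: P_def R_def algebra_simps)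
  then have "(P - R) * (h + x - 1) \<le> 4 * (h + x - 1)" using h x by (intro mult_right_mono) auto
  also have "\<dots> \<le> 20 * Q - 84" using x by (simp add: h_def)
  also have "\<dots> \<le> (Q - 1) * (2 * Q + 4)"
  proof -
    have "0 \<le> 2 * (Q - 9 / 2)\<^sup>2" by simp
    then show ?thesis by (simp add: power2_eq_square algebra_simps)
  qed
  also have "\<dots> \<le> R" unfolding R_def using Q x by (intro mult_left_mono) auto
  finally have "P * (h + x - 1) \<le> R * (h + x)" by (simp add: algebra_simps)
  then have "P * (h + x - 1) / h \<le> R * (h + x) / h" using h by (intro divide_right_mono) auto
  moreover have "P * (h + x - 1) / h = P * (1 + (x - 1) / h)" "R * (h + x) / h = R * (1 + x / h)"
    using h by (simp_all add: add_divide_distrib diff_divide_distrib algebra_simps)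
  ultimately have "P * (1 + (x - 1) / h) \<le> R * (1 + x / h)" by simp
  then have "C * (P * (1 + (x - 1) / h)) \<le> C * (R * (1 + x / h))" using C by (rule mult_left_mono)
  moreover have "\<not> n - 1 < 2 * q" "n - 1 < 3 * q - 3" using b n by auto
  then have "minimal_factor q (n - 1) = C * (1 + (x - 1) / h)"
    using b by (simp add: minimal_factor_def C_def h_def x_def Q_def of_nat_diff)
  moreover have "minimal_factor q n = C * (1 + x / h)"
    using b n by (simp add: minimal_factor_def C_def h_def x_def Q_def)
  moreover have "real n - 1 = 2 * Q + x - 1" "real n - real q = Q + x" "4 * real n - 6 * real q = 2 * Q + 4 * x"
    using b by (simp_all add: Q_def x_def)
  ultimately show ?thesis
    by (simp only: P_def R_def Q_def[symmetric]) (simp only: mult_ac)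
qed

section \<open>The bound of Tomescu for critical edges\<close>

text \<open>If the merged graph is not itself minimal, then removing a last vertex \<open>z\<close> outside a
  minimal core leaves an admissible graph, and \<open>z\<close> has at least \<open>q - 2\<close> neighbours.\<close>

lemma merge_minimal_bound:
  assumes q: "q \<ge> 4" and a: "admissible q E s A B V" and m: "minimal_blocked q E s A B V"
    and xy: "x \<in> V" "y \<in> V" "x \<noteq> y" "\<not> E x y" "y \<noteq> s" and n: "q + 2 \<le> card V"
    and IH: "\<And>E A B V'. admissible q E s A B V' \<Longrightarrow> card V' < card V \<Longrightarrow>
      real (card (cols q E V')) \<le> tomescu q (card V')"
    and IHm: "\<And>E A B V'. admissible q E s A B V' \<Longrightarrow> card V' < card V \<Longrightarrow>
      minimal_blocked q E s A B V' \<Longrightarrow> q < card V' \<Longrightarrow>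
      real (card (cols q E V')) \<le> minimal_factor q (card V') * tomescu q (card V')"
  shows "real (card (cols q (merge_adj E x y) (V - {y})))
    \<le> minimal_factor q (card V - 1) * tomescu q (card V - 1)"
proof -
  note D = admissibleD[OF a]
  define E' A' B' where "E' = merge_adj E x y" and "A' = merge_A E s x y A" and "B' = merge_B s x y B"
  have a': "admissible q E' s A' B' (V - {y})"
    unfolding E'_def A'_def B'_def by (rule merge_admissible[OF a xy])
  note D' = admissibleD[OF a']
  have cV: "card (V - {y}) = card V - 1" using D(2) xy by simp
  obtain C where C: "C \<subseteq> V - {y}" "minimal_blocked q E' s A' B' C"
    by (rule ex_minimal_blocked[OF D'(2,3,5)])
  have sC: "s \<in> C" by (rule minimal_blockedD(1)[OF C(2)])
  have tp: "0 < tomescu q k" for k using q by (intro tomescu_pos) auto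
  show ?thesis
  proof (cases "C = V - {y}")
    case True
    have "real (card (cols q E' (V - {y}))) \<le> minimal_factor q (card (V - {y})) * tomescu q (card (V - {y}))"
      by (rule IHm[OF a']) (use C(2) True cV n in auto)
    then show ?thesis by (simp only: cV E'_def)
  next
    case False
    then have C': "C \<subset> V - {y}" using C by auto
    show ?thesis
    proof (cases "cols q E' (V - {y}) = {}")
      case True
      have "0 \<le> minimal_factor q (card V - 1)" using minimal_factor_bounds(1)[OF q, of "card V - 1"]
        by (simp add: outer_factor_def split: if_splits)
      then show ?thesis using True tp[of "card V - 1"] by (simp add: E'_def)
    next
      case False
      then obtain c where c: "c \<in> cols q E' (V - {y})" by auto
      obtain z where z: "z \<in> V - {y} - C" and az: "admissible q E' s A' B' (V - {y} - {z})"
        by (rule admissible_remove_last[OF a' C(2) C' c])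
      define W where "W = V - {y} - {z}"
      have V: "V - {y} = insert z W" "z \<notin> W" using z by (auto simp: W_def)
      have fW: "finite W" using D(2) by (simp add: W_def)
      have cW: "card W = card V - 2" using D(2) z xy by (simp add: W_def)
      \<comment> \<open>One neighbour may be lost to the contraction and one to the removal of
        \<open>y\<close>.\<close>
      have deg: "q - 2 \<le> card {b\<in>W. E' z b}"
      proof -
        have zV: "z \<in> V" "z \<noteq> s" using z sC by auto
        have "{b\<in>V. E z b} - {y} \<subseteq> {b\<in>W. E' z b}"
          using rootedD(2)[OF D(1)] by (auto simp: W_def E'_def merge_adj_def)
        then have "card ({b\<in>V. E z b} - {y}) \<le> card {b\<in>W. E' z b}"
          using fW by (intro card_mono) auto
        moreover have "card {b\<in>V. E z b} - 1 \<le> card ({b\<in>V. E z b} - {y})"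
          using D(2) by (simp add: card_Diff_singleton_if)
        ultimately show ?thesis using minimal_blocked_degree'[OF D(1) m D(2) zV] by linarith
      qed
      obtain T where T: "T \<subseteq> {b\<in>W. E' z b}" "card T = q - 2"
        using obtain_subset_with_card_n[OF deg] by blast
      have cT: "real (card T) = real q - 2" using T q by (simp add: of_nat_diff)
      have "real (card (cols q E' (insert z W)))
          \<le> (real q - real (card T)) * real (card (cols q E' W)) + real (card T) * (real (card T) - 1) / 2 * tomescu q (card V - 3)"
      proof (rule card_cols_insert_le[OF D'(1) fW V(2) T(1)])
        show "real (card (mono_cols q E' W a b)) \<le> tomescu q (card V - 3)"
          if ab: "a \<in> T" "b \<in> T" "a \<noteq> b" for a b
        proof (rule card_mono_cols_le[OF az[folded W_def]])
          fix c d assume cd: "c \<in> W" "d \<in> W" "c \<noteq> d" "\<not> E' c d" "d \<noteq> s"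
          have "card (W - {d}) = card V - 3" using cd fW cW by simp
          moreover have "card V - 3 < card V" using n by simp
          ultimately show "real (card (cols q (merge_adj E' c d) (W - {d}))) \<le> tomescu q (card V - 3)"
            using IH[OF merge_admissible[OF az[folded W_def] cd]] by simp
        qed (use ab T tp in \<open>auto intro: less_imp_le\<close>)
      qed (use T tp in \<open>auto intro: less_imp_le\<close>)
      also have "real (card (cols q E' W)) \<le> tomescu q (card V - 2)"
        using IH[OF az[folded W_def]] cW n by simp
      also have "card V - 2 = Suc (card V - 3)" using n q by simp
      finally have "real (card (cols q E' (insert z W)))
          \<le> 2 * ((real q - 1) * tomescu q (card V - 3)) + (real q - 2) * (real q - 3) / 2 * tomescu q (card V - 3)"
        using q by (simp add: cT tomescu_Suc mult_left_mono)
      also have "\<dots> = (2 * (real q - 1) + (real q - 2) * (real q - 3) / 2) * tomescu q (card V - 3)"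
        by (simp add: algebra_simps)
      also have "\<dots> \<le> (outer_factor q * (real q - 1)\<^sup>2) * tomescu q (card V - 3)"
      proof (rule mult_right_mono)
        \<comment> \<open>Origin of \<open>outer_factor\<close>: equality holds for q = 4 and for q
          = 5.\<close>
        show "2 * (real q - 1) + (real q - 2) * (real q - 3) / 2 \<le> outer_factor q * (real q - 1)\<^sup>2"
        proof (cases "q = 4")
          case True
          then show ?thesis by (simp add: outer_factor_def)
        next
          case False
          then have "0 \<le> (3 * real q + 1) * (real q - 5)" using q by (intro mult_nonneg_nonneg) auto
          then show ?thesis using False by (simp add: outer_factor_def power2_eq_square field_simps)
        qed
      qed (use tp in \<open>auto intro: less_imp_le\<close>)
      also have "\<dots> = outer_factor q * tomescu q (card V - 1)"
      proof -
        have "card V - 1 = Suc (Suc (card V - 3))" using n q by simp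
        then show ?thesis by (simp add: tomescu_Suc power2_eq_square)
      qed
      also have "\<dots> \<le> minimal_factor q (card V - 1) * tomescu q (card V - 1)"
        using minimal_factor_bounds(1)[OF q] tp by (intro mult_right_mono) (auto intro: less_imp_le)
      finally show ?thesis by (simp add: V(1)[symmetric] E'_def)
    qed
  qed
qed


text \<open>For n = q + 1 identification leads to q vertices, where no sharper bound is available,
  so the slack comes from pigeonhole alone. All larger n use the sharpened collision bound
  \<open>u\<close>.\<close>

lemma minimal_blocked_bound:
  assumes q: "q \<ge> 4" and a: "admissible q E s A B V" and m: "minimal_blocked q E s A B V"
    and n: "q < card V"
    and IH: "\<And>E A B V'. admissible q E s A B V' \<Longrightarrow> card V' < card V \<Longrightarrow>
      real (card (cols q E V')) \<le> tomescu q (card V')"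
    and IHm: "\<And>E A B V'. admissible q E s A B V' \<Longrightarrow> card V' < card V \<Longrightarrow>
      minimal_blocked q E s A B V' \<Longrightarrow> q < card V' \<Longrightarrow>
      real (card (cols q E V')) \<le> minimal_factor q (card V') * tomescu q (card V')"
  shows "real (card (cols q E V)) \<le> minimal_factor q (card V) * tomescu q (card V)"
proof -
  note D = admissibleD[OF a]
  define n where "n = card V"
  define N where "N = real (card (cols q E V))"
  have tp: "0 < tomescu q k" for k using q by (intro tomescu_pos) auto
  have of: "0 < outer_factor q" by (simp add: outer_factor_def)
  have mf0: "0 < minimal_factor q k" for k using minimal_factor_bounds(1)[OF q, of k] of by linarith
  have Suc: "tomescu q n = (real q - 1) * tomescu q (n - 1)"
    using n by (cases n) (auto simp: n_def tomescu_Suc)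
  have q1: "real q - 1 > 0" using q by simp
  show ?thesis
  proof (cases "n = q + 1")
    case True
    have "real (card (mono_cols q E V x y)) \<le> tomescu q q" if "x \<in> V" "y \<in> V" "x \<noteq> y" for x y
    proof (rule card_mono_cols_le[OF a that less_imp_le[OF tp]])
      fix c d assume cd: "c \<in> V" "d \<in> V" "c \<noteq> d" "\<not> E c d" "d \<noteq> s"
      have "card (V - {d}) = q" using cd D(2) True by (simp add: n_def)
      then show "real (card (cols q (merge_adj E c d) (V - {d}))) \<le> tomescu q q"
        using IH[OF merge_admissible[OF a cd]] n by simp
    qed
    from minimal_blocked_mono_bound[OF D(1) m D(2) less_imp_le[OF tp] this, of 1]
    have "2 * N \<le> real q * tomescu q q" using True by (simp add: n_def[symmetric] N_def)
    also have "\<dots> \<le> 2 * outer_factor q * (real q - 1) * tomescu q q"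
      using q tp[of q] by (intro mult_right_mono) (auto simp: outer_factor_def)
    finally have "N \<le> outer_factor q * tomescu q n" using Suc True by simp
    also have "\<dots> \<le> minimal_factor q n * tomescu q n"
      using minimal_factor_bounds(1)[OF q] tp by (intro mult_right_mono) (auto intro: less_imp_le)
    finally show ?thesis by (simp add: N_def n_def)
  next
    case False
    then have n2: "q + 2 \<le> card V" using n by (simp add: n_def)
    define u where "u = minimal_factor q (n - 1) * tomescu q (n - 1)"
    have u0: "0 \<le> u" using mf0 tp by (simp add: u_def less_imp_le)
    have mono: "real (card (mono_cols q E V x y)) \<le> u" if "x \<in> V" "y \<in> V" "x \<noteq> y" for x y
    proof (rule card_mono_cols_le[OF a that u0])
      fix c d assume cd: "c \<in> V" "d \<in> V" "c \<noteq> d" "\<not> E c d" "d \<noteq> s"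
      show "real (card (cols q (merge_adj E c d) (V - {d}))) \<le> u"
        unfolding u_def n_def by (rule merge_minimal_bound[OF q a m cd n2 IH IHm])
    qed
    note bound = minimal_blocked_mono_bound[OF D(1) m D(2) u0 mono, folded n_def N_def]
    have "N \<le> minimal_factor q n * tomescu q n"
    proof -
      consider "n < 2 * q" | "2 * q \<le> n" "n < 3 * q - 3" | "3 * q - 3 \<le> n" by linarith
      then show ?thesis
      proof cases
        case 1
        have nq: "real n - real q > 0" using n by (simp add: n_def)
        \<comment> \<open>After cancelling n - q, passing from n - 1 to n costs (n - 1)/2, which is
          at most q - 1 exactly when n < 2 q.\<close>
        have "(2 * N) * (real n - real q) \<le> ((real n - 1) * u) * (real n - real q)"
          using bound[of 1] by (simp add: algebra_simps)
        then have "2 * N \<le> (real n - 1) * u" using nq by (rule mult_right_le_imp_le)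
        also have "\<dots> \<le> (2 * (real q - 1)) * u" using 1 u0 by (intro mult_right_mono) auto
        finally have "N \<le> (real q - 1) * u" by (simp add: algebra_simps)
        moreover have "n - 1 < 2 * q" using 1 by simp
        then have "(real q - 1) * u = minimal_factor q n * tomescu q n"
          using 1 by (simp add: Suc u_def minimal_factor_def)
        ultimately show ?thesis by simp
      next
        case 2
        have "(4 * real n - 6 * real q) * N \<le> (real n - 1) * (real n - real q) * u"
          using bound[of 2] by simp
        also have "\<dots> = ((real n - 1) * (real n - real q) * minimal_factor q (n - 1)) * tomescu q (n - 1)"
          by (simp add: u_def)
        also have "\<dots> \<le> ((4 * real n - 6 * real q) * (minimal_factor q n * (real q - 1))) * tomescu q (n - 1)"
          using minimal_factor_step[OF q 2] tp by (intro mult_right_mono) (auto intro: less_imp_le)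
        also have "\<dots> = (4 * real n - 6 * real q) * (minimal_factor q n * tomescu q n)"
          by (simp add: Suc)
        finally show ?thesis using 2 q by (simp add: mult_le_cancel_left_pos)
      next
        case 3
        then have "\<not> n < 2 * q" using q by simp
        with 3 have mf: "minimal_factor q n = 1" by (simp add: minimal_factor_def)
        show ?thesis
        proof (rule ccontr)
          assume "\<not> ?thesis"
          \<comment> \<open>Assuming too many colourings is what makes the collision probability at
            most 1/(q - 1).\<close>
          then have N: "tomescu q n < N" by (simp add: mf)
          then have "cols q E V \<noteq> {}" using tp[of n] by (auto simp: N_def)
          then obtain c where c: "c \<in> cols q E V" by auto
          have "u \<le> 1 * tomescu q (n - 1)"
            unfolding u_def using minimal_factor_bounds(2)[OF q] tp
            by (intro mult_right_mono) (auto intro: less_imp_le)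
          also have "\<dots> = tomescu q n / (real q - 1)" using q1 by (simp add: Suc)
          also have "\<dots> \<le> N / (real q - 1)" using N q1 by (simp add: divide_right_mono)
          finally have uN: "u \<le> N / (real q - 1)" .
          have "N\<^sup>2 \<le> (real q)\<^sup>2 * (real q * (real q - 1) / 2) ^ (n - 1)"
            unfolding N_def n_def
          proof (rule minimal_blocked_square_bound[OF D(1) m D(2) c])
            show "real (card (mono_cols q E V a b)) \<le> real (card (cols q E V)) / (real q - 1)"
              if "a \<in> V" "b \<in> V" "a \<noteq> b" for a b
              using mono[OF that] uN by (simp add: N_def)
          qed (use q in simp)
          also have "\<dots> \<le> (tomescu q n)\<^sup>2" by (rule square_bound_le_tomescu[OF q 3])
          finally have "N \<le> tomescu q n" using tp[of n] by (simp add: power2_le_iff_abs_le N_def)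
          then show False using N by simp
        qed
      qed
    qed
    then show ?thesis by (simp add: N_def n_def)
  qed
qed

text \<open>Both bounds are proved together, since the sharper one uses the plain one for smaller
  graphs. Without minimality, a last vertex with at least one neighbour costs a factor q - 1,
  exactly the growth of \<open>tomescu\<close>.\<close>

lemma card_cols_le_tomescu_strong:
  assumes q: "q \<ge> 4"
  shows "admissible q E s A B V \<Longrightarrow>
    real (card (cols q E V)) \<le> tomescu q (card V) \<and>
    (minimal_blocked q E s A B V \<longrightarrow> q < card V \<longrightarrow>
      real (card (cols q E V)) \<le> minimal_factor q (card V) * tomescu q (card V))"
proof (induction "card V" arbitrary: E A B V rule: less_induct)
  case less
  note a = less.prems
  note D = admissibleD[OF a]
  have tp: "0 < tomescu q k" for k using q by (intro tomescu_pos) auto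
  have min: "real (card (cols q E V)) \<le> minimal_factor q (card V) * tomescu q (card V)"
    if "minimal_blocked q E s A B V" "q < card V"
    by (rule minimal_blocked_bound[OF q a that]) (use less.hyps in auto)
  have "real (card (cols q E V)) \<le> tomescu q (card V)"
  proof (cases "cols q E V = {}")
    case True
    then show ?thesis using tp[of "card V"] by simp
  next
    case False
    then obtain c where c: "c \<in> cols q E V" by auto
    obtain C where C: "C \<subseteq> V" "minimal_blocked q E s A B C"
      by (rule ex_minimal_blocked[OF D(2,3,5)])
    show ?thesis
    proof (cases "C = V")
      case True
      have "q \<le> card V" by (rule blocked_card_le[OF D(1,5,3,2) c])
      then consider "card V = q" | "q < card V" by linarith
      then show ?thesis
      proof cases
        case 1
        have "card (cols q E V) \<le> fact q" by (rule card_cols_le_fact[OF D(1,5,3,2) 1])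
        then have "real (card (cols q E V)) \<le> real (fact q)" by (simp only: of_nat_le_iff)
        then show ?thesis using 1 q by (simp add: tomescu_self)
      next
        case 2
        have "real (card (cols q E V)) \<le> minimal_factor q (card V) * tomescu q (card V)"
          using min C True 2 by simp
        also have "\<dots> \<le> 1 * tomescu q (card V)"
          using minimal_factor_bounds(2)[OF q] tp by (intro mult_right_mono) (auto intro: less_imp_le)
        finally show ?thesis by simp
      qed
    next
      case False
      then have "C \<subset> V" using C by auto
      then obtain z where z: "z \<in> V - C" and az: "admissible q E s A B (V - {z})"
        and "\<exists>y\<in>V - {z}. E z y"
        by (rule admissible_remove_last[OF a C(2) _ c])
      then obtain y where y: "y \<in> V - {z}" "E z y" by blast
      have V: "insert z (V - {z}) = V" using z by auto
      have cV: "card V = Suc (card (V - {z}))" using z D(2) by (metis DiffD1 card.remove)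
      have "real (card (cols q E (insert z (V - {z}))))
          \<le> (real q - real (card {y})) * real (card (cols q E (V - {z}))) + real (card {y}) * (real (card {y}) - 1) / 2 * 1"
        using y q D(2) by (intro card_cols_insert_le[OF D(1), of "V - {z}" z "{y}" q 1]) auto
      then have "real (card (cols q E V)) \<le> (real q - 1) * real (card (cols q E (V - {z})))"
        unfolding V by simp
      also have "\<dots> \<le> (real q - 1) * tomescu q (card (V - {z}))"
        using less.hyps[OF _ az] cV q by (intro mult_left_mono) auto
      also have "\<dots> = tomescu q (card V)" by (simp add: cV tomescu_Suc)
      finally show ?thesis .
    qed
  qed
  with min show ?case by blast
qed

theorem card_cols_le_tomescu:
  assumes "q \<ge> 4" "admissible q E s A B V"
  shows "real (card (cols q E V)) \<le> tomescu q (card V)"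
  using card_cols_le_tomescu_strong[OF assms] by blast

section \<open>Graphs with several components\<close>

lemma card_cols_insert_le_mult:
  assumes "symp E" "irreflp E" "finite W" "z \<notin> W"
  shows "card (cols q E (insert z W)) \<le> q * card (cols q E W)"
proof -
  have "real (card (cols q E (insert z W))) = (\<Sum>c\<in>cols q E W. real (q - card (c ` {y\<in>W. E z y})))"
    using sum_cols_insert[OF assms(3,4,1,2), where f = "\<lambda>_. 1" and q = q] by simp
  also have "\<dots> \<le> (\<Sum>c\<in>cols q E W. real q)" by (intro sum_mono) auto
  finally have "real (card (cols q E (insert z W))) \<le> real (q * card (cols q E W))"
    by (simp add: mult.commute)
  then show ?thesis by (simp only: of_nat_le_iff)
qed

lemma card_cols_insert_adjacent_le:
  assumes "symp E" "irreflp E" "finite W" "z \<notin> W" "y \<in> W" "E z y"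
  shows "card (cols q E (insert z W)) \<le> (q - 1) * card (cols q E W)"
proof -
  have "real (card (cols q E (insert z W))) = (\<Sum>c\<in>cols q E W. real (q - card (c ` {y\<in>W. E z y})))"
    using sum_cols_insert[OF assms(3,4,1,2), where f = "\<lambda>_. 1" and q = q] by simp
  also have "\<dots> \<le> (\<Sum>c\<in>cols q E W. real (q - 1))"
  proof (rule sum_mono)
    fix c :: "'a \<Rightarrow> nat"
    have "0 < card (c ` {y\<in>W. E z y})" using assms by (subst card_gt_0_iff) auto
    then show "real (q - card (c ` {y\<in>W. E z y})) \<le> real (q - 1)" by simp
  qed
  finally have "real (card (cols q E (insert z W))) \<le> real ((q - 1) * card (cols q E W))"
    by (simp add: mult.commute)
  then show ?thesis by (simp only: of_nat_le_iff)
qed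

lemma card_cols_Un_le:
  assumes "symp E" "irreflp E" "finite W" "finite R"
  shows "card (cols q E (W \<union> R)) \<le> q ^ card (R - W) * card (cols q E W)"
  using \<open>finite R\<close>
proof (induction R)
  case empty
  then show ?case by simp
next
  case (insert z R)
  show ?case
  proof (cases "z \<in> W")
    case True
    then have "W \<union> insert z R = W \<union> R" "insert z R - W = R - W" by auto
    then show ?thesis using insert by simp
  next
    case False
    have "card (cols q E (insert z (W \<union> R))) \<le> q * card (cols q E (W \<union> R))"
      using assms insert False by (intro card_cols_insert_le_mult) auto
    also have "\<dots> \<le> q * (q ^ card (R - W) * card (cols q E W))" using insert by simp
    also have "\<dots> = q ^ card (insert z R - W) * card (cols q E W)"
      using insert False by (simp add: insert_Diff_if)
    finally show ?thesis by simp
  qed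
qed

text \<open>\<open>W0\<close> will contain a vertex of every component, so every larger set can be
  extended by an adjacent vertex, at the price of a factor q - 1.\<close>

lemma card_cols_grow_le:
  assumes E: "symp E" "irreflp E" and V: "finite V"
    and grow: "\<And>W. W0 \<subseteq> W \<Longrightarrow> W \<subset> V \<Longrightarrow> \<exists>x\<in>W. \<exists>y\<in>V - W. E x y"
    and W: "W0 \<subseteq> W" "W \<subseteq> V"
  shows "card (cols q E V) \<le> (q - 1) ^ card (V - W) * card (cols q E W)"
  using W
proof (induction "card (V - W)" arbitrary: W)
  case 0
  then have "W = V" using V by auto
  then show ?case by simp
next
  case (Suc n)
  then have "W \<subset> V" by (metis Diff_cancel card.empty nat.distinct(1) psubsetI)
  then obtain x y where xy: "x \<in> W" "y \<in> V" "y \<notin> W" "E x y" using grow[OF Suc.prems(1)] by blast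
  have V': "V - W = insert y (V - insert y W)" using xy by auto
  have cV: "card (V - W) = Suc (card (V - insert y W))"
    using V by (subst V') simp
  then have "card (cols q E V) \<le> (q - 1) ^ card (V - insert y W) * card (cols q E (insert y W))"
    using Suc.prems Suc.hyps(2) xy by (intro Suc.hyps(1)) auto
  also have "card (cols q E (insert y W)) \<le> (q - 1) * card (cols q E W)"
    using xy sympD[OF E(1) xy(4)] finite_subset[OF Suc.prems(2) V]
    by (intro card_cols_insert_adjacent_le[OF E, of W y x]) auto
  finally show ?case using cV by (simp add: mult_ac)
qed

section \<open>Components and their representatives\<close>

abbreviation edge_rel :: "'a ugraph \<Rightarrow> ('a \<times> 'a) set" where
  "edge_rel H \<equiv> {(x, y). {x, y} \<in> edges H}"

lemma simple_edge:
  assumes "simple_graph H" "{x, y} \<in> edges H"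
  shows "x \<in> verts H" "y \<in> verts H" "x \<noteq> y"
proof -
  have "{x, y} \<subseteq> verts H" "card {x, y} = 2" using assms by (auto simp: simple_graph_def)
  then show "x \<in> verts H" "y \<in> verts H" "x \<noteq> y" by auto
qed

lemma edge_rel_closed:
  assumes "simple_graph H" "(x, y) \<in> (edge_rel H)\<^sup>*" "x \<in> verts H"
  shows "y \<in> verts H"
  using assms(2,3)
proof (induction rule: rtrancl_induct)
  case (step y z)
  then show ?case using simple_edge(2)[OF assms(1), of y z] by simp
qed

lemma equiv_reachable: "simple_graph H \<Longrightarrow> equiv (verts H) (reachable H)"
proof -
  assume H: "simple_graph H"
  have "sym (edge_rel H)" by (auto simp: sym_def insert_commute)
  then have s: "sym ((edge_rel H)\<^sup>*)" by (rule sym_rtrancl)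
  show ?thesis
  proof (rule equivI)
    show "refl_on (verts H) (reachable H)" by (auto simp: refl_on_def reachable_def)
    show "sym (reachable H)" using s by (auto simp: reachable_def sym_def)
    show "trans (reachable H)" by (auto simp: reachable_def trans_def intro: rtrancl_trans)
  qed (auto simp: reachable_def)
qed

text \<open>The vertex \<open>u\<close> is forced to represent its own component; this later keeps
  the other end of the contracted edge out of \<open>R\<close>.\<close>

lemma ex_representatives:
  assumes H: "simple_graph H"
  obtains R where "R \<subseteq> verts H" "card R = num_components H"
    "\<And>y. y \<in> verts H \<Longrightarrow> \<exists>r\<in>R. (r, y) \<in> (edge_rel H)\<^sup>*"
    "u \<in> verts H \<Longrightarrow> u \<in> R" "\<And>w. w \<in> R \<Longrightarrow> (u, w) \<in> (edge_rel H)\<^sup>* \<Longrightarrow> u \<in> verts H \<Longrightarrow> w = u"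
proof -
  note eq = equiv_reachable[OF H]
  let ?Q = "verts H // reachable H"
  define f where "f X = (if u \<in> X then u else SOME x. x \<in> X)" for X
  have f: "f X \<in> X" if "X \<in> ?Q" for X
  proof -
    have "X \<noteq> {}" using in_quotient_imp_non_empty[OF eq that] .
    then show ?thesis by (auto simp: f_def intro: someI)
  qed
  have inj: "inj_on f ?Q"
    by (rule inj_onI) (metis f eq quotient_disj IntI empty_iff)
  show ?thesis
  proof (rule that[of "f ` ?Q"])
    show "f ` ?Q \<subseteq> verts H" using f in_quotient_imp_subset[OF eq] by blast
    show "card (f ` ?Q) = num_components H" using inj by (simp add: card_image num_components_def)
    show "\<exists>r\<in>f ` ?Q. (r, y) \<in> (edge_rel H)\<^sup>*" if y: "y \<in> verts H" for y
    proof -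
      let ?X = "reachable H `` {y}"
      have X: "?X \<in> ?Q" using y by (rule quotientI)
      have "(y, f ?X) \<in> reachable H" using f[OF X] by auto
      then have "(f ?X, y) \<in> reachable H" using eq by (auto elim: equivE dest: symD)
      then show ?thesis using X by (auto simp: reachable_def)
    qed
    show "u \<in> f ` ?Q" if u: "u \<in> verts H"
    proof -
      have "u \<in> reachable H `` {u}" using u by (auto simp: reachable_def)
      then have "f (reachable H `` {u}) = u" by (simp add: f_def)
      then show ?thesis using quotientI[OF u, of "reachable H"] by (metis imageI)
    qed
    show "w = u" if w: "w \<in> f ` ?Q" "(u, w) \<in> (edge_rel H)\<^sup>*" "u \<in> verts H" for w
    proof -
      obtain X where X: "X \<in> ?Q" "w = f X" using w by auto
      have "w \<in> verts H" using edge_rel_closed[OF H w(2,3)] .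
      then have "(u, w) \<in> reachable H" using w by (auto simp: reachable_def)
      moreover have "w \<in> X" using f X by auto
      ultimately have "u \<in> X" using in_quotient_imp_closed[OF eq X(1), of w u] eq
        by (auto elim: equivE dest: symD)
      then show ?thesis using X by (simp add: f_def)
    qed
  qed
qed

abbreviation adj :: "'a set set \<Rightarrow> 'a \<Rightarrow> 'a \<Rightarrow> bool" where
  "adj X \<equiv> \<lambda>x y. {x, y} \<in> X"

section \<open>Contracting an edge of a graph without q-colouring\<close>

locale uncolourable_edge =
  fixes H :: "'a ugraph" and u v :: 'a and q :: nat
  assumes simple: "simple_graph H" and uv: "{u, v} \<in> edges H"
    and uncolourable: "\<And>c. \<not> proper_colouring H q c"
begin

abbreviation "D \<equiv> adj (edges H - {{u, v}})"
abbreviation "F \<equiv> merge_adj D u v"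
abbreviation "W \<equiv> verts H - {v}"

lemma fin: "finite (verts H)" using simple by (simp add: simple_graph_def)

lemma uv_verts: "u \<in> verts H" "v \<in> verts H" "u \<noteq> v"
  using simple_edge[OF simple uv] by auto

lemma D_sym: "symp D"
  by (rule sympI) (auto simp: insert_commute)

lemma D_irrefl: "irreflp D"
  using simple_edge(3)[OF simple, of x x for x] by (intro irreflpI) blast

lemma rooted_F: "rooted F u {y. D u y} {y. D v y}"
proof -
  \<comment> \<open>\<open>rooted\<close> sees only the union of the halves. So \<open>v\<close> is
    merged into the root with \<open>B\<close> empty, and the result is split again into the
    neighbourhoods of \<open>u\<close> and \<open>v\<close>.\<close>
  have "rooted D u {y. D u y} {}" using D_sym D_irrefl by (simp add: rooted_def)
  then have "rooted F u (merge_A D u u v {y. D u y}) (merge_B u u v {})"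
    using uv_verts by (intro merge_rooted) auto
  then show ?thesis by (simp add: rooted_def merge_A_def merge_B_def)
qed

text \<open>A colouring of \<open>D\<close> that separates \<open>u\<close> and \<open>v\<close>
  would colour \<open>H\<close>; hence all of them survive the contraction.\<close>

lemma card_cols_delete_edge_le: "card (cols q D (verts H)) \<le> card (cols q F W)"
proof -
  have "cols q D (verts H) \<subseteq> mono_cols q D (verts H) u v"
  proof
    fix c assume c: "c \<in> cols q D (verts H)"
    have "c u = c v"
    proof (rule ccontr)
      assume neq: "c u \<noteq> c v"
      have "proper_colouring H q c" unfolding proper_colouring_def
      proof (intro conjI ballI allI impI)
        fix x y assume xy: "{x, y} \<in> edges H"
        show "c x \<noteq> c y"
        proof (cases "{x, y} = {u, v}")
          case True
          then show ?thesis using neq by (auto simp: doubleton_eq_iff)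
        next
          case False
          then show ?thesis using cols_proper[OF c] simple_edge[OF simple xy] xy by blast
        qed
      qed (use cols_less[OF c] in auto)
      then show False using uncolourable by blast
    qed
    then show "c \<in> mono_cols q D (verts H) u v" using c by (simp add: mono_cols_def)
  qed
  then have "card (cols q D (verts H)) \<le> card (mono_cols q D (verts H) u v)"
    using fin by (intro card_mono) (auto simp: mono_cols_def)
  also have "\<dots> \<le> card (cols q F W)"
    using fin uv_verts D_sym by (intro card_mono_cols_le_merge) auto
  finally show ?thesis .
qed

text \<open>A walk in \<open>H\<close> that passes through \<open>v\<close> is followed in the
  contraction at the root \<open>u\<close>, which lies in \<open>X\<close>.\<close>

lemma closed_reach:
  assumes X: "u \<in> X" and closed: "\<And>x y. x \<in> X \<Longrightarrow> y \<in> W - X \<Longrightarrow> \<not> F x y"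
    and xy: "(x, y) \<in> (edge_rel H)\<^sup>*" and x: "x \<in> X"
  shows "y \<in> insert v X"
  using xy
proof (induction rule: rtrancl_induct)
  case base
  then show ?case using x by simp
next
  case (step y z)
  have yz: "{y, z} \<in> edges H" using step by simp
  show ?case
  proof (rule ccontr)
    assume z: "z \<notin> insert v X"
    have zW: "z \<in> W - X" using z simple_edge(2)[OF simple yz] by auto
    show False
    proof (cases "y = v")
      case True
      then have "D v z" using yz z X by (auto simp: doubleton_eq_iff)
      then have "F u z" by (simp add: merge_adj_def)
      then show False using closed[OF X zW] by simp
    next
      case False
      then have "y \<in> X" using step by auto
      moreover have "D y z" using yz z False by (auto simp: doubleton_eq_iff)
      ultimately show False using closed[OF _ zW, of y] by (auto simp: merge_adj_def)
    qed
  qed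
qed

lemma ex_growing_roots:
  obtains R where "R \<subseteq> W" "card R = num_components H" "u \<in> R"
    "\<And>X. R \<subseteq> X \<Longrightarrow> X \<subset> W \<Longrightarrow> \<exists>x\<in>X. \<exists>y\<in>W - X. F x y"
proof -
  obtain R where R: "R \<subseteq> verts H" "card R = num_components H"
    "\<And>y. y \<in> verts H \<Longrightarrow> \<exists>r\<in>R. (r, y) \<in> (edge_rel H)\<^sup>*"
    "u \<in> verts H \<Longrightarrow> u \<in> R" "\<And>w. w \<in> R \<Longrightarrow> (u, w) \<in> (edge_rel H)\<^sup>* \<Longrightarrow> u \<in> verts H \<Longrightarrow> w = u"
    using ex_representatives[OF simple, of u] by metis
  have "(u, v) \<in> (edge_rel H)\<^sup>*" using uv by auto
  then have "v \<notin> R" using R(5)[of v] uv_verts by auto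
  show ?thesis
  proof (rule that[of R])
    show "R \<subseteq> W" using R(1) \<open>v \<notin> R\<close> by auto
    show "card R = num_components H" by (rule R(2))
    show "u \<in> R" using R(4) uv_verts by simp
    show "\<exists>x\<in>X. \<exists>y\<in>W - X. F x y" if X: "R \<subseteq> X" "X \<subset> W" for X
    proof (rule ccontr)
      assume "\<not> ?thesis"
      then have closed: "\<And>x y. x \<in> X \<Longrightarrow> y \<in> W - X \<Longrightarrow> \<not> F x y" by blast
      have "W \<subseteq> X"
      proof
        fix y assume y: "y \<in> W"
        then obtain r where r: "r \<in> R" "(r, y) \<in> (edge_rel H)\<^sup>*" using R(3) by blast
        have "y \<in> insert v X"
          by (rule closed_reach[OF _ closed r(2)]) (use r R(4) uv_verts X in auto)
        then show "y \<in> X" using y by auto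
      qed
      then show False using X by auto
    qed
  qed
qed

text \<open>Representatives have q choices each; every further vertex is attached to an earlier one
  and has q - 1.\<close>

lemma trivial_bound:
  "card (cols q D (verts H)) \<le> q ^ num_components H * (q - 1) ^ (num_verts H - 1 - num_components H)"
  "num_components H < num_verts H"
proof -
  obtain R where R: "R \<subseteq> W" "card R = num_components H" "u \<in> R"
    "\<And>X. R \<subseteq> X \<Longrightarrow> X \<subset> W \<Longrightarrow> \<exists>x\<in>X. \<exists>y\<in>W - X. F x y"
    by (rule ex_growing_roots) blast
  have F: "symp F" "irreflp F" using rooted_F by (auto simp: rooted_def)
  have fR: "finite R" using R fin by (meson finite_Diff finite_subset)
  have cW: "card W = num_verts H - 1" using fin uv_verts by (simp add: num_verts_def)
  have "card R \<le> card W" using R fin by (intro card_mono) auto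
  moreover have "0 < num_verts H" using fin uv_verts by (auto simp: num_verts_def card_gt_0_iff)
  ultimately show "num_components H < num_verts H" using cW R by simp
  have cR: "card (cols q F R) \<le> q ^ card R"
    using card_cols_Un_le[OF F _ fR, of "{}" q] by (simp add: cols_def)
  have "card (cols q F W) \<le> (q - 1) ^ card (W - R) * card (cols q F R)"
    using fin R by (intro card_cols_grow_le[OF F, of W R R]) auto
  also have "\<dots> \<le> (q - 1) ^ card (W - R) * q ^ card R" using cR by simp
  also have "card (W - R) = num_verts H - 1 - num_components H"
    using R fR by (simp only: card_Diff_subset cW)
  finally show "card (cols q D (verts H)) \<le> q ^ num_components H * (q - 1) ^ (num_verts H - 1 - num_components H)"
    using card_cols_delete_edge_le R by (simp add: mult.commute)
qed

text \<open>Different colours for the two halves of the root would be colours for \<open>u\<close>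
  and \<open>v\<close> in a q-colouring of \<open>H\<close>.\<close>

lemma blocked_F: "blocked q F u {y. D u y} {y. D v y} W"
proof (rule ccontr)
  assume "\<not> ?thesis"
  then obtain c i j where c: "c \<in> cols q F (W - {u})" and ij: "i < q" "j < q" "i \<noteq> j"
    and i: "i \<notin> c ` ({y. D u y} \<inter> (W - {u}))" and j: "j \<notin> c ` ({y. D v y} \<inter> (W - {u}))"
    by (rule blockedE)
  define d where "d = c(u := i, v := j)"
  have d: "d u = i" "d v = j" "\<And>x. x \<noteq> u \<Longrightarrow> x \<noteq> v \<Longrightarrow> d x = c x" using uv_verts by (auto simp: d_def)
  have du: "d x \<noteq> i" if "D u x" for x
  proof (cases "x = v")
    case False
    have "x \<noteq> u" "x \<in> verts H" using that simple_edge[OF simple, of u x] by auto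
    then have "x \<in> {y. D u y} \<inter> (W - {u})" using that False by blast
    then show ?thesis using i d(3)[OF \<open>x \<noteq> u\<close> False] by (metis imageI)
  qed (use d ij in auto)
  have dv: "d x \<noteq> j" if "D v x" for x
  proof (cases "x = u")
    case False
    have "x \<noteq> v" "x \<in> verts H" using that simple_edge[OF simple, of v x] by auto
    then have "x \<in> {y. D v y} \<inter> (W - {u})" using that False by blast
    then show ?thesis using j d(3)[OF False \<open>x \<noteq> v\<close>] by (metis imageI)
  qed (use d ij in auto)
  have "proper_colouring H q d" unfolding proper_colouring_def
  proof (intro conjI ballI allI impI)
    fix x assume "x \<in> verts H"
    then show "d x < q" using d ij cols_less[OF c, of x] by (cases "x = u"; cases "x = v") auto
  next
    fix x y assume xy: "{x, y} \<in> edges H"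
    note s = simple_edge[OF simple xy]
    show "d x \<noteq> d y"
    proof (cases "{x, y} = {u, v}")
      case True
      then show ?thesis using d ij by (auto simp: doubleton_eq_iff)
    next
      case False
      then have D: "D x y" "D y x" using xy by (auto simp: insert_commute)
      consider "x = u" | "x = v" | "y = u" | "y = v" | "x \<notin> {u, v}" "y \<notin> {u, v}" by blast
      then show ?thesis
      proof cases
        case 1 then show ?thesis using du D d by metis
      next
        case 2 then show ?thesis using dv D d by metis
      next
        case 3 then show ?thesis using du D d by metis
      next
        case 4 then show ?thesis using dv D d by metis
      next
        case 5
        have "F x y" using D by (simp add: merge_adj_def)
        then have "c x \<noteq> c y" using 5 s by (intro cols_proper[OF c]) auto
        then show ?thesis using 5 d by auto
      qed
    qed
  qed
  then show False using uncolourable by blast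
qed

text \<open>The count starts from a minimal core containing \<open>u\<close>. Each representative
  outside it costs q instead of q - 1, and there are at most k - 1 of those.\<close>

lemma tomescu_bound:
  assumes q: "q \<ge> 4"
  shows "real (card (cols q D (verts H)))
    \<le> tomescu q (num_verts H - 1) * (real q / (real q - 1)) ^ (num_components H - 1)"
proof (cases "cols q F W = {}")
  case True
  have "0 \<le> tomescu q (num_verts H - 1)" using q by (intro less_imp_le tomescu_pos) auto
  moreover have "0 \<le> (real q / (real q - 1)) ^ (num_components H - 1)" using q by simp
  ultimately show ?thesis using card_cols_delete_edge_le True by simp
next
  case False
  then obtain c0 where c0: "c0 \<in> cols q F W" by auto
  obtain R where R: "R \<subseteq> W" "card R = num_components H" "u \<in> R"
    "\<And>X. R \<subseteq> X \<Longrightarrow> X \<subset> W \<Longrightarrow> \<exists>x\<in>X. \<exists>y\<in>W - X. F x y"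
    by (rule ex_growing_roots) blast
  have F: "symp F" "irreflp F" using rooted_F by (auto simp: rooted_def)
  have fR: "finite R" using R fin by (meson finite_Diff finite_subset)
  have cW: "card W = num_verts H - 1" using fin uv_verts by (simp add: num_verts_def)
  obtain C where C: "C \<subseteq> W" "minimal_blocked q F u {y. D u y} {y. D v y} C"
    using ex_minimal_blocked[OF _ _ blocked_F] fin uv_verts by blast
  have uC: "u \<in> C" by (rule minimal_blockedD(1)[OF C(2)])
  have fC: "finite C" using C fin by (meson finite_Diff finite_subset)
  have "restrict c0 C \<in> cols q F C" using c0 C by (intro cols_restrict)
  then have "conn F u C" by (rule minimal_blocked_conn[OF rooted_F C(2)])
  then have "admissible q F u {y. D u y} {y. D v y} C"
    using rooted_F fC uC minimal_blockedD(2)[OF C(2)] by (simp add: admissible_def)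
  then have core: "real (card (cols q F C)) \<le> tomescu q (card C)" by (rule card_cols_le_tomescu[OF q])
  define r where "r = card (R - C)"
  define m where "m = card (W - (C \<union> R))"
  have "card (cols q F W) \<le> (q - 1) ^ m * card (cols q F (C \<union> R))"
    unfolding m_def using fin R C by (intro card_cols_grow_le[OF F, of W R]) auto
  also have "card (cols q F (C \<union> R)) \<le> q ^ r * card (cols q F C)"
    unfolding r_def by (rule card_cols_Un_le[OF F fC fR])
  finally have "card (cols q F W) \<le> (q - 1) ^ m * (q ^ r * card (cols q F C))" by simp
  then have "real (card (cols q F W)) \<le> real ((q - 1) ^ m * (q ^ r * card (cols q F C)))"
    by (simp only: of_nat_le_iff)
  also have "\<dots> = (real q - 1) ^ m * (real q ^ r * real (card (cols q F C)))"
    using q by (simp add: of_nat_diff)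
  also have "\<dots> \<le> (real q - 1) ^ m * (real q ^ r * tomescu q (card C))"
    using core q by (intro mult_left_mono) auto
  also have "\<dots> = tomescu q (m + r + card C) * (real q / (real q - 1)) ^ r"
    using q by (simp add: tomescu_def power_add power_divide)
  also have "m + r + card C = num_verts H - 1"
  proof -
    have "card (C \<union> R) = card C + card (R - C)" using fC fR by (simp add: card_Un_disjoint[symmetric])
    moreover have "card (W - (C \<union> R)) = card W - card (C \<union> R)"
      using C R fC fR by (intro card_Diff_subset) auto
    moreover have "card (C \<union> R) \<le> card W" using C R fin by (intro card_mono) auto
    ultimately show ?thesis using cW by (simp add: m_def r_def)
  qed
  also have "(real q / (real q - 1)) ^ r \<le> (real q / (real q - 1)) ^ (num_components H - 1)"
  proof (rule power_increasing)
    have "R - C \<subseteq> R - {u}" using uC by auto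
    then have "r \<le> card (R - {u})" unfolding r_def using fR by (intro card_mono) auto
    then show "r \<le> num_components H - 1" using R fR by simp
  qed (use q in auto)
  finally have "real (card (cols q F W)) \<le> tomescu q (num_verts H - 1) * (real q / (real q - 1)) ^ (num_components H - 1)"
    using q tomescu_pos[of q "num_verts H - 1"] by (simp add: mult_left_mono)
  then show ?thesis using card_cols_delete_edge_le by linarith
qed

text \<open>The exponent may be negative, hence \<open>powi\<close>. The factor q^k is split off
  because it cancels against the normalization of the density.\<close>

lemma edge_bound:
  assumes q: "q \<noteq> 3" "q \<ge> 1"
  shows "real (card (cols q D (verts H))) \<le> real q ^ num_components H *
     (fact (q - 1) * (real q - 1) powi (int (num_verts H) - int q - int (num_components H)))"
proof -
  have k: "num_components H < num_verts H" by (rule trivial_bound(2))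
  have k0: "0 < num_components H"
  proof -
    obtain R where R: "R \<subseteq> W" "card R = num_components H" "u \<in> R"
      by (rule ex_growing_roots) blast
    have "finite R" using R fin by (meson finite_Diff finite_subset)
    then show ?thesis using R by (metis card_gt_0_iff empty_iff)
  qed
  show ?thesis
  proof (cases "q \<ge> 4")
    case True
    define x where "x = real q - 1"
    have x: "x \<noteq> 0" using True by (simp add: x_def)
    have "int (num_verts H) - int q - int (num_components H)
        = int (num_verts H - 1) + (- int q + (- int (num_components H - 1)))"
      using k k0 by (simp add: of_nat_diff)
    then have "x powi (int (num_verts H) - int q - int (num_components H))
        = x ^ (num_verts H - 1) * (inverse (x ^ q) * inverse (x ^ (num_components H - 1)))"
      by (simp only: power_int_add[OF disjI1[OF x]] power_int_minus power_int_of_nat)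
    moreover have "tomescu q (num_verts H - 1) * (real q / (real q - 1)) ^ (num_components H - 1)
        = (fact q * real q ^ (num_components H - 1)) * (x ^ (num_verts H - 1) * (inverse (x ^ q) * inverse (x ^ (num_components H - 1))))"
      by (simp add: tomescu_def x_def divide_inverse power_mult_distrib power_inverse)
    moreover have "fact q * real q ^ (num_components H - 1) = real q ^ num_components H * fact (q - 1)"
    proof -
      obtain k' where k': "num_components H = Suc k'" using k0 by (cases "num_components H") auto
      show ?thesis using True by (simp add: k' fact_reduce[of q] mult_ac)
    qed
    ultimately have "tomescu q (num_verts H - 1) * (real q / (real q - 1)) ^ (num_components H - 1)
        = real q ^ num_components H * fact (q - 1) * x powi (int (num_verts H) - int q - int (num_components H))"
      by (simp only:)
    then show ?thesis using tomescu_bound[OF True] by (simp only: x_def mult.assoc)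
  next
    case False
    then consider "q = 1" | "q = 2" using q by linarith
    then show ?thesis
    proof cases
      case 1
      \<comment> \<open>The base is 0 here, so it matters that the exponent is a natural number: the
        bound vanishes unless the exponent is 0.\<close>
      have "int (num_verts H) - int q - int (num_components H) = int (num_verts H - 1 - num_components H)"
        using k 1 by simp
      moreover have "real (card (cols q D (verts H))) \<le> real (0 ^ (num_verts H - 1 - num_components H))"
        using trivial_bound(1) 1 by (simp only: of_nat_le_iff) simp
      ultimately show ?thesis using 1 by (simp only: power_int_of_nat) simp
    next
      case 2
      have "real (card (cols q D (verts H))) \<le> real (2 ^ num_components H)"
        using trivial_bound(1) 2 by (simp only: of_nat_le_iff) simp
      then show ?thesis using 2 by simp
    qed
  qed
qed

lemma edge_bound_3:
  assumes q: "q = 3"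
  shows "real (card (cols q D (verts H))) \<le> real q ^ num_components H *
     2 powi (int (num_verts H) - int (num_components H) - 1)"
proof -
  have "int (num_verts H) - int (num_components H) - 1 = int (num_verts H - 1 - num_components H)"
    using trivial_bound(2) by simp
  moreover have "real (card (cols q D (verts H))) \<le> real (3 ^ num_components H * 2 ^ (num_verts H - 1 - num_components H))"
    using trivial_bound(1) q by (simp only: of_nat_le_iff) simp
  ultimately show ?thesis using q by (simp only: power_int_of_nat) simp
qed

end

section \<open>Maps with monochromatic edges\<close>

definition mono_edges :: "'a set set \<Rightarrow> ('a \<Rightarrow> nat) \<Rightarrow> 'a set set" where
  "mono_edges X c = {e\<in>X. card (c ` e) = 1}"

lemma card_image_doubleton: "card (c ` {x, y}) = 1 \<longleftrightarrow> c x = c y"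
  by (cases "c x = c y") auto

lemma determined_card_le:
  assumes V: "finite V" and W: "W \<subseteq> V"
    and det: "\<And>t t'. t \<in> S \<Longrightarrow> t' \<in> S \<Longrightarrow> (\<And>x. x \<in> W \<Longrightarrow> t x = t' x) \<Longrightarrow> (\<And>x. x \<in> V \<Longrightarrow> t x = t' x)"
    and S: "S \<subseteq> V \<rightarrow>\<^sub>E {..<L}"
  shows "card S \<le> L ^ card W"
proof -
  have "card S \<le> card (W \<rightarrow>\<^sub>E {..<L})"
  proof (rule card_inj_on_le)
    show "inj_on (\<lambda>t. restrict t W) S"
    proof (rule inj_onI)
      fix t t' assume t: "t \<in> S" "t' \<in> S" and eq: "restrict t W = restrict t' W"
      have "t x = t' x" if "x \<in> W" for x using fun_cong[OF eq, of x] that by simp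
      then have "t x = t' x" if "x \<in> V" for x using det[OF t] that by blast
      moreover have "t \<in> extensional V" "t' \<in> extensional V" using t S by (auto simp: PiE_def)
      ultimately show "t = t'" by (intro extensionalityI)
    qed
    show "(\<lambda>t. restrict t W) ` S \<subseteq> W \<rightarrow>\<^sub>E {..<L}" using S W by fastforce
    show "finite (W \<rightarrow>\<^sub>E {..<L})" using V W by (intro finite_PiE) (auto intro: finite_subset)
  qed
  also have "\<dots> = L ^ card W" using V W finite_subset by (subst card_funcsetE) auto
  finally show ?thesis .
qed

lemma card_one_mono_edge:
  assumes V: "finite V" and e: "e \<subseteq> V" "card e = 2" and L: "L > 0"
  shows "real (card {t \<in> V \<rightarrow>\<^sub>E {..<L}. card (t ` e) = 1}) = real L ^ card V / real L"
proof -
  obtain x y where xy: "e = {x, y}" "x \<noteq> y" using e by (auto simp: card_2_iff)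
  let ?S = "{t \<in> V \<rightarrow>\<^sub>E {..<L}. card (t ` e) = 1}"
  have S: "?S = {t \<in> V \<rightarrow>\<^sub>E {..<L}. t x = t y}" by (simp only: xy card_image_doubleton)
  have V': "card V = Suc (card (V - {y}))" using V e xy by (metis card.remove insert_subset)
  have le: "card ?S \<le> L ^ card (V - {y})"
  proof (rule determined_card_le[OF V])
    fix t t' z assume t: "t \<in> ?S" "t' \<in> ?S" and eq: "\<And>z. z \<in> V - {y} \<Longrightarrow> t z = t' z" and z: "z \<in> V"
    have "t x = t y" "t' x = t' y" using t unfolding S by blast+
    then show "t z = t' z" using eq[of z] eq[of x] z e xy by (cases "z = y") auto
  qed auto
  have "card ((V - {y}) \<rightarrow>\<^sub>E {..<L}) \<le> card ?S"
  proof (rule card_inj_on_le)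
    show "inj_on (\<lambda>t. t(y := t x)) ((V - {y}) \<rightarrow>\<^sub>E {..<L})"
    proof (rule inj_onI)
      fix t t' assume t: "t \<in> (V - {y}) \<rightarrow>\<^sub>E {..<L}" "t' \<in> (V - {y}) \<rightarrow>\<^sub>E {..<L}"
        and eq: "t(y := t x) = t'(y := t' x)"
      have "t z = t' z" if "z \<in> V - {y}" for z using fun_cong[OF eq, of z] that by simp
      then show "t = t'" using t by (intro PiE_ext) auto
    qed
    show "(\<lambda>t. t(y := t x)) ` ((V - {y}) \<rightarrow>\<^sub>E {..<L}) \<subseteq> ?S"
    proof (rule image_subsetI)
      fix t assume t: "t \<in> (V - {y}) \<rightarrow>\<^sub>E {..<L}"
      have "t x \<in> {..<L}" using t e xy by (intro PiE_mem[OF t]) auto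
      then have "t(y := t x) \<in> insert y (V - {y}) \<rightarrow>\<^sub>E {..<L}" using t by (intro PiE_fun_upd)
      moreover have "insert y (V - {y}) = V" using e xy by auto
      ultimately show "t(y := t x) \<in> ?S" using xy by (simp add: S)
    qed
    show "finite ?S" using V by (intro finite_subset[OF _ finite_PiE[of V "\<lambda>_. {..<L}"]]) auto
  qed
  then have "L ^ card (V - {y}) \<le> card ?S" using V by (simp add: card_funcsetE)
  with le have "card ?S = L ^ card (V - {y})" by simp
  then have "real (card ?S) = real L ^ card (V - {y})" by simp
  then show ?thesis using L V' by simp
qed

text \<open>Choose \<open>d\<close> in \<open>f\<close> outside \<open>e\<close>: the values at
  \<open>d\<close> and at one end of \<open>e\<close> are determined by all the others, so two
  coordinates are lost even if the edges meet.\<close>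

lemma card_two_mono_edges:
  assumes V: "finite V" and e: "e \<subseteq> V" "card e = 2" and f: "f \<subseteq> V" "card f = 2" and ef: "e \<noteq> f" and L: "L > 0"
  shows "real (card {t \<in> V \<rightarrow>\<^sub>E {..<L}. card (t ` e) = 1 \<and> card (t ` f) = 1}) \<le> real L ^ card V / (real L)\<^sup>2"
proof -
  have "\<not> f \<subseteq> e" using ef e f card_subset_eq[of e f] by (metis card.infinite zero_neq_numeral)
  then obtain d where d: "d \<in> f" "d \<notin> e" by auto
  obtain c where c: "f = {c, d}" "c \<noteq> d" using f d by (auto simp: card_2_iff)
  obtain a b where ab: "e = {a, b}" "a \<noteq> b" using e by (auto simp: card_2_iff)
  let ?S = "{t \<in> V \<rightarrow>\<^sub>E {..<L}. card (t ` e) = 1 \<and> card (t ` f) = 1}"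
  have "card ?S \<le> L ^ card (V - {b, d})"
  proof (rule determined_card_le[OF V])
    fix t t' z assume t: "t \<in> ?S" "t' \<in> ?S" and eq: "\<And>z. z \<in> V - {b, d} \<Longrightarrow> t z = t' z" and z: "z \<in> V"
    have t': "t a = t b" "t' a = t' b" "t c = t d" "t' c = t' d"
      using t card_image_doubleton[of t] card_image_doubleton[of t'] by (simp_all only: ab c mem_Collect_eq)
    have "a \<in> V - {b, d}" using ab e d by auto
    then have b: "t b = t' b" using eq[of a] t' by simp
    have "t c = t' c" using b eq[of c] c f by (cases "c = b") auto
    then have "t d = t' d" using t' by simp
    then show "t z = t' z" using b eq[of z] z by (cases "z = b"; cases "z = d") auto
  qed auto
  also have "card V = Suc (Suc (card (V - {b, d})))"
  proof -
    have "b \<in> V" "d \<in> V" "b \<noteq> d" using ab c e f d by auto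
    moreover from this have "card {b, d} \<le> card V" using V by (intro card_mono) auto
    ultimately show ?thesis using V by (simp add: card_Diff_subset)
  qed
  then have "real L ^ card V / (real L)\<^sup>2 = real (L ^ card (V - {b, d}))"
    using L by (simp add: power2_eq_square)
  then show ?thesis using calculation by (simp only: of_nat_le_iff)
qed

text \<open>A second moment bound: for the number X of monochromatic edges, the indicator of X = 0
  is at most 1 - X + X (X - 1), since (X - 1)^2 \<ge> 0.\<close>

lemma card_proper_maps_le:
  assumes V: "finite V" and X: "finite X" "\<And>e. e \<in> X \<Longrightarrow> e \<subseteq> V \<and> card e = 2" and L: "L > 0"
  shows "real (card {t \<in> V \<rightarrow>\<^sub>E {..<L}. mono_edges X t = {}})
    \<le> real L ^ card V * (1 - real (card X) / real L + (real (card X) / real L)\<^sup>2)"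
proof -
  let ?M = "V \<rightarrow>\<^sub>E {..<L}"
  have fM: "finite ?M" using V by (intro finite_PiE) auto
  define I where "I e t = (if card (t ` e) = 1 then 1 else 0 :: real)" for e and t :: "'a \<Rightarrow> nat"
  define P where "P = X \<times> X - Id_on X"
  have cm: "real (card (mono_edges X t)) = (\<Sum>e\<in>X. I e t)" for t
    using X by (simp add: mono_edges_def I_def sum.If_cases Int_def)
  have cP: "real (card (mono_edges X t)) * (real (card (mono_edges X t)) - 1) = (\<Sum>(e, f)\<in>P. I e t * I f t)" for t
  proof -
    have "(\<Sum>(e, f)\<in>X \<times> X. I e t * I f t) = (\<Sum>e\<in>X. I e t) * (\<Sum>e\<in>X. I e t)"
      by (simp add: sum_product sum.cartesian_product)
    moreover have "(\<Sum>(e, f)\<in>X \<times> X. I e t * I f t) = (\<Sum>(e, f)\<in>P. I e t * I f t) + (\<Sum>(e, f)\<in>Id_on X. I e t * I f t)"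
      unfolding P_def using X by (subst sum.subset_diff[of "Id_on X"]) (auto simp: Id_on_def)
    moreover have "(\<Sum>(e, f)\<in>Id_on X. I e t * I f t) = (\<Sum>e\<in>X. I e t * I e t)"
    proof -
      have "Id_on X = (\<lambda>e. (e, e)) ` X" by auto
      then show ?thesis by (simp add: sum.reindex inj_on_def)
    qed
    moreover have "I e t * I e t = I e t" for e by (simp add: I_def)
    ultimately show ?thesis by (simp add: cm algebra_simps)
  qed
  have "real (card {t \<in> ?M. mono_edges X t = {}}) = (\<Sum>t\<in>?M. if mono_edges X t = {} then 1 else 0)"
    using fM by (simp add: sum.If_cases Int_def)
  also have "\<dots> \<le> (\<Sum>t\<in>?M. 1 - real (card (mono_edges X t))
      + real (card (mono_edges X t)) * (real (card (mono_edges X t)) - 1))"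
  proof (rule sum_mono)
    fix t :: "'a \<Rightarrow> nat"
    have "finite (mono_edges X t)" using X by (simp add: mono_edges_def)
    then have "mono_edges X t = {} \<longleftrightarrow> card (mono_edges X t) = 0" by simp
    moreover have "0 \<le> (real (card (mono_edges X t)) - 1) * (real (card (mono_edges X t)) - 1)" by simp
    ultimately show "(if mono_edges X t = {} then 1 else 0) \<le> 1 - real (card (mono_edges X t))
      + real (card (mono_edges X t)) * (real (card (mono_edges X t)) - 1)"
      by (simp add: algebra_simps)
  qed
  also have "\<dots> = real (card ?M) - (\<Sum>e\<in>X. \<Sum>t\<in>?M. I e t) + (\<Sum>(e, f)\<in>P. \<Sum>t\<in>?M. I e t * I f t)"
    by (simp add: sum.distrib sum_subtractf cP case_prod_unfold) (simp add: cm sum.swap[of _ ?M])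
  also have "(\<Sum>e\<in>X. \<Sum>t\<in>?M. I e t) = real (card X) * (real L ^ card V / real L)"
  proof -
    have "(\<Sum>t\<in>?M. I e t) = real L ^ card V / real L" if "e \<in> X" for e
    proof -
      have "(\<Sum>t\<in>?M. I e t) = real (card {t \<in> ?M. card (t ` e) = 1})"
        using fM by (simp add: I_def sum.If_cases Int_def)
      then show ?thesis using card_one_mono_edge[OF V _ _ L, of e] X(2)[OF that] by simp
    qed
    then show ?thesis by simp
  qed
  also have "(\<Sum>(e, f)\<in>P. \<Sum>t\<in>?M. I e t * I f t) \<le> (\<Sum>(e, f)\<in>P. real L ^ card V / (real L)\<^sup>2)"
  proof (rule sum_mono, clarify)
    fix e f assume "(e, f) \<in> P"
    then have ef: "e \<in> X" "f \<in> X" "e \<noteq> f" by (auto simp: P_def)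
    have "(\<Sum>t\<in>?M. I e t * I f t) = (\<Sum>t\<in>?M. if card (t ` e) = 1 \<and> card (t ` f) = 1 then 1 else 0)"
      by (intro sum.cong) (auto simp: I_def)
    also have "\<dots> = real (card {t \<in> ?M. card (t ` e) = 1 \<and> card (t ` f) = 1})"
      using fM by (simp add: sum.If_cases Int_def)
    also have "\<dots> \<le> real L ^ card V / (real L)\<^sup>2"
      using ef X(2)[of e] X(2)[of f] L V by (intro card_two_mono_edges) auto
    finally show "(\<Sum>t\<in>?M. I e t * I f t) \<le> real L ^ card V / (real L)\<^sup>2" .
  qed
  also have "(\<Sum>(e, f)\<in>P. real L ^ card V / (real L)\<^sup>2) = real (card P) * (real L ^ card V / (real L)\<^sup>2)"
    by simp
  also have "\<dots> \<le> (real (card X))\<^sup>2 * (real L ^ card V / (real L)\<^sup>2)"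
  proof (rule mult_right_mono)
    have "card P \<le> card (X \<times> X)" unfolding P_def using X by (intro card_mono) auto
    then have "real (card P) \<le> real (card X * card X)" by (simp only: of_nat_le_iff card_cartesian_product)
    then show "real (card P) \<le> (real (card X))\<^sup>2" by (simp add: power2_eq_square)
  qed simp
  finally show ?thesis using V by (simp add: card_funcsetE algebra_simps power_divide)
qed

section \<open>The host graphs\<close>

lemma finite_edges: "simple_graph H \<Longrightarrow> finite (edges H)"
  by (rule finite_subset[of _ "Pow (verts H)"]) (auto simp: simple_graph_def)

lemma chromatic_number_le: "proper_colouring H k c \<Longrightarrow> chromatic_number H \<le> k"
  unfolding chromatic_number_def by (rule Least_le) blast

lemma ex_proper_colouring:
  assumes "simple_graph H"
  shows "\<exists>c. proper_colouring H (chromatic_number H) c"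
proof -
  have "finite (verts H)" using assms by (simp add: simple_graph_def)
  then obtain f where f: "bij_betw f (verts H) {0..<card (verts H)}"
    using ex_bij_betw_finite_nat by blast
  have "proper_colouring H (card (verts H)) f"
    unfolding proper_colouring_def
  proof (intro conjI ballI allI impI)
    show "f x < card (verts H)" if "x \<in> verts H" for x
      using f that by (auto simp: bij_betw_def)
    show "f x \<noteq> f y" if "{x, y} \<in> edges H" for x y
      using f simple_edge[OF assms that] by (auto simp: bij_betw_def inj_on_def)
  qed
  then show ?thesis unfolding chromatic_number_def
    using LeastI[of "\<lambda>k. \<exists>c. proper_colouring H k c"] by blast
qed

text \<open>A map whose only monochromatic edge is e colours H - e properly with q colours, so e is
  critical and the map is among those counted by \<open>b\<close> for e.\<close>

lemma card_one_mono_maps_le: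
  assumes H: "simple_graph H" and q: "chromatic_number H = Suc q"
    and b: "\<And>u v. uncolourable_edge H u v q \<Longrightarrow>
      real (card (cols q (adj (edges H - {{u, v}})) (verts H))) \<le> b"
  shows "real (card {p \<in> verts H \<rightarrow>\<^sub>E {..<q}. card (mono_edges (edges H) p) = 1}) \<le> real (crit H) * b"
proof -
  let ?C = "{e. critical_edge H e}" and ?F = "\<lambda>e. cols q (adj (edges H - {e})) (verts H)"
  have fV: "finite (verts H)" using H by (simp add: simple_graph_def)
  have fC: "finite ?C"
    using finite_edges[OF H] by (rule finite_subset[rotated]) (auto simp: critical_edge_def)
  have nc: "\<not> proper_colouring H q c" for c using chromatic_number_le[of H q c] q by auto
  have "{p \<in> verts H \<rightarrow>\<^sub>E {..<q}. card (mono_edges (edges H) p) = 1} \<subseteq> (\<Union>e\<in>?C. ?F e)"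
  proof
    fix p assume "p \<in> {p \<in> verts H \<rightarrow>\<^sub>E {..<q}. card (mono_edges (edges H) p) = 1}"
    then have p: "p \<in> verts H \<rightarrow>\<^sub>E {..<q}" and "card (mono_edges (edges H) p) = 1" by auto
    then obtain e where e: "mono_edges (edges H) p = {e}" by (auto simp: card_1_singleton_iff)
    have proper: "p x \<noteq> p y" if "{x, y} \<in> edges H - {e}" for x y
    proof
      assume "p x = p y"
      then have "card (p ` {x, y}) = 1" by (simp only: card_image_doubleton)
      then have "{x, y} \<in> mono_edges (edges H) p" using that by (auto simp: mono_edges_def)
      then show False using e that by auto
    qed
    have pq: "p x < q" if "x \<in> verts H" for x using p that by auto
    have "p \<in> ?F e" using p proper by (auto simp: cols_def)
    moreover have "proper_colouring (delete_edge H e) q p"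
      using proper pq by (auto simp: proper_colouring_def delete_edge_def)
    then have "chromatic_number (delete_edge H e) < chromatic_number H"
      using chromatic_number_le[of "delete_edge H e" q p] q by simp
    then have "critical_edge H e" using e by (auto simp: critical_edge_def mono_edges_def)
    ultimately show "p \<in> (\<Union>e\<in>?C. ?F e)" by blast
  qed
  then have "card {p \<in> verts H \<rightarrow>\<^sub>E {..<q}. card (mono_edges (edges H) p) = 1} \<le> card (\<Union>e\<in>?C. ?F e)"
    using fC fV by (intro card_mono) auto
  also have "\<dots> \<le> (\<Sum>e\<in>?C. card (?F e))" using fC by (rule card_UN_le)
  finally have "real (card {p \<in> verts H \<rightarrow>\<^sub>E {..<q}. card (mono_edges (edges H) p) = 1})
      \<le> real (\<Sum>e\<in>?C. card (?F e))" by (simp only: of_nat_le_iff)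
  also have "\<dots> = (\<Sum>e\<in>?C. real (card (?F e)))" by simp
  also have "\<dots> \<le> (\<Sum>e\<in>?C. b)"
  proof (rule sum_mono)
    fix e assume "e \<in> ?C"
    then have "e \<in> edges H" by (simp add: critical_edge_def)
    then obtain u v where uv: "e = {u, v}" using H by (auto simp: simple_graph_def card_2_iff)
    have "uncolourable_edge H u v q" using H \<open>e \<in> edges H\<close> nc by unfold_locales (auto simp: uv)
    then show "real (card (?F e)) \<le> b" unfolding uv by (rule b)
  qed
  finally show ?thesis by (simp add: crit_def)
qed

text \<open>Here \<open>p\<close> gives the parts and \<open>t\<close> the types. A single edge
  inside a part costs 1/L, two or more cost at most 1/L^2, and \<open>ne\<close> guarantees at least
  one.\<close>

lemma card_refining_maps_le:
  assumes V: "finite V" and X: "finite X" "\<And>e. e \<in> X \<Longrightarrow> e \<subseteq> V \<and> card e = 2" and L: "L > 0"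
    and ne: "\<And>p. p \<in> V \<rightarrow>\<^sub>E {..<q} \<Longrightarrow> mono_edges X p \<noteq> {}"
  shows "real (card (SIGMA p:V \<rightarrow>\<^sub>E {..<q}. {t \<in> V \<rightarrow>\<^sub>E {..<L}. mono_edges X p \<subseteq> mono_edges X t}))
     \<le> real L ^ card V * (real (card {p \<in> V \<rightarrow>\<^sub>E {..<q}. card (mono_edges X p) = 1}) / real L
         + real q ^ card V / (real L)\<^sup>2)"
proof -
  let ?P = "V \<rightarrow>\<^sub>E {..<q}" and ?M = "V \<rightarrow>\<^sub>E {..<L}"
  define K where "K = real L ^ card V"
  have fin: "finite ?P" "finite ?M" using V by (auto intro: finite_PiE)
  have "real (card (SIGMA p:?P. {t \<in> ?M. mono_edges X p \<subseteq> mono_edges X t}))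
      = (\<Sum>p\<in>?P. real (card {t \<in> ?M. mono_edges X p \<subseteq> mono_edges X t}))"
    using fin by (simp add: card_SigmaI)
  also have "\<dots> \<le> (\<Sum>p\<in>?P. (if card (mono_edges X p) = 1 then K / real L else 0) + K / (real L)\<^sup>2)"
  proof (rule sum_mono)
    fix p assume p: "p \<in> ?P"
    have sub: "mono_edges X p \<subseteq> X" by (auto simp: mono_edges_def)
    have K0: "0 \<le> K / real L" "0 \<le> K / (real L)\<^sup>2" by (simp_all add: K_def)
    obtain e where e: "e \<in> mono_edges X p" using ne[OF p] by auto
    then have eX: "e \<subseteq> V" "card e = 2" using X sub by auto
    show "real (card {t \<in> ?M. mono_edges X p \<subseteq> mono_edges X t})
        \<le> (if card (mono_edges X p) = 1 then K / real L else 0) + K / (real L)\<^sup>2"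
    proof (cases "card (mono_edges X p) = 1")
      case True
      have "{t \<in> ?M. mono_edges X p \<subseteq> mono_edges X t} \<subseteq> {t \<in> ?M. card (t ` e) = 1}"
        using e by (auto simp: mono_edges_def)
      then have "card {t \<in> ?M. mono_edges X p \<subseteq> mono_edges X t} \<le> card {t \<in> ?M. card (t ` e) = 1}"
        using fin by (intro card_mono) auto
      then have "real (card {t \<in> ?M. mono_edges X p \<subseteq> mono_edges X t}) \<le> K / real L"
        using card_one_mono_edge[OF V eX L] by (simp add: K_def)
      then show ?thesis using True K0 by simp
    next
      case False
      have "\<not> mono_edges X p \<subseteq> {e}" using False e by (metis card_1_singleton_iff One_nat_def empty_iff subset_singletonD)
      then obtain f where f: "f \<in> mono_edges X p" "f \<noteq> e" by auto
      then have fX: "f \<subseteq> V" "card f = 2" using X sub by auto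
      have "{t \<in> ?M. mono_edges X p \<subseteq> mono_edges X t} \<subseteq> {t \<in> ?M. card (t ` e) = 1 \<and> card (t ` f) = 1}"
        using e f by (auto simp: mono_edges_def)
      then have "card {t \<in> ?M. mono_edges X p \<subseteq> mono_edges X t} \<le> card {t \<in> ?M. card (t ` e) = 1 \<and> card (t ` f) = 1}"
        using fin by (intro card_mono) auto
      then show ?thesis
        using card_two_mono_edges[OF V eX fX _ L] f False by (simp add: K_def)
    qed
  qed
  also have "\<dots> = real (card {p \<in> ?P. card (mono_edges X p) = 1}) * (K / real L) + real (card ?P) * (K / (real L)\<^sup>2)"
    using fin by (simp add: sum.distrib sum.If_cases Int_def)
  also have "\<dots> = K * (real (card {p \<in> ?P. card (mono_edges X p) = 1}) / real L + real q ^ card V / (real L)\<^sup>2)"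
    using V by (simp add: card_funcsetE algebra_simps)
  finally show ?thesis by (simp add: K_def)
qed

text \<open>Part \<open>x mod q\<close>, type \<open>x div q mod L\<close>: a balanced blow-up of \<open>q\<close> disjoint copies of the
  complete graph on \<open>L\<close> vertices.\<close>

definition host :: "nat \<Rightarrow> nat \<Rightarrow> nat \<Rightarrow> nat ugraph" where
  "host q L N = \<lparr>verts = {..<q * L * N},
     edges = {e. \<exists>x y. e = {x, y} \<and> x < q * L * N \<and> y < q * L * N \<and>
       x mod q = y mod q \<and> x div q mod L \<noteq> y div q mod L}\<rparr>"

lemma simple_host: "simple_graph (host q L N)"
  by (auto simp: simple_graph_def host_def card_insert_if)

lemma host_edgeD:
  assumes "{x, y} \<in> edges (host q L N)"
  shows "x mod q = y mod q" "x div q mod L \<noteq> y div q mod L"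
  using assms by (auto simp: host_def doubleton_eq_iff)

lemma complement_host_edgeD:
  assumes "{x, y} \<in> edges (complement (host q L N))" "x mod q = y mod q"
  shows "x div q mod L = y div q mod L"
  using assms by (auto simp: complement_def host_def)

text \<open>Part, type and copy determine a vertex. \<open>S\<close> restricts the first two, and
  the free choice of the copy cancels against the blow-up size N.\<close>

lemma hom_density_host_le:
  assumes V: "finite (verts H)" and pos: "q > 0" "L > 0" "N > 0" and S: "finite S"
    and G: "verts G = {..<q * L * N}"
    and sub: "\<And>f. f \<in> verts H \<rightarrow>\<^sub>E {..<q * L * N} \<Longrightarrow> \<forall>e\<in>edges H. f ` e \<in> edges G \<Longrightarrow>
      (restrict (\<lambda>x. f x mod q) (verts H), restrict (\<lambda>x. f x div q mod L) (verts H)) \<in> S"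
  shows "hom_density H G \<le> real (card S) / (real q * real L) ^ card (verts H)"
proof -
  let ?V = "verts H"
  let ?A = "{f \<in> ?V \<rightarrow>\<^sub>E {..<q * L * N}. \<forall>e\<in>edges H. f ` e \<in> edges G}"
  let ?g = "\<lambda>f. ((restrict (\<lambda>x. f x mod q) ?V, restrict (\<lambda>x. f x div q mod L) ?V), restrict (\<lambda>x. f x div q div L) ?V)"
  have "card ?A \<le> card (S \<times> (?V \<rightarrow>\<^sub>E {..<N}))"
  proof (rule card_inj_on_le)
    show "inj_on ?g ?A"
    proof (rule inj_onI)
      fix f f' assume f: "f \<in> ?A" "f' \<in> ?A" and eq: "?g f = ?g f'"
      have "f x = f' x" if "x \<in> ?V" for x
      proof -
        have "restrict (\<lambda>x. f x mod q) ?V x = restrict (\<lambda>x. f' x mod q) ?V x"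
          "restrict (\<lambda>x. f x div q mod L) ?V x = restrict (\<lambda>x. f' x div q mod L) ?V x"
          "restrict (\<lambda>x. f x div q div L) ?V x = restrict (\<lambda>x. f' x div q div L) ?V x"
          using eq by simp_all
        then have "f x mod q = f' x mod q" "f x div q mod L = f' x div q mod L" "f x div q div L = f' x div q div L"
          using that by simp_all
        then show ?thesis by (metis div_mult_mod_eq)
      qed
      then show "f = f'" using f by (intro PiE_ext[of f ?V "\<lambda>_. {..<q * L * N}"]) auto
    qed
    show "?g ` ?A \<subseteq> S \<times> (?V \<rightarrow>\<^sub>E {..<N})"
    proof (rule image_subsetI)
      fix f assume f: "f \<in> ?A"
      have "f x div q div L < N" if "x \<in> ?V" for x
      proof -
        have "f x < q * L * N" using f that by auto
        then have "f x < N * (q * L)" by (simp add: mult.commute)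
        then show ?thesis by (simp add: div_mult2_eq[symmetric] less_mult_imp_div_less)
      qed
      then show "?g f \<in> S \<times> (?V \<rightarrow>\<^sub>E {..<N})" using sub[of f] f by auto
    qed
    show "finite (S \<times> (?V \<rightarrow>\<^sub>E {..<N}))" using S V by (auto intro: finite_PiE)
  qed
  also have "\<dots> = card S * N ^ card ?V" using V by (simp add: card_cartesian_product card_funcsetE)
  finally have "real (card ?A) \<le> real (card S * N ^ card ?V)" by (simp only: of_nat_le_iff)
  then have "hom_density H G \<le> real (card S * N ^ card ?V) / real ((q * L * N) ^ card ?V)"
    unfolding hom_density_def G using V by (simp only: card_funcsetE card_lessThan) (intro divide_right_mono, auto)
  also have "\<dots> = real (card S) / (real q * real L) ^ card ?V"
    using pos by (simp add: power_mult_distrib)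
  finally show ?thesis .
qed

text \<open>The part is constant on components, and these q^k choices cancel against the prefactor;
  the types must form a proper colouring with L colours.\<close>

lemma hom_density_host:
  assumes H: "simple_graph H" and pos: "q > 0" "L > 0" "N > 0"
  shows "real q ^ (num_verts H - num_components H) * hom_density H (host q L N)
    \<le> 1 - real (num_edges H) / real L + (real (num_edges H) / real L)\<^sup>2"
proof -
  let ?V = "verts H" and ?X = "edges H"
  have V: "finite ?V" using H by (simp add: simple_graph_def)
  have X: "finite ?X" "\<And>e. e \<in> ?X \<Longrightarrow> e \<subseteq> ?V \<and> card e = 2"
    using finite_edges[OF H] H by (auto simp: simple_graph_def)
  define P where "P = {p \<in> ?V \<rightarrow>\<^sub>E {..<q}. \<forall>x y. {x, y} \<in> ?X \<longrightarrow> p x = p y}"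
  define T where "T = {t \<in> ?V \<rightarrow>\<^sub>E {..<L}. mono_edges ?X t = {}}"
  have "finite (?V \<rightarrow>\<^sub>E {..<k})" for k :: nat using V by (intro finite_PiE) auto
  then have fin: "finite P" "finite T" unfolding P_def T_def by auto
  obtain R where R: "R \<subseteq> ?V" "card R = num_components H"
    "\<And>y. y \<in> ?V \<Longrightarrow> \<exists>r\<in>R. (r, y) \<in> (edge_rel H)\<^sup>*"
    using ex_representatives[OF H] by metis
  have "card P \<le> q ^ card R"
  proof (rule determined_card_le[OF V R(1)])
    fix p p' y assume p: "p \<in> P" "p' \<in> P" and eq: "\<And>x. x \<in> R \<Longrightarrow> p x = p' x" and y: "y \<in> ?V"
    have const: "p r = p y" if "(r, y) \<in> (edge_rel H)\<^sup>*" "p \<in> P" for p r y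
      using that by (induction rule: rtrancl_induct) (auto simp: P_def)
    obtain r where "r \<in> R" "(r, y) \<in> (edge_rel H)\<^sup>*" using R(3)[OF y] by blast
    then show "p y = p' y" using const[of r y p] const[of r y p'] p eq by simp
  qed (auto simp: P_def)
  then have cP: "real (card P) \<le> real q ^ num_components H"
    using R by (metis of_nat_le_iff of_nat_power)
  have cT: "real (card T) \<le> real L ^ card ?V * (1 - real (card ?X) / real L + (real (card ?X) / real L)\<^sup>2)"
    unfolding T_def by (rule card_proper_maps_le[OF V X pos(2)])
  have "hom_density H (host q L N) \<le> real (card (P \<times> T)) / (real q * real L) ^ card ?V"
  proof (rule hom_density_host_le[OF V pos])
    fix f assume f: "f \<in> ?V \<rightarrow>\<^sub>E {..<q * L * N}" and hom: "\<forall>e\<in>?X. f ` e \<in> edges (host q L N)"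
    have edge: "f x mod q = f y mod q" "f x div q mod L \<noteq> f y div q mod L" if "{x, y} \<in> ?X" for x y
      using hom that host_edgeD[of "f x" "f y" q L N] by auto
    have "restrict (\<lambda>x. f x mod q) ?V \<in> P"
      using edge(1) pos simple_edge[OF H] by (auto simp: P_def)
    moreover have "mono_edges ?X (restrict (\<lambda>x. f x div q mod L) ?V) = {}"
    proof (rule ccontr)
      assume "\<not> ?thesis"
      then obtain e where e: "e \<in> ?X" "card (restrict (\<lambda>x. f x div q mod L) ?V ` e) = 1"
        by (auto simp: mono_edges_def)
      obtain x y where xy: "e = {x, y}" using X(2)[OF e(1)] by (auto simp: card_2_iff)
      have "x \<in> ?V" "y \<in> ?V" using X(2)[OF e(1)] xy by auto
      moreover have "restrict (\<lambda>x. f x div q mod L) ?V x = restrict (\<lambda>x. f x div q mod L) ?V y"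
        using e(2) unfolding xy by (simp only: card_image_doubleton)
      ultimately show False using edge(2)[of x y] e xy by simp
    qed
    ultimately show "(restrict (\<lambda>x. f x mod q) ?V, restrict (\<lambda>x. f x div q mod L) ?V) \<in> P \<times> T"
      using pos by (auto simp: T_def)
  qed (use fin in \<open>auto simp: host_def\<close>)
  also have "\<dots> = real (card P) * real (card T) / (real q * real L) ^ card ?V"
    by (simp add: card_cartesian_product)
  also have "\<dots> \<le> real q ^ num_components H * (real L ^ card ?V * (1 - real (card ?X) / real L + (real (card ?X) / real L)\<^sup>2))
      / (real q * real L) ^ card ?V"
    using cP cT by (intro divide_right_mono mult_mono) auto
  finally have le: "hom_density H (host q L N)
      \<le> real q ^ num_components H / real q ^ card ?V * (1 - real (card ?X) / real L + (real (card ?X) / real L)\<^sup>2)"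
    using pos by (simp add: power_mult_distrib)
  have "num_components H \<le> card ?V" using R V by (metis card_mono)
  then have q1: "real q ^ (num_verts H - num_components H) * (real q ^ num_components H / real q ^ card ?V) = 1"
    using pos by (simp add: num_verts_def power_add[symmetric])
  have "real q ^ (num_verts H - num_components H) * hom_density H (host q L N)
      \<le> real q ^ (num_verts H - num_components H) * (real q ^ num_components H / real q ^ card ?V
          * (1 - real (card ?X) / real L + (real (card ?X) / real L)\<^sup>2))"
    using le by (intro mult_left_mono) auto
  also have "\<dots> = 1 - real (card ?X) / real L + (real (card ?X) / real L)\<^sup>2"
    unfolding mult.assoc[symmetric] q1 by simp
  finally show ?thesis by (simp add: num_edges_def)
qed

text \<open>In the complement, vertices of one part can be adjacent only if they have the same type;
  across parts the types are free.\<close>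

lemma hom_density_complement_host:
  assumes H: "simple_graph H" and pos: "q > 0" "L > 0" "N > 0" and q: "chromatic_number H = Suc q"
  shows "hom_density H (complement (host q L N))
    \<le> real (card {p \<in> verts H \<rightarrow>\<^sub>E {..<q}. card (mono_edges (edges H) p) = 1}) / real q ^ num_verts H / real L
       + 1 / (real L)\<^sup>2"
proof -
  let ?V = "verts H" and ?X = "edges H"
  have V: "finite ?V" using H by (simp add: simple_graph_def)
  have X: "finite ?X" "\<And>e. e \<in> ?X \<Longrightarrow> e \<subseteq> ?V \<and> card e = 2"
    using finite_edges[OF H] H by (auto simp: simple_graph_def)
  define S where "S = (SIGMA p:?V \<rightarrow>\<^sub>E {..<q}. {t \<in> ?V \<rightarrow>\<^sub>E {..<L}. mono_edges ?X p \<subseteq> mono_edges ?X t})"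
  define N1 where "N1 = real (card {p \<in> ?V \<rightarrow>\<^sub>E {..<q}. card (mono_edges ?X p) = 1})"
  have fS: "finite S" unfolding S_def using V by (intro finite_SigmaI finite_subset[OF _ finite_PiE[of ?V "\<lambda>_. {..<L}"]] finite_PiE) auto
  have "hom_density H (complement (host q L N)) \<le> real (card S) / (real q * real L) ^ card ?V"
  proof (rule hom_density_host_le[OF V pos fS])
    fix f assume f: "f \<in> ?V \<rightarrow>\<^sub>E {..<q * L * N}" and hom: "\<forall>e\<in>?X. f ` e \<in> edges (complement (host q L N))"
    let ?p = "restrict (\<lambda>x. f x mod q) ?V" and ?t = "restrict (\<lambda>x. f x div q mod L) ?V"
    have "mono_edges ?X ?p \<subseteq> mono_edges ?X ?t"
    proof
      fix e assume "e \<in> mono_edges ?X ?p"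
      then have e: "e \<in> ?X" "card (?p ` e) = 1" by (auto simp: mono_edges_def)
      obtain x y where xy: "e = {x, y}" using X(2)[OF e(1)] by (auto simp: card_2_iff)
      have v: "x \<in> ?V" "y \<in> ?V" using X(2)[OF e(1)] xy by auto
      have "?p x = ?p y" using e(2) unfolding xy by (simp only: card_image_doubleton)
      then have "f x mod q = f y mod q" using v by simp
      moreover have "{f x, f y} \<in> edges (complement (host q L N))" using hom e xy by auto
      ultimately have "?t x = ?t y" using complement_host_edgeD v by simp
      then have "card (?t ` e) = 1" unfolding xy by (simp only: card_image_doubleton)
      then show "e \<in> mono_edges ?X ?t" using e by (simp add: mono_edges_def)
    qed
    then show "(?p, ?t) \<in> S" using pos by (auto simp: S_def)
  qed (simp add: complement_def host_def)
  also have "\<dots> \<le> real L ^ card ?V * (N1 / real L + real q ^ card ?V / (real L)\<^sup>2) / (real q * real L) ^ card ?V"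
    unfolding S_def N1_def
  proof (intro divide_right_mono card_refining_maps_le[OF V X pos(2)])
    fix p assume p: "p \<in> ?V \<rightarrow>\<^sub>E {..<q}"
    show "mono_edges ?X p \<noteq> {}"
    proof
      assume no: "mono_edges ?X p = {}"
      have "p x \<noteq> p y" if "{x, y} \<in> ?X" for x y
        using no that card_image_doubleton[of p x y] unfolding mono_edges_def by blast
      then have "proper_colouring H q p" using p by (auto simp: proper_colouring_def)
      then show False using chromatic_number_le[of H q p] q by simp
    qed
  qed auto
  also have "\<dots> = N1 / real q ^ num_verts H / real L + 1 / (real L)\<^sup>2"
  proof -
    have "real L ^ card ?V \<noteq> 0" "real q ^ card ?V \<noteq> 0" using pos by auto
    then show ?thesis by (simp add: power_mult_distrib num_verts_def add_divide_distrib mult.commute)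
  qed
  finally show ?thesis by (simp add: N1_def)
qed

text \<open>Maps that send different vertices to different residues modulo n are homomorphisms. The
  positive bound, uniform in \<open>N\<close>, serves the degenerate case of an empty
  \<open>H1\<close>.\<close>

lemma hom_density_complete_ge:
  assumes H: "simple_graph H" and pos: "verts H \<noteq> {}" "N > 0"
  defines "n \<equiv> card (verts H)"
  shows "1 / real n ^ n \<le> hom_density H (complement \<lparr>verts = {..<n * N}, edges = {}\<rparr>)"
proof -
  let ?V = "verts H" and ?G = "complement \<lparr>verts = {..<n * N}, edges = {} :: nat set set\<rparr>"
  have V: "finite ?V" using H by (simp add: simple_graph_def)
  have n: "n > 0" using V pos by (simp add: n_def card_gt_0_iff)
  obtain b where b: "bij_betw b ?V {0..<n}" using ex_bij_betw_finite_nat[OF V] by (auto simp: n_def)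
  have bn: "b x < n" if "x \<in> ?V" for x using b that by (auto simp: bij_betw_def)
  let ?A = "{f \<in> ?V \<rightarrow>\<^sub>E {..<n * N}. \<forall>e\<in>edges H. f ` e \<in> edges ?G}"
  let ?g = "\<lambda>h. restrict (\<lambda>x. b x + n * h x) ?V"
  have "card (?V \<rightarrow>\<^sub>E {..<N}) \<le> card ?A"
  proof (rule card_inj_on_le)
    show "inj_on ?g (?V \<rightarrow>\<^sub>E {..<N})"
    proof (rule inj_onI)
      fix h h' assume h: "h \<in> ?V \<rightarrow>\<^sub>E {..<N}" "h' \<in> ?V \<rightarrow>\<^sub>E {..<N}" and eq: "?g h = ?g h'"
      have "h x = h' x" if "x \<in> ?V" for x using fun_cong[OF eq, of x] that n by simp
      then show "h = h'" using h by (intro PiE_ext) auto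
    qed
    show "?g ` (?V \<rightarrow>\<^sub>E {..<N}) \<subseteq> ?A"
    proof (rule image_subsetI)
      fix h assume h: "h \<in> ?V \<rightarrow>\<^sub>E {..<N}"
      have lt: "b x + n * h x < n * N" if "x \<in> ?V" for x
      proof -
        have "b x + n * h x < n * Suc (h x)" using bn[OF that] by simp
        also have "\<dots> \<le> n * N" using h that by (intro mult_le_mono2) (auto simp: Suc_le_eq)
        finally show ?thesis .
      qed
      have "?g h ` e \<in> edges ?G" if e: "e \<in> edges H" for e
      proof -
        obtain x y where xy: "e = {x, y}" using e H by (auto simp: simple_graph_def card_2_iff)
        have s: "x \<in> ?V" "y \<in> ?V" "x \<noteq> y" using simple_edge[OF H] e xy by auto
        have "(b x + n * h x) mod n \<noteq> (b y + n * h y) mod n"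
          using s bn b by (auto simp: bij_betw_def inj_on_def)
        then have "b x + n * h x \<noteq> b y + n * h y" by metis
        then show ?thesis using s lt by (auto simp: xy complement_def)
      qed
      then show "?g h \<in> ?A" using lt by auto
    qed
    show "finite ?A" using V by (intro finite_subset[OF _ finite_PiE[of ?V "\<lambda>_. {..<n * N}"]]) auto
  qed
  then have "N ^ n \<le> card ?A" using V by (simp add: card_funcsetE n_def)
  then have "real (N ^ n) \<le> real (card ?A)" by (simp only: of_nat_le_iff)
  then have "real (N ^ n) / real ((n * N) ^ n) \<le> real (card ?A) / real ((n * N) ^ n)"
    by (rule divide_right_mono) simp
  also have "\<dots> = hom_density H ?G"
    using V by (simp add: hom_density_def complement_def card_funcsetE n_def)
  also have "real (N ^ n) / real ((n * N) ^ n) = 1 / real n ^ n"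
    using pos n by (simp add: power_mult_distrib)
  finally show ?thesis .
qed

lemma tendsto_zero_along_multiples:
  fixes \<delta> :: "nat \<Rightarrow> real"
  assumes "\<delta> \<longlonglongrightarrow> 0" "m > 0" "\<And>N. N > 0 \<Longrightarrow> x \<le> \<delta> (m * N)"
  shows "x \<le> 0"
proof -
  have "strict_mono (\<lambda>N. m * Suc N)" using assms(2) by (intro strict_monoI) simp
  then have "(\<delta> \<circ> (\<lambda>N. m * Suc N)) \<longlonglongrightarrow> 0" using assms(1) by (rule LIMSEQ_subseq_LIMSEQ[rotated])
  moreover have "\<forall>N\<ge>0. x \<le> (\<delta> \<circ> (\<lambda>N. m * Suc N)) N" unfolding o_def using assms(3) by blast
  ultimately show ?thesis by (blast intro: LIMSEQ_le_const)
qed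

theorem theorem5p4:
  fixes H1 :: "'a ugraph" and H2 :: "'b ugraph"
  assumes "simple_graph H1" and "simple_graph H2"
    and "chromatic_number H2 \<ge> 2"
    and "chromatic_number H2 \<noteq> 4 \<Longrightarrow>
      real (num_edges H1) >
        real (crit H2) * fact (chromatic_number H2 - 2)
          * (real (chromatic_number H2) - 2) powi
              (int (num_verts H2) - int (chromatic_number H2) - int (num_components H2) + 1)
          * (real (chromatic_number H1) - 1) ^ (num_verts H2 - num_components H2)
        / (real (chromatic_number H2) - 1) ^ (num_verts H2 - num_components H2)"
    and "chromatic_number H2 = 4 \<Longrightarrow>
      real (num_edges H1) >
        real (crit H2) * 2 powi (int (num_verts H2) - int (num_components H2) - 1)
          * (real (chromatic_number H1) - 1) ^ (num_verts H2 - num_components H2)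
        / 3 ^ (num_verts H2 - num_components H2)"
  shows "\<not> multiplicity_good H1 H2"
proof
  assume "multiplicity_good H1 H2"
  define q where "q = chromatic_number H2 - 1"
  have q: "chromatic_number H2 = Suc q" "q \<ge> 1" using assms(3) by (auto simp: q_def)
  define v k where "v = num_verts H2" and "k = num_components H2"
  define Y where "Y = (real (chromatic_number H1) - 1) ^ (v - k)"
  define K :: real where "K = (if q = 3 then 2 powi (int v - int k - 1)
    else fact (q - 1) * (real q - 1) powi (int v - int q - int k))"
  have hyp: "real (num_edges H1) > real (crit H2) * K * Y / real q ^ (v - k)"
  proof (cases "q = 3")
    case True
    then show ?thesis using assms(5) q by (simp add: K_def Y_def v_def k_def)
  next
    case False
    have "int v - int (chromatic_number H2) - int k + 1 = int v - int q - int k" using q by simp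
    moreover have "real (chromatic_number H2) - 2 = real q - 1" "chromatic_number H2 - 2 = q - 1"
      "real (chromatic_number H2) - 1 = real q"
      using q by simp_all
    moreover have "chromatic_number H2 \<noteq> 4" using False q by simp
    ultimately show ?thesis
      using assms(4) False by (simp only: K_def Y_def v_def k_def if_False mult.assoc not_False_eq_True)
  qed
  have K0: "0 \<le> K" using q by (auto simp: K_def)
  obtain \<delta> :: "nat \<Rightarrow> real" where \<delta>: "\<delta> \<longlonglongrightarrow> 0"
    and good: "\<And>G :: nat ugraph. simple_graph G \<Longrightarrow>
      1 - \<delta> (num_verts G) \<le> real q ^ (num_verts H1 - num_components H1) * hom_density H1 G
        + Y * hom_density H2 (complement G)"
    using \<open>multiplicity_good H1 H2\<close> q by (auto simp: multiplicity_good_def Y_def v_def k_def)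
  show False
  proof (cases "chromatic_number H1 = 0")
    \<comment> \<open>\<open>H1\<close> is empty and \<open>Y\<close> is a power of -1. The strict
      hypothesis with no edges forces \<open>Y\<close> = -1, so for edgeless hosts the left side is
      1 minus a density bounded away from 0.\<close>
    case True
    then have "verts H1 = {}"
      using ex_proper_colouring[OF assms(1)] by (auto simp: proper_colouring_def)
    then have e1: "edges H1 = {}" using assms(1) by (auto simp: simple_graph_def)
    then have "real (crit H2) * K * Y / real q ^ (v - k) < 0" using hyp by (simp add: num_edges_def)
    then have "Y < 0"
      using K0 by (metis divide_nonneg_nonneg mult_nonneg_nonneg not_less of_nat_0_le_iff zero_le_power)
    then have Y: "Y = - 1" using True minus_one_power_iff[of "v - k", where 'a = real]
      by (auto simp: Y_def split: if_splits)
    have ne: "verts H2 \<noteq> {}"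
    proof
      assume "verts H2 = {}"
      then have "proper_colouring H2 0 (\<lambda>_. 0)"
        using simple_edge(1)[OF assms(2)] by (auto simp: proper_colouring_def)
      then show False using chromatic_number_le[of H2 0] q by simp
    qed
    define n where "n = card (verts H2)"
    have n: "n > 0" using ne assms(2) by (auto simp: n_def simple_graph_def card_gt_0_iff)
    have "1 / real n ^ n \<le> \<delta> (n * N)" if N: "N > 0" for N
    proof -
      let ?G = "\<lparr>verts = {..<n * N}, edges = {} :: nat set set\<rparr>"
      have "simple_graph ?G" by (simp add: simple_graph_def)
      moreover have "hom_density H1 ?G = 1"
        using \<open>verts H1 = {}\<close> e1 by (simp add: hom_density_def)
      ultimately have "hom_density H2 (complement ?G) \<le> \<delta> (n * N)"
        using good[of ?G] \<open>verts H1 = {}\<close> by (simp add: Y num_verts_def)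
      moreover have "1 / real n ^ n \<le> hom_density H2 (complement ?G)"
        unfolding n_def by (rule hom_density_complete_ge[OF assms(2) ne N])
      ultimately show ?thesis by linarith
    qed
    then have "1 / real n ^ n \<le> 0" by (rule tendsto_zero_along_multiples[OF \<delta> n])
    moreover have "0 < 1 / real n ^ n" using n by simp
    ultimately show False by linarith
  next
    case False
    then have Y0: "0 \<le> Y" by (simp add: Y_def)
    define N1 where "N1 = real (card {p \<in> verts H2 \<rightarrow>\<^sub>E {..<q}. card (mono_edges (edges H2) p) = 1})"
    define m where "m = real (num_edges H1)"
    have "N1 \<le> real (crit H2) * (real q ^ k * K)"
      unfolding N1_def
    proof (rule card_one_mono_maps_le[OF assms(2) q(1)])
      fix a b assume "uncolourable_edge H2 a b q"
      then interpret uncolourable_edge H2 a b q .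
      show "real (card (cols q (adj (edges H2 - {{a, b}})) (verts H2))) \<le> real q ^ k * K"
        using edge_bound edge_bound_3 q by (auto simp: K_def v_def k_def)
    qed
    then have "Y * (N1 / real q ^ v) \<le> Y * (real (crit H2) * (real q ^ k * K) / real q ^ v)"
      using Y0 by (intro mult_left_mono divide_right_mono) auto
    also have "\<dots> = real (crit H2) * K * Y / real q ^ (v - k)"
    proof -
      obtain R where "R \<subseteq> verts H2" "card R = k"
        using ex_representatives[OF assms(2)] by (metis k_def)
      then have "k \<le> v" using assms(2) unfolding v_def num_verts_def simple_graph_def by (metis card_mono)
      then have "real q ^ v = real q ^ k * real q ^ (v - k)" by (simp add: power_add[symmetric])
      then show ?thesis using q by simp
    qed
    also have "\<dots> < m" using hyp by (simp add: m_def)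
    finally have d: "0 < m - Y * (N1 / real q ^ v)" by simp
    define d where "d = m - Y * (N1 / real q ^ v)"
    \<comment> \<open>\<open>L\<close> is fixed so large that the gain d/L exceeds the second-order
      error (m^2 + Y)/L^2; their difference \<open>x\<close> contradicts the vanishing error term
      along the blow-ups.\<close>
    obtain L :: nat where "(m\<^sup>2 + Y) / d < real L" using reals_Archimedean2 by blast
    then have L: "m\<^sup>2 + Y < d * real L" using d by (simp add: d_def pos_divide_less_eq mult.commute)
    have "0 \<le> m\<^sup>2 + Y" using Y0 by simp
    then have L0: "L > 0" using L by (cases L) auto
    define x where "x = d / real L - (m\<^sup>2 + Y) / (real L)\<^sup>2"
    have "x = (d * real L - (m\<^sup>2 + Y)) / (real L)\<^sup>2"
      using L0 by (simp add: x_def diff_divide_distrib power2_eq_square)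
    then have x: "0 < x" using L L0 by simp
    have "x \<le> \<delta> (q * L * N)" if N: "N > 0" for N
    proof -
      have "1 - \<delta> (q * L * N) \<le> real q ^ (num_verts H1 - num_components H1) * hom_density H1 (host q L N)
          + Y * hom_density H2 (complement (host q L N))"
        using good[OF simple_host, of q L N] by (simp add: num_verts_def host_def)
      also have "\<dots> \<le> (1 - m / real L + (m / real L)\<^sup>2) + Y * (N1 / real q ^ v / real L + 1 / (real L)\<^sup>2)"
        using hom_density_host[OF assms(1), of q L N] hom_density_complement_host[OF assms(2), of q L N]
          q L0 N Y0
        by (intro add_mono mult_left_mono) (auto simp: m_def N1_def v_def)
      also have "\<dots> = 1 - x"
        by (simp add: x_def d_def power_divide diff_divide_distrib add_divide_distrib algebra_simps)
      finally show ?thesis by simp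
    qed
    then have "x \<le> 0" using q L0 by (intro tendsto_zero_along_multiples[OF \<delta>, of "q * L"]) auto
    then show False using x by simp
  qed
qed

end
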